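(* Let $d\ge2$, $\gamma\in(0,\frac12]$, and let $v\in C^\gamma_c(\mathbb{R}^d)$ be a compactly supported divergence-free vector field $v:\mathbb{R}^d\to\mathbb{R}^d$. Then there exists a unique solution $q$, decaying at infinity, of $$-\Delta q=\operatorname{div}\operatorname{div}(v\otimes v)=\sum_{i,j=1}^d\partial_i\partial_j(v^iv^j)\quad\text{in }\mathbb{R}^d,$$ and it satisfies $$\|q\|_{C^{2\gamma}_*(\mathbb{R}^d)}\le C\|v\|^2_{C^\gamma(\mathbb{R}^d)}$$ for a constant $C>0$.
   Context: $C^\gamma_c(\mathbb{R}^d)$ is the set of compactly supported $\gamma$-Hölder continuous functions, with $\|f\|_{C^\gamma(\mathbb{R}^d)}=\|f\|_{L^\infty}+\sup_{x\neq y}|f(x)-f(y)|/|x-y|^\gamma$. The divergence-free condition and the equation are understood in the sense of distributions, and "decaying at infinity" means $q(x)\to0$ as $|x|\to\infty$. Hölder–Zygmund norm: fix a smooth radial $\varphi\ge0$ supported in $\{|\xi|\le2\}$ with $\varphi=1$ on $\{|\xi|\le1\}$; set $\mathbf P_1(\xi)=\varphi(\xi)$ and $\mathbf P_N(\xi)=\varphi(\xi/N)-\varphi(2\xi/N)$ for dyadic $N=2^k$, $k\ge1$; let $f_N=\mathcal F^{-1}(\mathbf P_N\hat f)$. Then $\|f\|_{C^s_*(\mathbb{R}^d)}=\sup_{N\in\{1,2,4,\dots\}}N^s\|f_N\|_{L^\infty}$. For $s\in(0,1)$ this is equivalent to the usual $C^s$ norm, and for $s=1$ to $\|f\|_{L^\infty}+\sup_{x,\,h\neq0}|f(x+h)+f(x-h)-2f(x)|/|h|$.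 *)

theory Defs
  imports "HOL-Analysis.Analysis" "HOL-Probability.Essential_Supremum"
begin

section \<open>Function norms\<close>

text \<open>All norms take values in \<^typ>\<open>ennreal\<close>, so that finiteness expresses membership in the
  corresponding space.\<close>

definition Linf_norm :: "(real^'n \<Rightarrow> 'b::real_normed_vector) \<Rightarrow> ennreal" where
  "Linf_norm f = e2ennreal (esssup lborel (\<lambda>x. ereal (norm (f x))))"

definition holder_norm :: "real \<Rightarrow> (real^'n \<Rightarrow> 'b::real_normed_vector) \<Rightarrow> ennreal" where
  "holder_norm \<gamma> f = Linf_norm f +
     (SUP (x, y)\<in>{(x, y). x \<noteq> y}. ennreal (norm (f x - f y) / norm (x - y) powr \<gamma>))"

definition fun_support :: "(real^'n \<Rightarrow> 'b::zero) \<Rightarrow> (real^'n) set" where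
  "fun_support f = closure {x. f x \<noteq> 0}"

definition holder_compact :: "real \<Rightarrow> (real^'n \<Rightarrow> 'b::real_normed_vector) set" where
  "holder_compact \<gamma> = {f. holder_norm \<gamma> f < \<infinity> \<and> compact (fun_support f)}"

section \<open>Smooth functions and test functions\<close>

definition pd :: "'n \<Rightarrow> (real^'n \<Rightarrow> 'b::real_normed_vector) \<Rightarrow> real^'n \<Rightarrow> 'b" where
  "pd i f = (\<lambda>x. frechet_derivative f (at x) (axis i 1))"

primrec iter_pd :: "'n list \<Rightarrow> (real^'n \<Rightarrow> 'b::real_normed_vector) \<Rightarrow> real^'n \<Rightarrow> 'b" where
  "iter_pd [] f = f"
| "iter_pd (i # is) f = pd i (iter_pd is f)"

definition smooth_fun :: "(real^'n \<Rightarrow> 'b::real_normed_vector) \<Rightarrow> bool" where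
  "smooth_fun f \<longleftrightarrow> (\<forall>is. iter_pd is f differentiable_on UNIV)"

definition test_functions :: "(real^'n \<Rightarrow> real) set" where
  "test_functions = {\<phi>. smooth_fun \<phi> \<and> compact (fun_support \<phi>)}"

definition schwartz :: "(real^'n \<Rightarrow> complex) set" where
  "schwartz = {\<psi>. smooth_fun \<psi> \<and>
     (\<forall>k is. bounded (range (\<lambda>x. norm x ^ k *\<^sub>R iter_pd is \<psi> x)))}"

section \<open>Distributions and the pressure equation\<close>

text \<open>A distribution is represented by a functional of which only the values on
  \<^const>\<open>test_functions\<close> matter; equations between distributions are therefore required
  on \<^const>\<open>test_functions\<close> only.\<close>

definition distr_of :: "(real^'n \<Rightarrow> real) \<Rightarrow> (real^'n \<Rightarrow> real) \<Rightarrow> real" where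
  "distr_of f = (\<lambda>\<phi>. LINT x|lborel. f x * \<phi> x)"

definition distr_pd ::
    "'n \<Rightarrow> ((real^'n \<Rightarrow> real) \<Rightarrow> real) \<Rightarrow> (real^'n \<Rightarrow> real) \<Rightarrow> real" where
  "distr_pd i T = (\<lambda>\<phi>. - T (pd i \<phi>))"

definition div_free :: "(real^'n \<Rightarrow> real^'n) \<Rightarrow> bool" where
  "div_free v \<longleftrightarrow>
     (\<forall>\<phi>\<in>test_functions. (\<Sum>i\<in>UNIV. distr_pd i (distr_of (\<lambda>x. v x $ i)) \<phi>) = 0)"

definition locally_integrable :: "(real^'n \<Rightarrow> real) \<Rightarrow> bool" where
  "locally_integrable q \<longleftrightarrow> (\<forall>S. compact S \<longrightarrow> set_integrable lborel S q)"

definition solves_pressure_eq :: "(real^'n \<Rightarrow> real^'n) \<Rightarrow> (real^'n \<Rightarrow> real) \<Rightarrow> bool" where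
  "solves_pressure_eq v q \<longleftrightarrow> locally_integrable q \<and>
     (\<forall>\<phi>\<in>test_functions.
        - (\<Sum>i\<in>UNIV. distr_pd i (distr_pd i (distr_of q)) \<phi>) =
        (\<Sum>i\<in>UNIV. \<Sum>j\<in>UNIV. distr_pd i (distr_pd j (distr_of (\<lambda>x. v x $ i * v x $ j))) \<phi>))"

definition decaying_solution :: "(real^'n \<Rightarrow> real^'n) \<Rightarrow> (real^'n \<Rightarrow> real) \<Rightarrow> bool" where
  "decaying_solution v q \<longleftrightarrow> solves_pressure_eq v q \<and> (q \<longlongrightarrow> 0) at_infinity"

section \<open>Tempered distributions and the Fourier transform\<close>

definition fourier :: "(real^'n \<Rightarrow> complex) \<Rightarrow> real^'n \<Rightarrow> complex" where
  "fourier \<psi> = (\<lambda>\<xi>. LINT x|lborel. exp (- (\<i> * complex_of_real (x \<bullet> \<xi>))) * \<psi> x)"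

definition inv_fourier :: "(real^'n \<Rightarrow> complex) \<Rightarrow> real^'n \<Rightarrow> complex" where
  "inv_fourier \<psi> = (\<lambda>x. complex_of_real (1 / (2 * pi) ^ CARD('n)) *
     (LINT \<xi>|lborel. exp (\<i> * complex_of_real (x \<bullet> \<xi>)) * \<psi> \<xi>))"

text \<open>As above, a tempered distribution is a functional of which only the values on
  \<^const>\<open>schwartz\<close> matter; the operations below are defined by duality.  The pairing
  is bilinear, without complex conjugation.\<close>

definition temp_of :: "(real^'n \<Rightarrow> complex) \<Rightarrow> (real^'n \<Rightarrow> complex) \<Rightarrow> complex" where
  "temp_of f = (\<lambda>\<psi>. LINT x|lborel. f x * \<psi> x)"

definition temp_fourier ::
    "((real^'n \<Rightarrow> complex) \<Rightarrow> complex) \<Rightarrow> (real^'n \<Rightarrow> complex) \<Rightarrow> complex" where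
  "temp_fourier T = (\<lambda>\<psi>. T (fourier \<psi>))"

definition temp_inv_fourier ::
    "((real^'n \<Rightarrow> complex) \<Rightarrow> complex) \<Rightarrow> (real^'n \<Rightarrow> complex) \<Rightarrow> complex" where
  "temp_inv_fourier T = (\<lambda>\<psi>. T (inv_fourier \<psi>))"

definition temp_mult ::
    "(real^'n \<Rightarrow> real) \<Rightarrow> ((real^'n \<Rightarrow> complex) \<Rightarrow> complex) \<Rightarrow> (real^'n \<Rightarrow> complex) \<Rightarrow> complex" where
  "temp_mult m T = (\<lambda>\<psi>. T (\<lambda>\<xi>. complex_of_real (m \<xi>) * \<psi> \<xi>))"

text \<open>The essential sup norm of the bounded function representing a tempered distribution.
  The representing function is unique almost everywhere; if there is none, the value
  is \<^term>\<open>Inf {} = (\<infinity> :: ennreal)\<close>.\<close>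

definition temp_Linf :: "((real^'n \<Rightarrow> complex) \<Rightarrow> complex) \<Rightarrow> ennreal" where
  "temp_Linf T = Inf {Linf_norm g | g. g \<in> borel_measurable lborel \<and> Linf_norm g < \<infinity> \<and>
     (\<forall>\<psi>\<in>schwartz. T \<psi> = temp_of g \<psi>)}"

section \<open>The Hoelder-Zygmund norm\<close>

definition lp_cutoff :: "(real^'n \<Rightarrow> real) \<Rightarrow> bool" where
  "lp_cutoff \<phi> \<longleftrightarrow> smooth_fun \<phi> \<and> (\<forall>\<xi> \<eta>. norm \<xi> = norm \<eta> \<longrightarrow> \<phi> \<xi> = \<phi> \<eta>) \<and> (\<forall>\<xi>. 0 \<le> \<phi> \<xi>) \<and>
     fun_support \<phi> \<subseteq> {\<xi>. norm \<xi> \<le> 2} \<and> (\<forall>\<xi>. norm \<xi> \<le> 1 \<longrightarrow> \<phi> \<xi> = 1)"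

text \<open>The index \<open>k\<close> stands for the dyadic frequency \<open>N = 2 ^ k\<close>.\<close>

definition lp_symbol :: "(real^'n \<Rightarrow> real) \<Rightarrow> nat \<Rightarrow> real^'n \<Rightarrow> real" where
  "lp_symbol \<phi> k \<xi> =
     (if k = 0 then \<phi> \<xi> else \<phi> ((1 / 2 ^ k) *\<^sub>R \<xi>) - \<phi> ((2 / 2 ^ k) *\<^sub>R \<xi>))"

definition lp_piece ::
    "(real^'n \<Rightarrow> real) \<Rightarrow> nat \<Rightarrow> (real^'n \<Rightarrow> real) \<Rightarrow> (real^'n \<Rightarrow> complex) \<Rightarrow> complex" where
  "lp_piece \<phi> k f = temp_inv_fourier (temp_mult (lp_symbol \<phi> k)
     (temp_fourier (temp_of (\<lambda>x. complex_of_real (f x)))))"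

text \<open>Meaningful for \<open>f\<close> defining a tempered distribution, for instance for locally integrable
  \<open>f\<close> tending to \<open>0\<close> at infinity.\<close>

definition zygmund_norm ::
    "(real^'n \<Rightarrow> real) \<Rightarrow> real \<Rightarrow> (real^'n \<Rightarrow> real) \<Rightarrow> ennreal" where
  "zygmund_norm \<phi> s f = (SUP k. ennreal ((2 ^ k) powr s) * temp_Linf (lp_piece \<phi> k f))"

end

theory Submission
  imports Defs "HOL-Probability.Sinc_Integral"
begin

text \<open>
  Let \<open>\<sigma>\<close> be a radial test function with \<open>\<nabla>\<sigma>(z) = - z \<phi>(z)\<close>, so that the rescalings \<open>\<phi>\<^sub>t\<close> and \<open>\<sigma>\<^sub>t\<close>
  satisfy \<open>\<partial>\<^sub>t \<phi>\<^sub>t = t \<Delta>\<sigma>\<^sub>t\<close>. Integrating in \<open>t\<close>, the function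
  \<open>q = (1 / \<integral>\<phi>) \<integral>\<^sub>0\<^sup>\<infinity> t (\<partial>\<^sub>i \<partial>\<^sub>j \<sigma>\<^sub>t) * (v\<^sup>i v\<^sup>j) dt\<close>
  solves the equation. As \<open>v\<close> is divergence free, \<open>v\<^sup>i v\<^sup>j\<close> may be replaced by
  \<open>(v\<^sup>i - v\<^sup>i(y)) (v\<^sup>j - v\<^sup>j(y))\<close> in \<open>((\<partial>\<^sub>i \<partial>\<^sub>j \<eta>) * (v\<^sup>i v\<^sup>j))(y)\<close> for every rapidly decaying smooth \<open>\<eta>\<close>; the factor
  \<open>\<bar>x - y\<bar>\<^bsup>2\<gamma>\<^esup>\<close> gained in this way makes the \<open>t\<close>-integral converge at \<open>0\<close>. It also bounds the
  Littlewood-Paley pieces: the kernel of a frequency band is \<open>\<Delta>\<eta>\<close> with \<open>\<eta>\<close> rapidly decaying, and the equation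
  turns \<open>q * \<Delta>\<eta>\<close> into \<open>- (\<partial>\<^sub>i \<partial>\<^sub>j \<eta>) * (v\<^sup>i v\<^sup>j)\<close>. Uniqueness follows from the same family \<open>\<phi>\<^sub>t\<close>: the
  mollification of a decaying harmonic distribution by \<open>\<phi>\<^sub>t\<close> does not depend on \<open>t\<close> and vanishes as \<open>t \<rightarrow> \<infinity>\<close>.
\<close>

section \<open>Smooth functions\<close>

text \<open>The products of the components of \<open>v\<close> are only \<gamma>-Hoelder, so
  singular integrals applied to \<open>v \<otimes> v\<close> would give only half of the claimed
  exponent. The doubling is available only where \<open>v \<otimes> v\<close> is paired with the
  Hessian of a single function, and the proof is arranged so that every estimate at small scales or
  high frequencies has this form. The cutoff \<open>\<phi>\<close>, given as a frequency symbol, is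
  used a second time as a mollifier in physical space. Being radial, it makes z \<phi>(z) a
  gradient, which is the origin of \<sigma>; this replaces the Newtonian kernel and its singularity
  by a family of smooth compactly supported kernels. At large scales and for the lowest frequency
  piece the cancellation gives nothing useful. There the size and the support of \<open>v\<close>
  are used, and through them the constant depends on the support. Littlewood-Paley kernels are not
  compactly supported, so the cancellation and the equation are proved for a class wider than the
  test functions, \<open>smooth_W\<close>.\<close>

lemma pd_eq: "(f has_derivative f') (at x) \<Longrightarrow> pd i f x = f' (axis i 1)"
  unfolding pd_def by (metis frechet_derivative_at)

lemma has_derivative_pd:
  fixes f :: "real^'n \<Rightarrow> 'b::real_normed_vector"
  assumes "f differentiable (at x)"
  shows "(f has_derivative (\<lambda>h. \<Sum>i\<in>UNIV. h $ i *\<^sub>R pd i f x)) (at x)"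
proof -
  obtain D where D: "(f has_derivative D) (at x)"
    using assms by (auto simp: differentiable_def)
  then have lin: "linear D" by (simp add: has_derivative_linear)
  have "D h = (\<Sum>i\<in>UNIV. h $ i *\<^sub>R pd i f x)" for h
  proof -
    have "D h = D (\<Sum>i\<in>UNIV. h $ i *\<^sub>R axis i 1)"
      using basis_expansion[of h] by (simp add: scalar_mult_eq_scaleR)
    also have "\<dots> = (\<Sum>i\<in>UNIV. h $ i *\<^sub>R D (axis i 1))"
      using lin by (simp add: linear_sum linear_cmul)
    finally show ?thesis by (simp add: pd_eq[OF D])
  qed
  then have "D = (\<lambda>h. \<Sum>i\<in>UNIV. h $ i *\<^sub>R pd i f x)" by (rule ext)
  then show ?thesis using D by simp
qed

lemma iter_pd_snoc: "iter_pd (is @ [i]) f = iter_pd is (pd i f)"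
  by (induction "is") auto

text \<open>\<open>iter_pd\<close> puts each new derivative on the outside;
  \<open>iter_pd_snoc\<close> peels off the innermost one instead, which is what arguments about the
  function itself need.\<close>

lemma smooth_fun_iff:
  "smooth_fun f \<longleftrightarrow> f differentiable_on UNIV \<and> (\<forall>i. smooth_fun (pd i f))"
proof
  assume f: "smooth_fun f"
  have "f differentiable_on UNIV" using f[unfolded smooth_fun_def, rule_format, of "[]"] by simp
  moreover have "smooth_fun (pd i f)" for i
    using f unfolding smooth_fun_def by (metis iter_pd_snoc)
  ultimately show "f differentiable_on UNIV \<and> (\<forall>i. smooth_fun (pd i f))" by blast
next
  assume f: "f differentiable_on UNIV \<and> (\<forall>i. smooth_fun (pd i f))"
  show "smooth_fun f"
    unfolding smooth_fun_def
  proof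
    fix "is" show "iter_pd is f differentiable_on UNIV"
      using f by (cases "is" rule: rev_cases) (auto simp: iter_pd_snoc smooth_fun_def)
  qed
qed

lemma smooth_fun_pd: "smooth_fun f \<Longrightarrow> smooth_fun (pd i f)"
  using smooth_fun_iff by blast

lemma smooth_fun_iter_pd: "smooth_fun f \<Longrightarrow> smooth_fun (iter_pd is f)"
  by (induction "is") (auto intro: smooth_fun_pd)

lemma smooth_fun_continuous: "smooth_fun f \<Longrightarrow> continuous_on UNIV f"
  using smooth_fun_iff by (blast intro: differentiable_imp_continuous_on)

lemma smooth_fun_measurable: "smooth_fun f \<Longrightarrow> f \<in> borel_measurable borel"
  by (rule borel_measurable_continuous_onI) (rule smooth_fun_continuous)

text \<open>Meant for families with explicit derivatives: naming a class that contains its own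
  partial derivatives replaces an induction over index lists.\<close>

lemma smooth_fun_coinduct:
  assumes "P f"
    and step: "\<And>f. P f \<Longrightarrow> f differentiable_on UNIV \<and> (\<forall>i. P (pd i f))"
  shows "smooth_fun f"
proof -
  have "P (iter_pd is f)" for "is" by (induction "is") (auto simp: assms(1) step)
  then show ?thesis using step by (auto simp: smooth_fun_def)
qed

section \<open>Differentiability up to a finite order\<close>

text \<open>Stratifies smoothness by order. The derivative of a product is a sum of products, so
  closure under products is proved by induction on the order, for which \<open>smooth_fun\<close>
  itself offers no handle.\<close>

primrec differentiable_times :: "nat \<Rightarrow> (real^'n \<Rightarrow> 'b::real_normed_vector) \<Rightarrow> bool" where
  "differentiable_times 0 f \<longleftrightarrow> True"
| "differentiable_times (Suc n) f \<longleftrightarrow>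
     f differentiable_on UNIV \<and> (\<forall>i. differentiable_times n (pd i f))"

lemma smooth_fun_iff_differentiable_times:
  fixes f :: "real^'n \<Rightarrow> 'b::real_normed_vector"
  shows "smooth_fun f \<longleftrightarrow> (\<forall>n. differentiable_times n f)"
proof
  assume "smooth_fun f"
  then have "differentiable_times n f" for n
  proof (induction n arbitrary: f)
    case (Suc n)
    then show ?case using smooth_fun_iff[of f] by simp
  qed simp
  then show "\<forall>n. differentiable_times n f" ..
next
  assume "\<forall>n. differentiable_times n f"
  then show "smooth_fun f"
  proof (rule smooth_fun_coinduct[where P="\<lambda>f. \<forall>n. differentiable_times n f"])
    fix f :: "real^'n \<Rightarrow> 'b" assume *: "\<forall>n. differentiable_times n f"
    then have "differentiable_times (Suc n) f" for n ..
    then show "f differentiable_on UNIV \<and> (\<forall>i. \<forall>n. differentiable_times n (pd i f))" by simp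
  qed
qed

lemma differentiable_times_Suc: "differentiable_times (Suc n) f \<Longrightarrow> differentiable_times n f"
  by (induction n arbitrary: f) auto

section \<open>Derivative rules and closure properties of smooth functions\<close>

lemma pd_const: "pd i (\<lambda>x. c) = (\<lambda>x. 0)"
  by (rule ext) (rule pd_eq[OF has_derivative_const])

lemma pd_nth: "pd i (\<lambda>x::real^'n. x $ j) = (\<lambda>x. if i = j then 1 else 0)"
proof
  fix x :: "real^'n"
  have "((\<lambda>x::real^'n. x $ j) has_derivative (\<lambda>h. h $ j)) (at x)"
    by (rule bounded_linear_imp_has_derivative) (rule bounded_linear_vec_nth)
  from pd_eq[OF this] show "pd i (\<lambda>x. x $ j) x = (if i = j then 1 else 0)"
    by (auto simp: axis_def)
qed

lemma pd_add:
  assumes "f differentiable_on UNIV" "g differentiable_on UNIV"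
  shows "pd i (\<lambda>x. f x + g x) = (\<lambda>x. pd i f x + pd i g x)"
proof
  fix x
  obtain f' g' where *: "(f has_derivative f') (at x)" "(g has_derivative g') (at x)"
    using assms by (force simp: differentiable_on_def differentiable_def)
  show "pd i (\<lambda>x. f x + g x) x = pd i f x + pd i g x"
    using pd_eq[OF has_derivative_add[OF *]] pd_eq[OF *(1)] pd_eq[OF *(2)] by simp
qed

lemma pd_scaleR:
  assumes "f differentiable_on UNIV"
  shows "pd i (\<lambda>x. c *\<^sub>R f x) = (\<lambda>x. c *\<^sub>R pd i f x)"
proof
  fix x
  obtain f' where *: "(f has_derivative f') (at x)"
    using assms by (auto simp: differentiable_on_def differentiable_def)
  show "pd i (\<lambda>x. c *\<^sub>R f x) x = c *\<^sub>R pd i f x"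
    using pd_eq[OF has_derivative_scaleR_right[OF *]] pd_eq[OF *] by simp
qed

lemma pd_mult:
  fixes f g :: "real^'n \<Rightarrow> real"
  assumes "f differentiable_on UNIV" "g differentiable_on UNIV"
  shows "pd i (\<lambda>x. f x * g x) = (\<lambda>x. f x * pd i g x + pd i f x * g x)"
proof
  fix x
  obtain f' g' where *: "(f has_derivative f') (at x)" "(g has_derivative g') (at x)"
    using assms by (force simp: differentiable_on_def differentiable_def)
  show "pd i (\<lambda>x. f x * g x) x = f x * pd i g x + pd i f x * g x"
    using pd_eq[OF has_derivative_mult[OF *]] pd_eq[OF *(1)] pd_eq[OF *(2)] by simp
qed

lemma pd_affine:
  fixes f :: "real^'n \<Rightarrow> 'b::real_normed_vector"
  assumes "f differentiable_on UNIV"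
  shows "pd i (\<lambda>x. f (c *\<^sub>R x + b)) = (\<lambda>x. c *\<^sub>R pd i f (c *\<^sub>R x + b))"
proof
  fix x
  obtain f' where f': "(f has_derivative f') (at (c *\<^sub>R x + b))"
    using assms by (auto simp: differentiable_on_def differentiable_def)
  have "((\<lambda>x. f (c *\<^sub>R x + b)) has_derivative (\<lambda>h. f' (c *\<^sub>R h))) (at x)"
    by (rule has_derivative_compose[where g=f and f="\<lambda>x. c *\<^sub>R x + b" and f'="\<lambda>h. c *\<^sub>R h", OF _ f'])
       (auto intro!: derivative_eq_intros)
  from pd_eq[OF this] show "pd i (\<lambda>x. f (c *\<^sub>R x + b)) x = c *\<^sub>R pd i f (c *\<^sub>R x + b)"
    using has_derivative_linear[OF f'] by (simp add: linear_cmul pd_eq[OF f'])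
qed

lemma differentiable_affine:
  fixes f :: "real^'n \<Rightarrow> 'b::real_normed_vector"
  assumes "f differentiable_on UNIV"
  shows "(\<lambda>x. f (c *\<^sub>R x + b)) differentiable_on UNIV"
proof -
  have "(\<lambda>x. f (c *\<^sub>R x + b)) differentiable (at x)" for x
  proof -
    obtain f' where f': "(f has_derivative f') (at (c *\<^sub>R x + b))"
      using assms by (auto simp: differentiable_on_def differentiable_def)
    have "((\<lambda>x. f (c *\<^sub>R x + b)) has_derivative (\<lambda>h. f' (c *\<^sub>R h))) (at x)"
      by (rule has_derivative_compose[where g=f and f="\<lambda>x. c *\<^sub>R x + b" and f'="\<lambda>h. c *\<^sub>R h", OF _ f'])
         (auto intro!: derivative_eq_intros)
    then show ?thesis by (auto simp: differentiable_def)
  qed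
  then show ?thesis by (simp add: differentiable_on_def)
qed

lemma differentiable_scaleR_fun:
  "f differentiable_on UNIV \<Longrightarrow> (\<lambda>x. c *\<^sub>R f x) differentiable_on UNIV"
  by (auto simp: differentiable_on_def intro!: differentiable_scaleR)

lemma iter_pd_affine:
  fixes f :: "real^'n \<Rightarrow> 'b::real_normed_vector"
  assumes "smooth_fun f"
  shows "iter_pd is (\<lambda>x. f (c *\<^sub>R x + b)) = (\<lambda>x. c ^ length is *\<^sub>R iter_pd is f (c *\<^sub>R x + b))"
proof (induction "is")
  case (Cons i "is")
  have d: "iter_pd is f differentiable_on UNIV"
    using smooth_fun_iter_pd[OF assms] smooth_fun_iff by blast
  show ?case
    by (simp add: Cons pd_scaleR[OF differentiable_affine[OF d]] pd_affine[OF d] mult.commute)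
qed simp

lemma smooth_fun_affine:
  fixes f :: "real^'n \<Rightarrow> 'b::real_normed_vector"
  assumes "smooth_fun f"
  shows "smooth_fun (\<lambda>x. f (c *\<^sub>R x + b))"
  unfolding smooth_fun_def
proof
  fix "is"
  have "iter_pd is f differentiable_on UNIV" using assms by (simp add: smooth_fun_def)
  then have "(\<lambda>x. c ^ length is *\<^sub>R iter_pd is f (c *\<^sub>R x + b)) differentiable_on UNIV"
    by (intro differentiable_scaleR_fun differentiable_affine)
  then show "iter_pd is (\<lambda>x. f (c *\<^sub>R x + b)) differentiable_on UNIV"
    by (subst iter_pd_affine[OF assms])
qed

lemma differentiable_times_const: "differentiable_times n (\<lambda>x. c)"
proof (induction n arbitrary: c)
  case (Suc n)
  show ?case unfolding differentiable_times.simps pd_const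
    using Suc by (auto intro: differentiable_on_const)
qed simp

lemma differentiable_times_nth: "differentiable_times n (\<lambda>x::real^'n. x $ j)"
proof (cases n)
  case (Suc m)
  have "(\<lambda>x::real^'n. x $ j) differentiable_on UNIV"
    by (rule bounded_linear_imp_differentiable_on) (rule bounded_linear_vec_nth)
  moreover have "differentiable_times m (pd i (\<lambda>x::real^'n. x $ j))" for i
    unfolding pd_nth by (rule differentiable_times_const)
  ultimately show ?thesis using Suc by simp
qed simp

lemma differentiable_times_add:
  "differentiable_times n f \<Longrightarrow> differentiable_times n g \<Longrightarrow> differentiable_times n (\<lambda>x. f x + g x)"
proof (induction n arbitrary: f g)
  case (Suc n)
  have "differentiable_times n (pd i (\<lambda>x. f x + g x))" for i
    using Suc by (subst pd_add) simp_all
  then show ?case using Suc.prems differentiable_on_add[of f UNIV g] by simp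
qed simp

lemma differentiable_times_mult:
  fixes f g :: "real^'n \<Rightarrow> real"
  shows "differentiable_times n f \<Longrightarrow> differentiable_times n g \<Longrightarrow> differentiable_times n (\<lambda>x. f x * g x)"
proof (induction n arbitrary: f g)
  case (Suc n)
  then have "differentiable_times n f" "differentiable_times n g"
    using differentiable_times_Suc by blast+
  then have "differentiable_times n (pd i (\<lambda>x. f x * g x))" for i
    using Suc by (subst pd_mult) (simp_all add: differentiable_times_add)
  then show ?case using Suc.prems differentiable_on_mult[of f UNIV g] by simp
qed simp

lemma smooth_fun_const: "smooth_fun (\<lambda>x. c)"
  by (simp add: smooth_fun_iff_differentiable_times differentiable_times_const)

lemma smooth_fun_nth: "smooth_fun (\<lambda>x. x $ j)"
  by (simp add: smooth_fun_iff_differentiable_times differentiable_times_nth)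

lemma smooth_fun_add: "smooth_fun f \<Longrightarrow> smooth_fun g \<Longrightarrow> smooth_fun (\<lambda>x. f x + g x)"
  by (simp add: smooth_fun_iff_differentiable_times differentiable_times_add)

lemma smooth_fun_mult:
  fixes f g :: "real^'n \<Rightarrow> real"
  shows "smooth_fun f \<Longrightarrow> smooth_fun g \<Longrightarrow> smooth_fun (\<lambda>x. f x * g x)"
  by (simp add: smooth_fun_iff_differentiable_times differentiable_times_mult)

lemma smooth_fun_cmult:
  fixes f :: "real^'n \<Rightarrow> real"
  shows "smooth_fun f \<Longrightarrow> smooth_fun (\<lambda>x. c * f x)"
  by (rule smooth_fun_mult[OF smooth_fun_const])

lemma smooth_fun_uminus:
  fixes f :: "real^'n \<Rightarrow> real"
  shows "smooth_fun f \<Longrightarrow> smooth_fun (\<lambda>x. - f x)"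
  using smooth_fun_cmult[of f "-1"] by simp

lemma smooth_fun_diff:
  fixes f g :: "real^'n \<Rightarrow> real"
  shows "smooth_fun f \<Longrightarrow> smooth_fun g \<Longrightarrow> smooth_fun (\<lambda>x. f x - g x)"
  using smooth_fun_add[OF _ smooth_fun_uminus, of f g] by simp

lemma smooth_fun_pdI:
  "f differentiable_on UNIV \<Longrightarrow> (\<And>i. smooth_fun (pd i f)) \<Longrightarrow> smooth_fun f"
  using smooth_fun_iff by blast

lemma pd_cong_open:
  assumes "open S" "x \<in> S" "\<And>y. y \<in> S \<Longrightarrow> f y = g y"
  shows "pd i f x = pd i g x"
proof -
  have "(f has_derivative D) (at x) \<longleftrightarrow> (g has_derivative D) (at x)" for D
    using has_derivative_transform_within_open[of f D x UNIV S g]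
      has_derivative_transform_within_open[of g D x UNIV S f] assms by auto
  then show ?thesis unfolding pd_def frechet_derivative_def by simp
qed

text \<open>With w = m / |x|^2, the derivative \<open>pd i w\<close> is (pd i m - 2 x_i w) / |x|^2:
  again a numerator that vanishes near 0, over |x|^2. The induction on n, over all m, therefore
  never has to treat 1 / |x|^2 as a function of its own.\<close>

lemma differentiable_times_div_norm2:
  fixes m :: "real^'n \<Rightarrow> real"
  assumes "differentiable_times n m" "r > 0" "\<And>x. norm x < r \<Longrightarrow> m x = 0"
  shows "differentiable_times n (\<lambda>x. m x / (norm x)\<^sup>2)"
  using assms(1,3)
proof (induction n arbitrary: m)
  case (Suc n)
  define w where "w = (\<lambda>x. m x / (norm x)\<^sup>2)"
  have w0: "w x = 0" if "norm x < r" for x using Suc.prems(2) that by (simp add: w_def)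
  have m': "m differentiable_on UNIV" "\<And>i. differentiable_times n (pd i m)" "differentiable_times n m"
    using Suc.prems(1) differentiable_times_Suc by auto
  have opn: "open {x::real^'n. norm x < r}" by (intro open_Collect_less continuous_intros)
  \<comment> \<open>Near 0 the function w is constantly 0 and so is the new numerator; elsewhere
    this is the quotient rule.\<close>
  have wd: "(w has_derivative (\<lambda>h. \<Sum>i\<in>UNIV. h $ i *
     ((pd i m x - 2 * (x $ i * w x)) / (norm x)\<^sup>2))) (at x)" for x
  proof (cases "norm x < r")
    case True
    have "(w has_derivative (\<lambda>h. 0)) (at x)"
      using has_derivative_transform_within_open[of "\<lambda>x. 0" "\<lambda>h. 0" x UNIV "{x. norm x < r}" w] opn True w0
      by simp
    moreover have "pd i m x = 0" for i
      using pd_cong_open[OF opn, of x m "\<lambda>x. 0" i] True Suc.prems(2) by (simp add: pd_const)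
    ultimately show ?thesis using True by (simp add: w0)
  next
    case False
    then have x0: "x \<noteq> 0" using \<open>r > 0\<close> by auto
    have md: "(m has_derivative (\<lambda>h. \<Sum>i\<in>UNIV. h $ i *\<^sub>R pd i m x)) (at x)"
      using m'(1) by (intro has_derivative_pd) (simp add: differentiable_on_def)
    have nd: "((\<lambda>x::real^'n. (norm x)\<^sup>2) has_derivative (\<lambda>h. 2 * (x \<bullet> h))) (at x)"
      unfolding power2_norm_eq_inner
      by (auto intro!: derivative_eq_intros simp: inner_commute)
    have "(w has_derivative (\<lambda>h. - m x * (inverse ((norm x)\<^sup>2) * (2 * (x \<bullet> h)) * inverse ((norm x)\<^sup>2))
        + (\<Sum>i\<in>UNIV. h $ i *\<^sub>R pd i m x) / (norm x)\<^sup>2)) (at x)"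
      unfolding w_def by (rule has_derivative_divide[OF md nd]) (simp add: x0)
    also have "(\<lambda>h. - m x * (inverse ((norm x)\<^sup>2) * (2 * (x \<bullet> h)) * inverse ((norm x)\<^sup>2))
        + (\<Sum>i\<in>UNIV. h $ i *\<^sub>R pd i m x) / (norm x)\<^sup>2) =
      (\<lambda>h. \<Sum>i\<in>UNIV. h $ i * ((pd i m x - 2 * (x $ i * w x)) / (norm x)\<^sup>2))" (is "?l = ?r")
    proof
      fix h
      have "- m x * (inverse ((norm x)\<^sup>2) * (2 * (x $ i * h $ i)) * inverse ((norm x)\<^sup>2)) +
          h $ i * pd i m x / (norm x)\<^sup>2 = h $ i * ((pd i m x - 2 * (x $ i * w x)) / (norm x)\<^sup>2)" for i
        using x0 by (simp add: w_def divide_simps) (simp add: algebra_simps)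
      then show "?l h = ?r h"
        unfolding inner_vec_def sum_distrib_left sum_distrib_right sum_divide_distrib
          sum.distrib[symmetric] by simp
    qed
    finally show ?thesis .
  qed
  have dw: "w differentiable_on UNIV"
    using wd by (auto simp: differentiable_on_def differentiable_def)
  have pw: "pd i w = (\<lambda>x. (pd i m x - 2 * (x $ i * w x)) / (norm x)\<^sup>2)" for i
  proof
    fix x show "pd i w x = (pd i m x - 2 * (x $ i * w x)) / (norm x)\<^sup>2"
      unfolding pd_eq[OF wd[of x], of i] axis_def by (simp add: if_distrib[of "\<lambda>u. u * _"] if_distrib[of "\<lambda>u. u / _"] cong: if_cong)
  qed
  \<comment> \<open>The induction hypothesis is used twice: here for w, which enters the new
    numerator, and below for the quotient with that numerator.\<close>
  have wn: "differentiable_times n w"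
    unfolding w_def using Suc.IH[OF m'(3)] Suc.prems(2) by blast
  have "differentiable_times n (pd i w)" for i
  proof -
    have "differentiable_times n (\<lambda>x. pd i m x + (- 2) * (x $ i * w x))"
      by (intro differentiable_times_add differentiable_times_mult m' wn
           differentiable_times_nth differentiable_times_const)
    moreover have "pd i m x + (- 2) * (x $ i * w x) = 0" if "norm x < r" for x
      using pd_cong_open[OF opn, of x m "\<lambda>x. 0" i] that Suc.prems(2) w0 by (simp add: pd_const)
    ultimately have "differentiable_times n (\<lambda>x. (pd i m x + (- 2) * (x $ i * w x)) / (norm x)\<^sup>2)"
      by (rule Suc.IH)
    then show ?thesis by (simp add: pw)
  qed
  then show ?case using dw unfolding w_def by simp
qed simp

lemma smooth_fun_div_norm2:
  fixes m :: "real^'n \<Rightarrow> real"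
  assumes "smooth_fun m" "r > 0" "\<And>x. norm x < r \<Longrightarrow> m x = 0"
  shows "smooth_fun (\<lambda>x. m x / (norm x)\<^sup>2)"
  using assms differentiable_times_div_norm2 unfolding smooth_fun_iff_differentiable_times by blast

section \<open>Integration by parts and commuting derivatives\<close>

lemma DERIV_along_line:
  fixes f :: "real^'n \<Rightarrow> real"
  assumes "f differentiable_on UNIV"
  shows "((\<lambda>s. f (b + s *\<^sub>R w)) has_real_derivative (\<Sum>i\<in>UNIV. w $ i * pd i f (b + s *\<^sub>R w))) (at s)"
proof -
  have f': "(f has_derivative (\<lambda>h. \<Sum>i\<in>UNIV. h $ i *\<^sub>R pd i f (b + s *\<^sub>R w))) (at (b + s *\<^sub>R w))"
    using assms by (intro has_derivative_pd) (simp add: differentiable_on_def)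
  have l: "((\<lambda>s. b + s *\<^sub>R w) has_derivative (\<lambda>h. h *\<^sub>R w)) (at s)"
    by (auto intro!: derivative_eq_intros)
  have "((\<lambda>s. f (b + s *\<^sub>R w)) has_derivative
      (\<lambda>h. \<Sum>i\<in>UNIV. (h *\<^sub>R w) $ i *\<^sub>R pd i f (b + s *\<^sub>R w))) (at s)"
    by (rule has_derivative_compose[OF l f'])
  moreover have "(\<lambda>h. \<Sum>i\<in>UNIV. (h *\<^sub>R w) $ i *\<^sub>R pd i f (b + s *\<^sub>R w)) =
      (*) (\<Sum>i\<in>UNIV. w $ i * pd i f (b + s *\<^sub>R w))"
    by (simp add: fun_eq_iff sum_distrib_left mult_ac)
  ultimately show ?thesis
    unfolding has_field_derivative_def by simp
qed

lemma DERIV_along_axis: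
  fixes f :: "real^'n \<Rightarrow> real"
  assumes "f differentiable_on UNIV"
  shows "((\<lambda>s. f (b + s *\<^sub>R axis i 1)) has_real_derivative pd i f (b + s *\<^sub>R axis i 1)) (at s)"
proof -
  have "(\<Sum>k\<in>UNIV. axis i 1 $ k * pd k f (b + s *\<^sub>R axis i 1)) = pd i f (b + s *\<^sub>R axis i 1)"
    by (simp add: axis_def if_distrib[of "\<lambda>u. u * _"] cong: if_cong)
  then show ?thesis using DERIV_along_line[OF assms, of b "axis i 1" s] by simp
qed

text \<open>The mean value theorem is applied first to the increment of \<open>f\<close> in
  direction j, as a function along direction i, and then to \<open>pd i f\<close> along direction
  j.\<close>

lemma second_difference_mvt:
  fixes f :: "real^'n \<Rightarrow> real"
  assumes f: "smooth_fun f" and "h > 0"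
  shows "\<exists>s t. 0 < s \<and> s < h \<and> 0 < t \<and> t < h \<and>
    f (p + h *\<^sub>R axis i 1 + h *\<^sub>R axis j 1) - f (p + h *\<^sub>R axis i 1) - f (p + h *\<^sub>R axis j 1) + f p
      = h * h * pd j (pd i f) (p + s *\<^sub>R axis i 1 + t *\<^sub>R axis j 1)"
proof -
  let ?e = "axis i (1::real)" and ?d = "axis j (1::real)"
  have df: "f differentiable_on UNIV" and dpf: "pd i f differentiable_on UNIV"
    using f smooth_fun_iff by blast+
  have "((\<lambda>s. f ((p + h *\<^sub>R ?d) + s *\<^sub>R ?e) - f (p + s *\<^sub>R ?e)) has_real_derivative
      pd i f ((p + h *\<^sub>R ?d) + s *\<^sub>R ?e) - pd i f (p + s *\<^sub>R ?e)) (at s)" for s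
    by (intro DERIV_diff DERIV_along_axis df)
  from MVT2[OF \<open>h > 0\<close> this] obtain s where s: "0 < s" "s < h" and
    1: "f ((p + h *\<^sub>R ?d) + h *\<^sub>R ?e) - f (p + h *\<^sub>R ?e) - (f ((p + h *\<^sub>R ?d)) - f p) =
      h * (pd i f ((p + h *\<^sub>R ?d) + s *\<^sub>R ?e) - pd i f (p + s *\<^sub>R ?e))"
    by (auto)
  have "((\<lambda>t. pd i f ((p + s *\<^sub>R ?e) + t *\<^sub>R ?d)) has_real_derivative
      pd j (pd i f) ((p + s *\<^sub>R ?e) + t *\<^sub>R ?d)) (at t)" for t
    by (intro DERIV_along_axis dpf)
  from MVT2[OF \<open>h > 0\<close> this] obtain t where t: "0 < t" "t < h" and
    2: "pd i f ((p + s *\<^sub>R ?e) + h *\<^sub>R ?d) - pd i f (p + s *\<^sub>R ?e) =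
      h * pd j (pd i f) ((p + s *\<^sub>R ?e) + t *\<^sub>R ?d)"
    by auto
  have "f (p + h *\<^sub>R ?e + h *\<^sub>R ?d) - f (p + h *\<^sub>R ?e) - f (p + h *\<^sub>R ?d) + f p
      = h * h * pd j (pd i f) (p + s *\<^sub>R ?e + t *\<^sub>R ?d)"
    using 1 2 by (simp add: algebra_simps)
  with s t show ?thesis by blast
qed

text \<open>Schwarz's theorem. The second difference is symmetric in i and j, so arbitrarily close
  to p each mixed derivative takes a value that the other one also takes; continuity at p does the
  rest.\<close>

lemma pd_commute:
  fixes f :: "real^'n \<Rightarrow> real"
  assumes f: "smooth_fun f"
  shows "pd i (pd j f) = pd j (pd i f)"
proof
  fix p
  let ?e = "axis i (1::real)" and ?d = "axis j (1::real)"
  have A: "isCont (pd i (pd j f)) p" and B: "isCont (pd j (pd i f)) p"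
    using smooth_fun_continuous[OF smooth_fun_pd[OF smooth_fun_pd[OF f]]]
    by (simp_all add: continuous_on_eq_continuous_at)
  show "pd i (pd j f) p = pd j (pd i f) p"
  proof (rule ccontr)
    assume "pd i (pd j f) p \<noteq> pd j (pd i f) p"
    then have e: "dist (pd i (pd j f) p) (pd j (pd i f) p) / 2 > 0" (is "?r > 0") by simp
    obtain r1 where r1: "r1 > 0" "\<And>x. dist x p < r1 \<Longrightarrow> dist (pd i (pd j f) x) (pd i (pd j f) p) < ?r"
      using A e by (metis continuous_at_eps_delta)
    obtain r2 where r2: "r2 > 0" "\<And>x. dist x p < r2 \<Longrightarrow> dist (pd j (pd i f) x) (pd j (pd i f) p) < ?r"
      using B e by (metis continuous_at_eps_delta)
    \<comment> \<open>Each of the two offsets is below h, so the intermediate points stay within 2 h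
      of p, inside both balls.\<close>
    define h where "h = min r1 r2 / 3"
    have h: "h > 0" using r1(1) r2(1) by (simp add: h_def)
    have near: "dist (p + s *\<^sub>R axis a 1 + t *\<^sub>R axis b 1) p < min r1 r2"
      if "0 < s" "s < h" "0 < t" "t < h" for s t and a b :: 'n
    proof -
      have "norm (s *\<^sub>R axis a 1 + t *\<^sub>R (axis b 1 :: real^'n)) \<le> s + t"
        using that by (intro order_trans[OF norm_triangle_ineq]) (simp add: norm_axis_1)
      then show ?thesis using that unfolding h_def by (simp add: dist_norm add.assoc)
    qed
    obtain s t where st: "0 < s" "s < h" "0 < t" "t < h" and
      1: "f (p + h *\<^sub>R ?e + h *\<^sub>R ?d) - f (p + h *\<^sub>R ?e) - f (p + h *\<^sub>R ?d) + f p
        = h * h * pd j (pd i f) (p + s *\<^sub>R ?e + t *\<^sub>R ?d)"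
      using second_difference_mvt[OF f h, of p i j] by blast
    obtain s' t' where st': "0 < s'" "s' < h" "0 < t'" "t' < h" and
      2: "f (p + h *\<^sub>R ?d + h *\<^sub>R ?e) - f (p + h *\<^sub>R ?d) - f (p + h *\<^sub>R ?e) + f p
        = h * h * pd i (pd j f) (p + s' *\<^sub>R ?d + t' *\<^sub>R ?e)"
      using second_difference_mvt[OF f h, of p j i] by blast
    have "h * h * pd j (pd i f) (p + s *\<^sub>R ?e + t *\<^sub>R ?d) = h * h * pd i (pd j f) (p + s' *\<^sub>R ?d + t' *\<^sub>R ?e)"
      unfolding 1[symmetric] 2[symmetric] by (simp add: algebra_simps)
    then have "pd j (pd i f) (p + s *\<^sub>R ?e + t *\<^sub>R ?d) = pd i (pd j f) (p + s' *\<^sub>R ?d + t' *\<^sub>R ?e)"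
      using h by simp
    moreover have "dist (pd j (pd i f) (p + s *\<^sub>R ?e + t *\<^sub>R ?d)) (pd j (pd i f) p) < ?r"
      using near[OF st, of i j] by (intro r2) simp
    moreover have "dist (pd i (pd j f) (p + s' *\<^sub>R ?d + t' *\<^sub>R ?e)) (pd i (pd j f) p) < ?r"
      using near[OF st', of j i] by (intro r1) simp
    ultimately show False
      using dist_triangle_half_r[of "pd j (pd i f) (p + s *\<^sub>R ?e + t *\<^sub>R ?d)" "pd i (pd j f) p"
          "dist (pd i (pd j f) p) (pd j (pd i f) p)" "pd j (pd i f) p"] by simp
  qed
qed

section \<open>Affine substitutions and integrals of derivatives\<close>

lemma lborel_integrable_affine:
  fixes f :: "real^'n \<Rightarrow> 'b::{banach, second_countable_topology}"
  assumes [measurable]: "f \<in> borel_measurable borel" and "c \<noteq> 0"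
  shows "integrable lborel (\<lambda>x. f (c *\<^sub>R x + b)) \<longleftrightarrow> integrable lborel f"
proof -
  have "integrable lborel f \<longleftrightarrow>
    integrable (density (distr lborel borel (\<lambda>x. b + c *\<^sub>R x)) (\<lambda>_. ennreal (\<bar>c\<bar>^CARD('n)))) f"
    using lborel_affine[OF \<open>c \<noteq> 0\<close>, of b] by (simp add: ennreal_power)
  also have "\<dots> \<longleftrightarrow> integrable lborel (\<lambda>x. f (c *\<^sub>R x + b))"
  proof -
    have "integrable lborel (\<lambda>x. k *\<^sub>R g x) \<longleftrightarrow> integrable lborel g" if "k \<noteq> 0"
      for k and g :: "real^'n \<Rightarrow> 'b"
      using that integrable_scaleR_right[of "inverse k" lborel "\<lambda>x. k *\<^sub>R g x"] by auto
    then show ?thesis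
      using \<open>c \<noteq> 0\<close> by (simp add: integrable_density integrable_distr_eq add.commute)
  qed
  finally show ?thesis ..
qed

lemma lborel_integral_affine:
  fixes f :: "real^'n \<Rightarrow> 'b::{banach, second_countable_topology}"
  assumes [measurable]: "f \<in> borel_measurable borel" and "c \<noteq> 0"
  shows "(LINT x|lborel. f x) = \<bar>c\<bar>^CARD('n) *\<^sub>R (LINT x|lborel. f (c *\<^sub>R x + b))"
proof -
  have "(LINT x|lborel. f x) =
    (LINT x|density (distr lborel borel (\<lambda>x. b + c *\<^sub>R x)) (\<lambda>_. ennreal (\<bar>c\<bar>^CARD('n))). f x)"
    using lborel_affine[OF \<open>c \<noteq> 0\<close>, of b] by (simp add: ennreal_power)
  also have "\<dots> = (LINT x|lborel. \<bar>c\<bar>^CARD('n) *\<^sub>R f (c *\<^sub>R x + b))"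
    by (simp add: integral_density integral_distr add.commute)
  finally show ?thesis by simp
qed

text \<open>Translation invariance takes the place of boundary terms: the integral of f (x + e) - f
  x is 0, and by the fundamental theorem and Fubini it is also the integral of \<open>pd i f\<close>
  averaged over the shifts s in [0, 1]. In this form it also covers functions that merely
  decay.\<close>

lemma integral_pd_eq_0:
  fixes f :: "real^'n \<Rightarrow> real"
  assumes "f differentiable_on UNIV" "continuous_on UNIV (pd i f)"
    and f: "integrable lborel f" and pf: "integrable lborel (pd i f)"
  shows "(LINT x|lborel. pd i f x) = 0"
proof -
  let ?e = "axis i (1::real)"
  have [measurable]: "f \<in> borel_measurable borel" "pd i f \<in> borel_measurable borel"
    using assms by (auto intro!: borel_measurable_continuous_onI differentiable_imp_continuous_on)
  let ?g = "\<lambda>(s, x). indicator {0..1} s * pd i f (x + s *\<^sub>R ?e)"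
  have tr: "integrable lborel (\<lambda>x. g (x + b))" "(LINT x|lborel. g (x + b)) = (LINT x|lborel. g x)"
    if "integrable lborel g" for g :: "real^'n \<Rightarrow> real" and b
    using lborel_integrable_affine[of g 1 b] lborel_integral_affine[of g 1 b] that by simp_all
  have gi: "integrable (lborel \<Otimes>\<^sub>M lborel) ?g"
  proof (rule lborel_pair.Fubini_integrable)
    have "(\<lambda>s::real. LINT x|lborel. norm (?g (s, x))) =
       (\<lambda>s. indicator {0..1} s * (LINT x|lborel. \<bar>pd i f x\<bar>))"
      using tr(2)[OF integrable_norm[OF pf]] by (auto simp: abs_mult fun_eq_iff)
    moreover have "integrable lborel (\<lambda>s::real. indicator {0..1} s * (LINT x|lborel. \<bar>pd i f x\<bar>))"
      by simp
    ultimately show "integrable lborel (\<lambda>s::real. LINT x|lborel. norm (?g (s, x)))" by simp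
    show "AE s in lborel. integrable lborel (\<lambda>x. ?g (s, x))"
      using tr(1)[OF pf] by simp
  qed measurable
  have "(LINT x|lborel. f (x + ?e) - f x) = (LINT x|lborel. f (x + ?e)) - (LINT x|lborel. f x)"
    by (rule Bochner_Integration.integral_diff[OF tr(1)[OF f] f])
  also have "(LINT x|lborel. f (x + ?e)) = (LINT x|lborel. f x)" by (rule tr(2)[OF f])
  finally have "(LINT x|lborel. f (x + ?e) - f x) = 0" by simp
  moreover have "f (x + ?e) - f x = (LINT s|lborel. ?g (s, x))" for x
  proof -
    have "isCont (\<lambda>s. x + s *\<^sub>R ?e) s" "isCont (pd i f) (x + s *\<^sub>R ?e)" for s
      using assms(2) by (auto simp: continuous_on_eq_continuous_at)
    then have c: "isCont (\<lambda>s. pd i f (x + s *\<^sub>R ?e)) s" for s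
      by (rule isCont_o2)
    have "(LINT s|lborel. pd i f (x + s *\<^sub>R ?e) * indicator {0..1} s) = f (x + 1 *\<^sub>R ?e) - f (x + 0 *\<^sub>R ?e)"
      by (rule integral_FTC_Icc_real) (auto intro: c DERIV_along_axis[OF assms(1)])
    then show ?thesis by (simp add: mult.commute)
  qed
  ultimately have "0 = (LINT x|lborel. LINT s|lborel. ?g (s, x))" by simp
  also have "\<dots> = (LINT s|lborel. LINT x|lborel. ?g (s, x))"
    using lborel_pair.Fubini_integral[of "\<lambda>s x. ?g (s, x)"] gi by simp
  also have "\<dots> = (LINT s|lborel. indicator {0..1::real} s * (LINT x|lborel. pd i f x))"
    using tr(2)[OF pf] by simp
  finally show ?thesis by simp
qed

text \<open>The majorant is the product over the coordinates of 1 / (1 + x_b^2), integrable by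
  Tonelli. Each of the d factors 1 + x_b^2 is at most (1 + |x|)^2, whence the exponent 2 d.\<close>

lemma integrable_decay:
  fixes f :: "real^'n \<Rightarrow> 'b::{banach, second_countable_topology}"
  assumes [measurable]: "f \<in> borel_measurable borel"
    and le: "\<And>x. norm (f x) * (1 + norm x) ^ (2 * CARD('n)) \<le> C"
  shows "integrable lborel f"
proof (rule Bochner_Integration.integrable_bound)
  let ?g = "\<lambda>x::real^'n. C * (\<Prod>b\<in>Basis. inverse (1 + (x \<bullet> b)\<^sup>2))"
  have "integrable lborel (\<lambda>x::real^'n. (\<Prod>b\<in>Basis. inverse (1 + (x \<bullet> b)\<^sup>2)))"
  proof (rule integrableI_nonneg)
    have fin: "(\<integral>\<^sup>+x. ennreal (inverse (1 + x\<^sup>2)) \<partial>(lborel::real measure)) < \<infinity>"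
      using integrable_inverse_1_plus_square
      by (simp add: set_integrable_def integrable_iff_bounded)
    have "(\<integral>\<^sup>+x. ennreal (\<Prod>b\<in>Basis. inverse (1 + ((x::real^'n) \<bullet> b)\<^sup>2)) \<partial>lborel) =
      (\<integral>\<^sup>+x. (\<Prod>b\<in>Basis. (\<lambda>u. ennreal (inverse (1 + u\<^sup>2))) ((x::real^'n) \<bullet> b)) \<partial>lborel)"
      by (simp add: prod_ennreal)
    also have "\<dots> = (\<Prod>b\<in>(Basis::(real^'n) set). (\<integral>\<^sup>+u. ennreal (inverse (1 + u\<^sup>2)) \<partial>(lborel::real measure)))"
      by (rule nn_integral_lborel_prod) auto
    also have "\<dots> < \<infinity>"
      using fin by (simp add: power_less_top_ennreal)
    finally show "(\<integral>\<^sup>+x. ennreal (\<Prod>b\<in>Basis. inverse (1 + ((x::real^'n) \<bullet> b)\<^sup>2)) \<partial>lborel) < \<infinity>" .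
  qed (auto intro!: prod_nonneg AE_I2)
  then show "integrable lborel ?g" by simp
  show "AE x in lborel. norm (f x) \<le> norm (?g x)"
  proof (rule AE_I2)
    fix x :: "real^'n"
    let ?P = "\<Prod>b\<in>Basis. (1 + (x \<bullet> b)\<^sup>2)"
    have P: "?P > 0" by (intro prod_pos) (simp add: add_pos_nonneg)
    have "?P \<le> (\<Prod>b\<in>(Basis::(real^'n) set). (1 + norm x)\<^sup>2)"
    proof (intro prod_mono conjI)
      fix b :: "real^'n" assume "b \<in> Basis"
      then have "\<bar>x \<bullet> b\<bar> \<le> norm x" by (rule Basis_le_norm)
      then have "\<bar>x \<bullet> b\<bar>\<^sup>2 \<le> (norm x)\<^sup>2" by (intro power_mono) auto
      then show "1 + (x \<bullet> b)\<^sup>2 \<le> (1 + norm x)\<^sup>2"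
        using norm_ge_zero[of x] by (simp add: power2_sum del: norm_ge_zero)
    qed auto
    also have "\<dots> = (1 + norm x) ^ (2 * CARD('n))" by (simp add: power_mult)
    finally have "norm (f x) * ?P \<le> norm (f x) * (1 + norm x) ^ (2 * CARD('n))"
      by (intro mult_left_mono) auto
    also have "\<dots> \<le> C" by (rule le)
    finally have "norm (f x) \<le> C * inverse ?P" using P by (simp add: field_simps)
    then show "norm (f x) \<le> norm (?g x)" by (simp add: prod_inversef[symmetric])
  qed
qed simp

section \<open>Smooth functions with bounded and integrable derivatives\<close>

text \<open>All derivatives lie in L^1 and in L^infinity. The class contains the test functions and
  the Littlewood-Paley kernels, is stable under \<open>pd\<close> and affine substitutions, and
  admits integration by parts without boundary terms.\<close>

definition smooth_W :: "(real^'n \<Rightarrow> real) \<Rightarrow> bool" where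
  "smooth_W f \<longleftrightarrow> smooth_fun f \<and>
     (\<forall>is. integrable lborel (iter_pd is f) \<and> bounded (range (iter_pd is f)))"

lemma smooth_W_D:
  assumes "smooth_W f"
  shows "smooth_fun f" "integrable lborel f" "bounded (range f)" "f \<in> borel_measurable borel"
  using assms smooth_fun_measurable
  by (auto simp: smooth_W_def dest: spec[of _ "[]"])

lemma smooth_W_pd: "smooth_W f \<Longrightarrow> smooth_W (pd i f)"
  unfolding smooth_W_def by (metis iter_pd_snoc smooth_fun_pd)

lemma smooth_W_bound:
  assumes "smooth_W f"
  obtains B where "B \<ge> 0" "\<And>x. \<bar>f x\<bar> \<le> B"
  using smooth_W_D(3)[OF assms] unfolding bounded_iff
  by (metis UNIV_I abs_ge_zero image_eqI order.trans real_norm_def)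

lemma smooth_W_affine:
  assumes "smooth_W f" "c \<noteq> 0"
  shows "smooth_W (\<lambda>x. f (c *\<^sub>R x + b))"
proof -
  have f: "smooth_fun f" using assms(1) smooth_W_D by blast
  have "integrable lborel (\<lambda>x. iter_pd is f (c *\<^sub>R x + b))" for "is"
    using assms smooth_fun_measurable[OF smooth_fun_iter_pd[OF f]]
    by (subst lborel_integrable_affine) (auto simp: smooth_W_def)
  moreover have "bounded (range (\<lambda>x. c ^ length is *\<^sub>R iter_pd is f (c *\<^sub>R x + b)))" for "is"
  proof -
    have "bounded ((\<lambda>x. c ^ length is *\<^sub>R x) ` range (iter_pd is f))"
      using assms(1) by (intro bounded_scaling) (auto simp: smooth_W_def)
    then show ?thesis by (rule bounded_subset) auto
  qed
  ultimately show ?thesis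
    unfolding smooth_W_def using smooth_fun_affine[OF f] by (simp add: iter_pd_affine[OF f])
qed

lemma smooth_W_integral_pd: "smooth_W f \<Longrightarrow> (LINT x|lborel. pd i f x) = 0"
  using smooth_W_D(1,2)[of f] smooth_W_D(1,2)[OF smooth_W_pd[of f i]]
  by (intro integral_pd_eq_0) (auto simp: smooth_fun_iff[of f] smooth_fun_continuous)

lemma smooth_W_mult_integrable:
  assumes f: "smooth_W f" and g: "smooth_W g"
  shows "integrable lborel (\<lambda>x. f x * g x)"
proof -
  obtain B where B: "\<And>x. \<bar>f x\<bar> \<le> B" using smooth_W_bound[OF f] by blast
  have [measurable]: "f \<in> borel_measurable borel" "g \<in> borel_measurable borel"
    using f g smooth_W_D by auto
  show ?thesis
  proof (rule Bochner_Integration.integrable_bound)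
    show "integrable lborel (\<lambda>x. B * g x)" using smooth_W_D(2)[OF g] by simp
    show "AE x in lborel. norm (f x * g x) \<le> norm (B * g x)"
      using B by (intro AE_I2) (auto simp: abs_mult intro!: mult_right_mono order_trans[OF B])
  qed simp
qed

lemma integral_by_parts_pd:
  assumes f: "smooth_W f" and g: "smooth_W g"
  shows "(LINT x|lborel. f x * pd i g x) = - (LINT x|lborel. pd i f x * g x)"
proof -
  have d: "f differentiable_on UNIV" "g differentiable_on UNIV"
    using f g smooth_W_D(1) smooth_fun_iff by blast+
  have fg: "smooth_fun (\<lambda>x. f x * g x)"
    using f g by (intro smooth_fun_mult smooth_W_D)
  have i: "integrable lborel (\<lambda>x. f x * pd i g x)" "integrable lborel (\<lambda>x. pd i f x * g x)"
    using f g by (auto intro!: smooth_W_mult_integrable smooth_W_pd)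
  have "(LINT x|lborel. pd i (\<lambda>x. f x * g x) x) = 0"
  proof (rule integral_pd_eq_0)
    show "continuous_on UNIV (pd i (\<lambda>x. f x * g x))"
      by (rule smooth_fun_continuous[OF smooth_fun_pd[OF fg]])
    show "integrable lborel (pd i (\<lambda>x. f x * g x))"
      unfolding pd_mult[OF d] using i by (rule Bochner_Integration.integrable_add)
  qed (use fg smooth_fun_iff smooth_W_mult_integrable[OF f g] in blast)+
  then show ?thesis
    unfolding pd_mult[OF d] using i by simp
qed

section \<open>Supports and test functions\<close>

lemma not_in_fun_support: "x \<notin> fun_support f \<Longrightarrow> f x = 0"
  unfolding fun_support_def using closure_subset[of "{x. f x \<noteq> 0}"] by auto

lemma fun_support_subset: "closed S \<Longrightarrow> (\<And>x. x \<notin> S \<Longrightarrow> f x = 0) \<Longrightarrow> fun_support f \<subseteq> S"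
  unfolding fun_support_def by (intro closure_minimal) auto

lemma closed_fun_support: "closed (fun_support f)"
  by (simp add: fun_support_def)

lemma fun_support_pd: "fun_support (pd i f) \<subseteq> fun_support f"
proof (rule fun_support_subset[OF closed_fun_support])
  fix x assume "x \<notin> fun_support f"
  then have "pd i f x = pd i (\<lambda>x. 0) x"
    using closed_fun_support[of f]
    by (intro pd_cong_open[of "- fun_support f"]) (auto intro: not_in_fun_support)
  then show "pd i f x = 0" by (simp add: pd_const)
qed

lemma test_functionsI:
  assumes "smooth_fun f" "compact S" "\<And>x. x \<notin> S \<Longrightarrow> f x = 0"
  shows "f \<in> test_functions"
proof -
  have "S \<inter> fun_support f = fun_support f"
    using fun_support_subset[of S f] compact_imp_closed assms by blast
  then have "compact (fun_support f)"
    using compact_Int_closed[OF assms(2) closed_fun_support, of f] by simp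
  with assms(1) show ?thesis by (simp add: test_functions_def)
qed

lemma test_functions_pd: "f \<in> test_functions \<Longrightarrow> pd i f \<in> test_functions"
  using fun_support_pd[of i f] not_in_fun_support[of _ "pd i f"]
  by (intro test_functionsI[of _ "fun_support f"]) (auto simp: test_functions_def smooth_fun_pd)

lemma test_functions_iter_pd: "f \<in> test_functions \<Longrightarrow> iter_pd is f \<in> test_functions"
  by (induction "is") (auto intro: test_functions_pd)

lemma test_functions_smooth_W:
  assumes "f \<in> test_functions"
  shows "smooth_W f"
proof -
  have "integrable lborel g" "bounded (range g)" if g: "g \<in> test_functions" for g :: "real^'n \<Rightarrow> real"
  proof -
    have S: "compact (fun_support g)" and c: "continuous_on UNIV g"
      using g smooth_fun_continuous by (auto simp: test_functions_def)
    have "integrable lborel (\<lambda>x. indicator (fun_support g) x *\<^sub>R g x)"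
      by (rule borel_integrable_compact[OF S continuous_on_subset[OF c]]) simp
    moreover have "(\<lambda>x. indicator (fun_support g) x *\<^sub>R g x) = g"
      using not_in_fun_support[of _ g] by (fastforce simp: indicator_def)
    ultimately show "integrable lborel g" by simp
    have "bounded (insert 0 (g ` fun_support g))"
      using compact_imp_bounded[OF compact_continuous_image[OF continuous_on_subset[OF c] S]] by simp
    then show "bounded (range g)"
      by (rule bounded_subset) (auto intro: not_in_fun_support)
  qed
  then show ?thesis
    unfolding smooth_W_def using assms test_functions_iter_pd[OF assms] by (auto simp: test_functions_def)
qed

lemma test_functions_mult:
  assumes "f \<in> test_functions" "smooth_fun g"
  shows "(\<lambda>x. f x * g x) \<in> test_functions"
  using assms by (intro test_functionsI[of _ "fun_support f"])
    (auto simp: test_functions_def smooth_fun_mult not_in_fun_support)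

lemma test_functions_affine:
  assumes f: "f \<in> test_functions" and c: "c \<noteq> 0"
  shows "(\<lambda>x. f (c *\<^sub>R x + b)) \<in> test_functions"
proof (rule test_functionsI)
  let ?S = "(\<lambda>y. inverse c *\<^sub>R (y + (-b))) ` fun_support f"
  show "compact ?S"
    using f by (intro compact_continuous_image continuous_intros) (simp add: test_functions_def)
  fix x assume "x \<notin> ?S"
  have "x = inverse c *\<^sub>R ((c *\<^sub>R x + b) + (-b))" using c by simp
  with \<open>x \<notin> ?S\<close> have "c *\<^sub>R x + b \<notin> fun_support f" by blast
  then show "f (c *\<^sub>R x + b) = 0" by (rule not_in_fun_support)
qed (use f in \<open>auto simp: test_functions_def intro: smooth_fun_affine\<close>)

section \<open>Laplacian and Hessian\<close>

definition lap :: "(real^'n \<Rightarrow> real) \<Rightarrow> real^'n \<Rightarrow> real" where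
  "lap f x = (\<Sum>i\<in>UNIV. pd i (pd i f) x)"

text \<open>The Hessian as a quadratic form. At \<open>a = v x\<close> it is the integrand obtained
  by testing div div (v \<otimes> v) with \<open>f\<close>.\<close>

definition hess :: "(real^'n \<Rightarrow> real) \<Rightarrow> real^'n \<Rightarrow> real^'n \<Rightarrow> real" where
  "hess f x a = (\<Sum>i\<in>UNIV. \<Sum>j\<in>UNIV. pd j (pd i f) x * (a $ i * a $ j))"

text \<open>The sum of the entries is preferred to an operator norm because integrability, with or
  without a weight, then follows entry by entry.\<close>

definition hess_norm :: "(real^'n \<Rightarrow> real) \<Rightarrow> real^'n \<Rightarrow> real" where
  "hess_norm f x = (\<Sum>i\<in>UNIV. \<Sum>j\<in>UNIV. \<bar>pd j (pd i f) x\<bar>)"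

lemma hess_norm_nonneg: "0 \<le> hess_norm f x"
  by (simp add: hess_norm_def sum_nonneg)

lemma abs_hess_le: "\<bar>hess f x a\<bar> \<le> hess_norm f x * (norm a)\<^sup>2"
proof -
  have "\<bar>pd j (pd i f) x * (a $ i * a $ j)\<bar> \<le> \<bar>pd j (pd i f) x\<bar> * (norm a)\<^sup>2" for i j
    unfolding abs_mult power2_eq_square
    by (intro mult_left_mono mult_mono component_le_norm_cart) auto
  then have "\<bar>hess f x a\<bar> \<le> (\<Sum>i\<in>UNIV. \<Sum>j\<in>UNIV. \<bar>pd j (pd i f) x\<bar> * (norm a)\<^sup>2)"
    unfolding hess_def by (intro order_trans[OF sum_abs] sum_mono)
  then show ?thesis by (simp add: hess_norm_def sum_distrib_right)
qed

lemma pd_pd_affine: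
  assumes "smooth_fun f"
  shows "pd j (pd i (\<lambda>x. f (c *\<^sub>R x + b))) x = c\<^sup>2 * pd j (pd i f) (c *\<^sub>R x + b)"
  using fun_cong[OF iter_pd_affine[OF assms, of "[j, i]" c b], of x] by (simp add: power2_eq_square)

lemma lap_affine:
  assumes "smooth_fun f"
  shows "lap (\<lambda>x. f (c *\<^sub>R x + b)) x = c\<^sup>2 * lap f (c *\<^sub>R x + b)"
  by (simp add: lap_def pd_pd_affine[OF assms] sum_distrib_left)

lemma hess_affine:
  assumes "smooth_fun f"
  shows "hess (\<lambda>x. f (c *\<^sub>R x + b)) x a = c\<^sup>2 * hess f (c *\<^sub>R x + b) a"
  by (simp add: hess_def pd_pd_affine[OF assms] sum_distrib_left mult.assoc)

lemma smooth_W_lap: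
  assumes "smooth_W f"
  shows "integrable lborel (lap f)" "lap f \<in> borel_measurable borel" "continuous_on UNIV (lap f)"
    "\<exists>B\<ge>0. \<forall>x. \<bar>lap f x\<bar> \<le> B"
proof -
  have W: "smooth_W (pd i (pd i f))" for i using assms by (intro smooth_W_pd)
  show "integrable lborel (lap f)"
    unfolding lap_def[abs_def] using W smooth_W_D by (intro Bochner_Integration.integrable_sum) auto
  show "continuous_on UNIV (lap f)"
    unfolding lap_def[abs_def] using W smooth_W_D(1) smooth_fun_continuous by (intro continuous_on_sum) auto
  then show "lap f \<in> borel_measurable borel" by (rule borel_measurable_continuous_onI)
  have "\<exists>B. \<forall>x. \<bar>pd i (pd i f) x\<bar> \<le> B" for i using smooth_W_bound[OF W[of i]] by blast
  then obtain B where "\<And>i x. \<bar>pd i (pd i f) x\<bar> \<le> B i" by metis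
  then have "\<bar>lap f x\<bar> \<le> (\<Sum>i\<in>UNIV. B i)" for x
    unfolding lap_def by (intro order_trans[OF sum_abs] sum_mono)
  then show "\<exists>B\<ge>0. \<forall>x. \<bar>lap f x\<bar> \<le> B"
    by (intro exI[of _ "\<Sum>i\<in>UNIV. B i"]) (auto intro: order_trans[OF abs_ge_zero])
qed

text \<open>Both sides equal the integral of \<open>f\<close> against fourth derivatives of
  \<open>g\<close>, which commute. The lemma moves the Laplacian from the tested function to the
  kernel, because \<open>lap \<sigma>\<close> is what the scale derivative of the mollifier
  produces.\<close>

lemma integral_hess_lap:
  assumes f: "smooth_W f" and g: "smooth_W g"
  shows "(LINT x|lborel. pd j (pd i f) x * lap g x) = (LINT x|lborel. lap f x * pd j (pd i g) x)"
proof -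
  have W: "smooth_W (pd a (pd b h))" if "smooth_W h" for a b and h :: "real^'a \<Rightarrow> real"
    using that by (intro smooth_W_pd)
  have sf: "smooth_fun f" and sg: "smooth_fun g" using f g smooth_W_D by auto
  have "(LINT x|lborel. pd j (pd i f) x * pd k (pd k g) x) =
      (LINT x|lborel. pd k (pd k f) x * pd j (pd i g) x)" for k
  proof -
    have "(LINT x|lborel. pd j (pd i f) x * pd k (pd k g) x) =
        (LINT x|lborel. f x * pd i (pd j (pd k (pd k g))) x)"
      using integral_by_parts_pd[of "pd i f" "pd k (pd k g)" j] integral_by_parts_pd[of f "pd j (pd k (pd k g))" i]
        f g by (auto simp: smooth_W_pd)
    also have "pd i (pd j (pd k (pd k g))) = pd k (pd k (pd j (pd i g)))"
      using pd_commute[of "pd k g" j k] pd_commute[of g j k] pd_commute[of "pd k (pd j g)" i k]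
        pd_commute[of "pd j g" i k] pd_commute[of g i j] sg by (simp add: smooth_fun_pd)
    also have "(LINT x|lborel. f x * pd k (pd k (pd j (pd i g))) x) =
        (LINT x|lborel. pd k (pd k f) x * pd j (pd i g) x)"
      using integral_by_parts_pd[of "pd k f" "pd j (pd i g)" k] integral_by_parts_pd[of f "pd k (pd j (pd i g))" k]
        f g by (auto simp: smooth_W_pd)
    finally show ?thesis .
  qed
  then have eq: "(\<Sum>k\<in>UNIV. LINT x|lborel. pd j (pd i f) x * pd k (pd k g) x) =
      (\<Sum>k\<in>UNIV. LINT x|lborel. pd k (pd k f) x * pd j (pd i g) x)" by simp
  have int: "integrable lborel (\<lambda>x. pd a (pd b f) x * pd c (pd e g) x)" for a b c e
    using f g by (intro smooth_W_mult_integrable W)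
  have "(LINT x|lborel. pd j (pd i f) x * lap g x) =
      (\<Sum>k\<in>UNIV. LINT x|lborel. pd j (pd i f) x * pd k (pd k g) x)"
    unfolding lap_def sum_distrib_left by (rule Bochner_Integration.integral_sum) (rule int)
  moreover have "(LINT x|lborel. lap f x * pd j (pd i g) x) =
      (\<Sum>k\<in>UNIV. LINT x|lborel. pd k (pd k f) x * pd j (pd i g) x)"
    unfolding lap_def sum_distrib_right by (rule Bochner_Integration.integral_sum) (rule int)
  ultimately show ?thesis using eq by simp
qed

section \<open>The cutoff as a mollifier, and its potential\<close>

locale lp_cutoff_function =
  fixes \<phi> :: "real^'n \<Rightarrow> real"
  assumes lp_cutoff: "lp_cutoff \<phi>"
begin

lemma smooth_\<phi>: "smooth_fun \<phi>"
  and \<phi>_radial: "norm \<xi> = norm \<eta> \<Longrightarrow> \<phi> \<xi> = \<phi> \<eta>"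
  and \<phi>_nonneg: "0 \<le> \<phi> \<xi>"
  and \<phi>_eq_1: "norm \<xi> \<le> 1 \<Longrightarrow> \<phi> \<xi> = 1"
  using lp_cutoff unfolding lp_cutoff_def by blast+

lemma \<phi>_eq_0:
  assumes "2 < norm \<xi>"
  shows "\<phi> \<xi> = 0"
proof (rule not_in_fun_support)
  have "fun_support \<phi> \<subseteq> {\<xi>. norm \<xi> \<le> 2}" using lp_cutoff unfolding lp_cutoff_def by blast
  then show "\<xi> \<notin> fun_support \<phi>" using assms by auto
qed

lemma \<phi>_test: "\<phi> \<in> test_functions"
  by (rule test_functionsI[OF smooth_\<phi> compact_cball[of 0 2]]) (auto intro: \<phi>_eq_0)

lemma \<phi>_W: "smooth_W \<phi>"
  by (rule test_functions_smooth_W[OF \<phi>_test])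

lemma \<phi>_measurable [measurable]: "\<phi> \<in> borel_measurable borel"
  by (rule smooth_W_D(4)[OF \<phi>_W])

text \<open>\<open>\<phi>\<close> is fixed by its role as a frequency cutoff and equals 1 near 0, so
  it cannot be normalised as a mollifier; its integral is carried along as a factor.\<close>

definition mass :: real where "mass = (LINT x|lborel. \<phi> x)"

lemma mass_pos: "0 < mass"
proof -
  have "0 < measure lborel (ball (0::real^'n) 1)"
    using content_ball_pos[of 1 "0::real^'n"] by simp
  also have "\<dots> = (LINT x|lborel. indicator (ball (0::real^'n) 1) x)" by simp
  also have "\<dots> \<le> mass"
    unfolding mass_def using \<phi>_eq_1 \<phi>_nonneg
    by (intro integral_mono' smooth_W_D(2)[OF \<phi>_W]) (auto simp: indicator_def dist_norm)
  finally show ?thesis .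
qed

text \<open>\<open>\<phi>\<close> as a function of the squared radius, read off along an arbitrary
  axis. The absolute value extends it continuously to negative arguments.\<close>

definition profile :: "real \<Rightarrow> real" where
  "profile \<tau> = \<phi> (sqrt \<bar>\<tau>\<bar> *\<^sub>R axis undefined 1)"

lemma profile_norm: "profile ((norm z)\<^sup>2) = \<phi> z"
  unfolding profile_def by (rule \<phi>_radial) (simp add: norm_axis_1)

lemma profile_continuous: "continuous_on A profile"
  unfolding profile_def[abs_def]
  by (intro continuous_on_compose2[OF smooth_fun_continuous[OF smooth_\<phi>]] continuous_intros) auto

text \<open>Chosen so that \<open>\<nabla>\<sigma>(z) = - z \<phi>(z)\<close>; then \<open>t\<^sup>-\<^sup>d \<phi>(z/t)\<close>, \<open>d\<close> being the dimension, has
  the \<open>t\<close>-derivative \<open>t\<^sup>-\<^sup>d\<^sup>-\<^sup>1 (\<Delta>\<sigma>)(z/t)\<close>. The lower limit \<open>-1\<close> makes \<open>0\<close> an interior point.\<close>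

definition \<sigma> :: "real^'n \<Rightarrow> real" where
  "\<sigma> z = (integral {-1..9} profile - integral {-1..(norm z)\<^sup>2} profile) / 2"

lemma has_derivative_\<sigma>: "(\<sigma> has_derivative (\<lambda>h. - \<phi> z * (z \<bullet> h))) (at z)"
proof -
  let ?t = "(norm z)\<^sup>2"
  have t: "-1 < ?t" using zero_le_power2[of "norm z"] by linarith
  have "((\<lambda>u. integral {-1..u} profile) has_real_derivative profile ?t) (at ?t within {-1..?t + 1})"
    using t by (intro integral_has_real_derivative profile_continuous) auto
  then have I: "((\<lambda>u. integral {-1..u} profile) has_derivative (\<lambda>h. profile ?t * h)) (at ?t)"
    using t by (simp add: at_within_Icc_at has_field_derivative_def)
  have n: "((\<lambda>x. (norm x)\<^sup>2) has_derivative (\<lambda>h. 2 * (z \<bullet> h))) (at z)"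
    unfolding power2_norm_eq_inner by (auto intro!: derivative_eq_intros simp: inner_commute)
  have "((\<lambda>x. integral {-1..9} profile - integral {-1..(norm x)\<^sup>2} profile) has_derivative
      (\<lambda>h. 0 - profile ?t * (2 * (z \<bullet> h)))) (at z)"
    by (intro has_derivative_diff has_derivative_const has_derivative_compose[OF n I])
  from has_derivative_mult_right[OF this, of "1 / 2"] show ?thesis
    unfolding \<sigma>_def[abs_def] by (simp add: profile_norm)
qed

lemma pd_\<sigma>: "pd i \<sigma> = (\<lambda>x. (- x $ i) * \<phi> x)"
  using pd_eq[OF has_derivative_\<sigma>] by (auto simp: inner_axis fun_eq_iff)

text \<open>Only continuity of \<open>profile\<close> is known, which makes \<sigma> once
  differentiable; all further derivatives come from the formula for its gradient, whose components
  are visibly smooth.\<close>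

lemma smooth_\<sigma>: "smooth_fun \<sigma>"
proof (rule smooth_fun_pdI)
  show "\<sigma> differentiable_on UNIV"
    using has_derivative_\<sigma> by (auto simp: differentiable_on_def differentiable_def)
  show "smooth_fun (pd i \<sigma>)" for i
    unfolding pd_\<sigma> by (intro smooth_fun_mult smooth_fun_uminus smooth_fun_nth smooth_\<phi>)
qed

text \<open>\<open>profile\<close> vanishes beyond 4, the square of the radius 2 of the support of
  \<open>\<phi>\<close>. Ending the integral in \<sigma> at 9 = 3^2 leaves a margin and fixes the
  additive constant so that \<sigma> vanishes from radius 3 on.\<close>

lemma \<sigma>_eq_0:
  assumes "3 \<le> norm z"
  shows "\<sigma> z = 0"
proof -
  have u: "9 \<le> (norm z)\<^sup>2" using power_mono[OF assms, of 2] by simp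
  have "profile \<tau> = 0" if "9 \<le> \<tau>" for \<tau>
  proof -
    have "3 \<le> sqrt \<tau>" using that by (intro real_le_rsqrt) simp
    then show ?thesis
      using that unfolding profile_def by (intro \<phi>_eq_0) (simp add: norm_axis_1)
  qed
  then have "integral {9..(norm z)\<^sup>2} profile = integral {9..(norm z)\<^sup>2} (\<lambda>_. 0)"
    by (intro integral_cong) auto
  moreover have "integral {-1..9} profile + integral {9..(norm z)\<^sup>2} profile = integral {-1..(norm z)\<^sup>2} profile"
    using u by (intro Henstock_Kurzweil_Integration.integral_combine integrable_continuous_interval profile_continuous) auto
  ultimately show ?thesis by (simp add: \<sigma>_def)
qed

lemma \<sigma>_test: "\<sigma> \<in> test_functions"
  by (rule test_functionsI[OF smooth_\<sigma> compact_cball[of 0 3]]) (auto intro: \<sigma>_eq_0)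

lemma \<sigma>_W: "smooth_W \<sigma>"
  by (rule test_functions_smooth_W[OF \<sigma>_test])

lemma pd_pd_\<sigma>_eq_0: "3 < norm z \<Longrightarrow> pd j (pd i \<sigma>) z = 0"
proof -
  assume "3 < norm z"
  moreover have "fun_support (pd j (pd i \<sigma>)) \<subseteq> fun_support \<sigma>"
    using fun_support_pd by blast
  moreover have "fun_support \<sigma> \<subseteq> cball 0 3"
    by (rule fun_support_subset) (auto intro: \<sigma>_eq_0)
  ultimately show ?thesis by (intro not_in_fun_support) auto
qed

text \<open>The divergence of - z \<phi>(z). It is also the derivative at t = 1 of t^(-d)
  \<phi>(z/t), which is the whole point of \<sigma>.\<close>

lemma lap_\<sigma>: "lap \<sigma> z = - (real CARD('n) * \<phi> z) - (\<Sum>k\<in>UNIV. z $ k * pd k \<phi> z)"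
proof -
  have d: "\<phi> differentiable_on UNIV" using smooth_\<phi> smooth_fun_iff by blast
  have d': "(\<lambda>x::real^'n. - x $ k) differentiable_on UNIV" for k
    using smooth_fun_uminus[OF smooth_fun_nth] smooth_fun_iff by blast
  have p: "pd k (\<lambda>x::real^'n. - x $ k) = (\<lambda>x. - 1)" for k
  proof -
    have "(\<lambda>x::real^'n. x $ k) differentiable_on UNIV" using smooth_fun_nth smooth_fun_iff by blast
    from pd_scaleR[OF this, of k "-1"] show ?thesis by (simp add: pd_nth)
  qed
  have "pd k (pd k \<sigma>) z = - \<phi> z - z $ k * pd k \<phi> z" for k
    unfolding pd_\<sigma> pd_mult[OF d' d] p by simp
  then show ?thesis by (simp add: lap_def sum_subtractf sum_negf)
qed

lemma \<phi>_kernel_FTC: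
  assumes "0 < \<epsilon>" "\<epsilon> \<le> T"
  shows "(LINT t|lborel. lap \<sigma> ((1 / t) *\<^sub>R z) / t ^ (CARD('n) + 1) * indicator {\<epsilon>..T} t) =
    \<phi> ((1 / T) *\<^sub>R z) / T ^ CARD('n) - \<phi> ((1 / \<epsilon>) *\<^sub>R z) / \<epsilon> ^ CARD('n)"
proof (rule integral_FTC_Icc_real[OF assms(2)])
  let ?d = "CARD('n)"
  fix t assume "\<epsilon> \<le> t" "t \<le> T"
  then have t: "0 < t" using assms by simp
  have df: "\<phi> differentiable_on UNIV" using smooth_\<phi> smooth_fun_iff by blast
  define S where "S = (\<Sum>k\<in>UNIV. z $ k * pd k \<phi> ((1 / t) *\<^sub>R z))"
  have 1: "((\<lambda>s. \<phi> (0 + s *\<^sub>R z)) has_real_derivative S) (at (1 / t))"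
    unfolding S_def using DERIV_along_line[OF df, of 0 z "1 / t"] by simp
  have 2: "((\<lambda>t. 1 / t) has_real_derivative - (1 / t\<^sup>2)) (at t)"
    using t by (auto intro!: derivative_eq_intros simp: power2_eq_square)
  have 3: "((\<lambda>t. \<phi> ((1 / t) *\<^sub>R z)) has_real_derivative S * - (1 / t\<^sup>2)) (at t)"
    using DERIV_chain2[OF 1 2] by simp
  have 4: "((\<lambda>t. inverse (t ^ ?d)) has_real_derivative - (real ?d / t ^ (?d + 1))) (at t)"
  proof -
    \<comment> \<open>The derivative of the power carries the exponent d - 1 in truncated
      subtraction, so d is written as a successor.\<close>
    have "?d > 0" by simp
    then obtain m where m: "?d = Suc m" using gr0_implies_Suc by blast
    have "- (real ?d / t ^ (?d + 1)) = - (real ?d * t ^ (?d - Suc 0) * inverse ((t ^ ?d) ^ Suc (Suc 0)))"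
      using t by (simp add: m field_simps)
    then show ?thesis
      using DERIV_inverse_fun[OF DERIV_pow[of ?d t]] t by simp
  qed
  have "lap \<sigma> ((1 / t) *\<^sub>R z) = - (real ?d * \<phi> ((1 / t) *\<^sub>R z)) - S / t"
    by (simp add: lap_\<sigma> S_def sum_divide_distrib)
  then have eq: "lap \<sigma> ((1 / t) *\<^sub>R z) / t ^ (?d + 1) =
      S * - (1 / t\<^sup>2) * inverse (t ^ ?d) + - (real ?d / t ^ (?d + 1)) * \<phi> ((1 / t) *\<^sub>R z)"
    using t by (simp add: field_simps power2_eq_square)
  show "((\<lambda>t. \<phi> ((1 / t) *\<^sub>R z) / t ^ ?d) has_real_derivative lap \<sigma> ((1 / t) *\<^sub>R z) / t ^ (?d + 1)) (at t)"
    unfolding eq divide_inverse[of "\<phi> _"] by (rule DERIV_mult[OF 3 4])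
  have "isCont (lap \<sigma>) ((1 / t) *\<^sub>R z)" "isCont (\<lambda>t. (1 / t) *\<^sub>R z) t"
    using smooth_W_lap(3)[OF \<sigma>_W] t by (auto simp: continuous_on_eq_continuous_at intro!: continuous_intros)
  then have "isCont (\<lambda>t. lap \<sigma> ((1 / t) *\<^sub>R z)) t" by (rule isCont_o2[rotated])
  then show "isCont (\<lambda>t. lap \<sigma> ((1 / t) *\<^sub>R z) / t ^ (?d + 1)) t"
    using t by (intro continuous_intros) auto
qed

end

section \<open>The cancellation for solenoidal fields\<close>

lemma integrable_mult_bounded:
  fixes f g :: "'a \<Rightarrow> real"
  assumes "integrable M f" and [measurable]: "g \<in> borel_measurable M" and B: "\<And>x. \<bar>g x\<bar> \<le> B"
  shows "integrable M (\<lambda>x. f x * g x)"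
proof (rule Bochner_Integration.integrable_bound)
  show "integrable M (\<lambda>x. B * f x)" using assms by simp
  have [measurable]: "f \<in> borel_measurable M" using assms by simp
  show "(\<lambda>x. f x * g x) \<in> borel_measurable M" by measurable
  show "AE x in M. norm (f x * g x) \<le> norm (B * f x)"
  proof (rule AE_I2)
    fix x
    have "\<bar>g x\<bar> \<le> \<bar>B\<bar>" using B[of x] by linarith
    then show "norm (f x * g x) \<le> norm (B * f x)"
      by (simp add: abs_mult mult.commute[of "\<bar>B\<bar>"] mult_left_mono)
  qed
qed

lemma abs_integral_mult_le:
  fixes f g :: "'a \<Rightarrow> real"
  assumes f: "integrable M f" and g: "g \<in> borel_measurable M" and B: "\<And>x. \<bar>g x\<bar> \<le> B"
  shows "\<bar>\<integral>x. f x * g x \<partial>M\<bar> \<le> B * (\<integral>x. \<bar>f x\<bar> \<partial>M)"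
proof -
  have "\<bar>\<integral>x. f x * g x \<partial>M\<bar> \<le> (\<integral>x. \<bar>f x * g x\<bar> \<partial>M)"
    by (rule integral_abs_bound)
  also have "\<dots> \<le> (\<integral>x. B * \<bar>f x\<bar> \<partial>M)"
    using integrable_abs[OF integrable_mult_bounded[OF f g B]] f B
    by (intro integral_mono) (auto simp: abs_mult mult.commute[of B] intro!: mult_left_mono)
  finally show ?thesis by simp
qed

text \<open>Majorant in the scale t for the layers \<open>Q t\<close>, with a = 2 \<gamma>: t^(a-1)
  is what the cancellation leaves at small scales, and t^(-2) bounds the decay t^(-d-1) at large
  ones. For t \<le> 0 it is 0, as \<open>Q\<close> is.\<close>

definition dominator :: "real \<Rightarrow> real \<Rightarrow> real" where
  "dominator a t = (if t \<le> 0 then 0 else if t \<le> 1 then t powr (a - 1) else t powr (-2))"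

lemma dominator_nonneg: "0 \<le> dominator a t"
  by (simp add: dominator_def)

lemma integrable_dominator:
  assumes "a > 0"
  shows "integrable lborel (dominator a)"
proof -
  have "(\<lambda>t. t powr (a - 1)) absolutely_integrable_on {0..1::real}"
    using assms by (intro nonnegative_absolutely_integrable_1 integrable_on_powr_from_0) auto
  then have 1: "integrable lborel (\<lambda>t. indicator {0..1::real} t * t powr (a - 1))"
    unfolding set_integrable_def by (subst (asm) integrable_completion) auto
  have "(\<lambda>t. t powr (-2)) absolutely_integrable_on {1::real..}"
    using has_integral_powr_to_inf[of "-2" 1]
    by (intro nonnegative_absolutely_integrable_1) (auto simp: integrable_on_def)
  then have 2: "integrable lborel (\<lambda>t. indicator {1::real..} t * t powr (-2))"
    unfolding set_integrable_def by (subst (asm) integrable_completion) auto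
  have m[measurable]: "dominator a \<in> borel_measurable borel"
    unfolding dominator_def[abs_def] by measurable
  show ?thesis
    by (rule Bochner_Integration.integrable_bound[OF Bochner_Integration.integrable_add[OF 1 2]])
       (auto simp: dominator_def indicator_def)
qed

section \<open>The velocity field and its bounds\<close>

text \<open>Of the size of \<open>v\<close> only a Hoelder constant H and a support radius R are
  kept. The constants defined in this locale involve \<open>\<phi>\<close>, \<gamma> and R but
  neither \<open>v\<close> nor H, so that they can be fixed before the field.\<close>

locale pressure_data = lp_cutoff_function \<phi> for \<phi> :: "real^'n \<Rightarrow> real" +
  fixes v :: "real^'n \<Rightarrow> real^'n" and \<gamma> H R :: real
  assumes \<gamma>: "0 < \<gamma>" "\<gamma> \<le> 1 / 2"
    and H: "0 \<le> H" and holder: "norm (v x - v y) \<le> H * norm (x - y) powr \<gamma>"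
    and R: "0 < R" and v_eq_0: "R < norm x \<Longrightarrow> v x = 0"
    and div_free: "div_free v"
begin

lemma v_continuous: "continuous_on UNIV v"
  unfolding continuous_on_def
proof
  fix x :: "real^'n"
  have "((\<lambda>y. H * norm (y - x) powr \<gamma>) \<longlongrightarrow> H * norm (x - x) powr \<gamma>) (at x)"
    using \<gamma> by (intro tendsto_intros tendsto_powr') auto
  then have "((\<lambda>y. H * norm (y - x) powr \<gamma>) \<longlongrightarrow> 0) (at x)" by simp
  then have "((\<lambda>y. v y - v x) \<longlongrightarrow> 0) (at x)"
    by (rule Lim_null_comparison[rotated]) (intro always_eventually allI holder)
  then show "(v \<longlongrightarrow> v x) (at x within UNIV)" by (simp add: LIM_zero_cancel)
qed

lemma v_measurable [measurable]: "v \<in> borel_measurable borel"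
  by (rule borel_measurable_continuous_onI[OF v_continuous])

definition vmax :: real where "vmax = (2 * R + 1) powr \<gamma>"

text \<open>Compares x with a point y of norm R + 1, where \<open>v\<close> vanishes; |x - y| \<le>
  2 R + 1 explains \<open>vmax\<close>. The sup norm is thus paid for by the Hoelder constant, and
  every later bound is quadratic in H alone.\<close>

lemma v_bound: "norm (v x) \<le> H * vmax"
proof (cases "R < norm x")
  case True
  then show ?thesis using H by (simp add: v_eq_0 vmax_def)
next
  case False
  define y where "y = (R + 1) *\<^sub>R (axis undefined 1 :: real^'n)"
  have y: "norm y = R + 1" using R by (simp add: y_def norm_axis_1)
  then have "norm (v x) = norm (v x - v y)" by (simp add: v_eq_0)
  also have "\<dots> \<le> H * norm (x - y) powr \<gamma>" by (rule holder)
  also have "\<dots> \<le> H * vmax"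
    using norm_triangle_ineq4[of x y] y False H \<gamma> unfolding vmax_def
    by (intro mult_left_mono powr_mono2) auto
  finally show ?thesis .
qed

lemma v_nth_bound: "\<bar>v x $ i\<bar> \<le> H * vmax"
  using component_le_norm_cart[of "v x" i] v_bound[of x] by linarith

lemma v_nth_measurable [measurable]: "(\<lambda>x. v x $ i) \<in> borel_measurable borel"
  by (rule borel_measurable_continuous_onI) (intro continuous_intros v_continuous)

lemma v_nth_integrable: "integrable lborel (\<lambda>x. v x $ i)"
proof -
  have "integrable lborel (\<lambda>x. indicator (cball 0 R) x *\<^sub>R v x $ i)"
    by (rule borel_integrable_compact) (auto intro!: continuous_intros continuous_on_subset[OF v_continuous])
  moreover have "(\<lambda>x. indicator (cball 0 R) x *\<^sub>R v x $ i) = (\<lambda>x. v x $ i)"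
    by (auto simp: fun_eq_iff indicator_def v_eq_0)
  ultimately show ?thesis by simp
qed

lemma vv_integrable: "integrable lborel (\<lambda>x. v x $ i * v x $ j)"
  by (rule integrable_mult_bounded[OF v_nth_integrable _ v_nth_bound]) simp

lemma smooth_W_v_integrable:
  assumes "smooth_W g"
  shows "integrable lborel (\<lambda>x. g x * (v x $ i))" "integrable lborel (\<lambda>x. g x * (v x $ i * v x $ j))"
proof -
  obtain B where B: "\<And>x. \<bar>g x\<bar> \<le> B" using smooth_W_bound[OF assms] by blast
  have [measurable]: "g \<in> borel_measurable borel" using assms smooth_W_D by auto
  show "integrable lborel (\<lambda>x. g x * (v x $ i))" "integrable lborel (\<lambda>x. g x * (v x $ i * v x $ j))"
    using integrable_mult_bounded[OF v_nth_integrable[of i] _ B]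
      integrable_mult_bounded[OF vv_integrable[of i j] _ B] by (simp_all add: mult.commute)
qed

text \<open>The growth of g at infinity is irrelevant because \<open>v\<close> has compact support:
  g may be cut off outside it. This makes the divergence condition usable against derivatives of
  functions in \<open>smooth_W\<close>.\<close>

lemma div_free_smooth:
  assumes g: "smooth_fun g"
  shows "(\<Sum>i\<in>UNIV. LINT x|lborel. pd i g x * v x $ i) = 0"
proof -
  \<comment> \<open>Equal to 1 on the ball of radius R + 1, an open set containing the support of
    \<open>v\<close>, so that no derivative changes where \<open>v\<close> is nonzero.\<close>
  define c where "c x = \<phi> ((1 / (R + 1)) *\<^sub>R x + 0)" for x
  have c: "c \<in> test_functions"
    unfolding c_def[abs_def] using R by (intro test_functions_affine \<phi>_test) auto
  have "c x = 1" if "norm x < R + 1" for x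
    using that R unfolding c_def by (intro \<phi>_eq_1) (simp add: field_simps)
  then have 1: "pd i (\<lambda>x. c x * g x) x = pd i g x" if "norm x < R + 1" for i x
    using that by (intro pd_cong_open[of "ball 0 (R + 1)"]) auto
  have 2: "v x $ i * pd i (\<lambda>x. c x * g x) x = pd i g x * v x $ i" for i x
    by (cases "norm x < R + 1") (simp_all add: 1 v_eq_0)
  have "(\<lambda>x. c x * g x) \<in> test_functions"
    using c g by (rule test_functions_mult)
  then have "(\<Sum>i\<in>UNIV. distr_pd i (distr_of (\<lambda>x. v x $ i)) (\<lambda>x. c x * g x)) = 0"
    using div_free unfolding div_free_def by blast
  then show ?thesis
    unfolding distr_pd_def distr_of_def 2 by (simp add: sum_negf)
qed

text \<open>The cancellation behind the double regularity: \<open>v \<otimes> v\<close> may be replaced by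
  \<open>(v - a) \<otimes> (v - a)\<close>, since the cross terms vanish by incompressibility.\<close>

lemma integral_hess_shift:
  assumes f: "smooth_W f"
  shows "(LINT x|lborel. hess f x (v x - a)) = (LINT x|lborel. hess f x (v x))"
proof -
  define h where "h i j = pd j (pd i f)" for i j
  have W: "smooth_W (h i j)" for i j unfolding h_def using f by (intro smooth_W_pd)
  have sym: "h i j = h j i" for i j
    unfolding h_def using f by (intro pd_commute smooth_W_D)
  note I = smooth_W_v_integrable[OF W] smooth_W_D(2)[OF W]
  \<comment> \<open>Removes the term with the constant a_i a_j.\<close>
  have h0: "(LINT x|lborel. h i j x) = 0" for i j
    unfolding h_def using f by (intro smooth_W_integral_pd smooth_W_pd)
  \<comment> \<open>For fixed i this is the divergence condition tested with \<open>pd i f\<close>.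
    It removes both cross terms, one of them after the symmetry \<open>sym\<close> has exchanged the
    indices.\<close>
  have div: "(\<Sum>j\<in>UNIV. LINT x|lborel. h i j x * v x $ j) = 0" for i
    unfolding h_def using f by (intro div_free_smooth smooth_fun_pd smooth_W_D)
  have e: "(LINT x|lborel. h i j x * ((v x - a) $ i * (v x - a) $ j)) =
      (LINT x|lborel. h i j x * (v x $ i * v x $ j)) - a $ j * (LINT x|lborel. h i j x * v x $ i)
        - a $ i * (LINT x|lborel. h i j x * v x $ j)" for i j
  proof -
    have "(LINT x|lborel. h i j x * ((v x - a) $ i * (v x - a) $ j)) =
      (LINT x|lborel. h i j x * (v x $ i * v x $ j) - a $ j * (h i j x * v x $ i)
        - a $ i * (h i j x * v x $ j) + (a $ i * a $ j) * h i j x)"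
      by (simp add: algebra_simps)
    also have "\<dots> = (LINT x|lborel. h i j x * (v x $ i * v x $ j)) - (LINT x|lborel. a $ j * (h i j x * v x $ i))
        - (LINT x|lborel. a $ i * (h i j x * v x $ j)) + (LINT x|lborel. (a $ i * a $ j) * h i j x)"
      using I by (subst Bochner_Integration.integral_add Bochner_Integration.integral_diff; (intro Bochner_Integration.integrable_add Bochner_Integration.integrable_diff integrable_mult_right)?; simp?)+
    finally show ?thesis by (simp add: h0)
  qed
  have i2: "integrable lborel (\<lambda>x. h i j x * ((v x - a) $ i * (v x - a) $ j))" for i j
  proof -
    have "integrable lborel (\<lambda>x. h i j x * (v x $ i * v x $ j) - a $ j * (h i j x * v x $ i)
        - a $ i * (h i j x * v x $ j) + (a $ i * a $ j) * h i j x)"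
      using I by (intro Bochner_Integration.integrable_add Bochner_Integration.integrable_diff integrable_mult_right)
    then show ?thesis by (simp add: algebra_simps)
  qed
  have "(LINT x|lborel. hess f x (v x - a)) =
      (\<Sum>i\<in>UNIV. \<Sum>j\<in>UNIV. LINT x|lborel. h i j x * ((v x - a) $ i * (v x - a) $ j))"
    unfolding hess_def h_def[symmetric]
    using i2 by (simp add: Bochner_Integration.integral_sum)
  also have "\<dots> = (\<Sum>i\<in>UNIV. \<Sum>j\<in>UNIV. LINT x|lborel. h i j x * (v x $ i * v x $ j))
      - (\<Sum>j\<in>UNIV. a $ j * (\<Sum>i\<in>UNIV. LINT x|lborel. h j i x * v x $ i))
      - (\<Sum>i\<in>UNIV. a $ i * (\<Sum>j\<in>UNIV. LINT x|lborel. h i j x * v x $ j))"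
    unfolding e sum_subtractf sum_distrib_left
    by (subst (2) sum.swap) (simp add: sym)
  also have "\<dots> = (\<Sum>i\<in>UNIV. \<Sum>j\<in>UNIV. LINT x|lborel. h i j x * (v x $ i * v x $ j))"
    by (simp add: div)
  also have "\<dots> = (LINT x|lborel. hess f x (v x))"
    unfolding hess_def h_def[symmetric]
    using I by (simp add: Bochner_Integration.integral_sum)
  finally show ?thesis .
qed

end

section \<open>The pressure\<close>

lemma abs_integral_le:
  fixes f g :: "'a \<Rightarrow> real"
  assumes "integrable M g" "f \<in> borel_measurable M" "\<And>x. \<bar>f x\<bar> \<le> g x"
  shows "\<bar>\<integral>x. f x \<partial>M\<bar> \<le> (\<integral>x. g x \<partial>M)"
proof -
  have "integrable M f"
    using assms by (intro Bochner_Integration.integrable_bound[OF assms(1)]) (auto intro!: AE_I2 order_trans[OF assms(3)])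
  then have "\<bar>\<integral>x. f x \<partial>M\<bar> \<le> (\<integral>x. \<bar>f x\<bar> \<partial>M)" "(\<integral>x. \<bar>f x\<bar> \<partial>M) \<le> (\<integral>x. g x \<partial>M)"
    using assms by (auto intro!: integral_abs_bound integral_mono)
  then show ?thesis by linarith
qed

lemma hess_norm_integrable: "smooth_W f \<Longrightarrow> integrable lborel (hess_norm f)"
  unfolding hess_norm_def[abs_def]
  by (intro Bochner_Integration.integrable_sum integrable_abs smooth_W_D smooth_W_pd)

lemma hess_norm_bound:
  assumes "smooth_W f"
  obtains B where "B \<ge> 0" "\<And>x. hess_norm f x \<le> B"
proof -
  have "\<exists>B. \<forall>x. \<bar>pd j (pd i f) x\<bar> \<le> B" for i j
    using smooth_W_bound[OF smooth_W_pd[OF smooth_W_pd[OF assms]]] by metis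
  then have "\<forall>x. \<bar>pd j (pd i f) x\<bar> \<le> (SOME B. \<forall>x. \<bar>pd j (pd i f) x\<bar> \<le> B)" for i j
    by (rule someI_ex)
  then obtain B where B: "\<And>i j x. \<bar>pd j (pd i f) x\<bar> \<le> B i j" by fast
  then have *: "hess_norm f x \<le> (\<Sum>i\<in>UNIV. \<Sum>j\<in>UNIV. B i j)" for x
    unfolding hess_norm_def by (intro sum_mono)
  from that[OF order_trans[OF hess_norm_nonneg *] *] show ?thesis .
qed

lemma hess_measurable:
  assumes "smooth_fun f"
  shows "(\<lambda>p. hess f (fst p) (snd p)) \<in> borel_measurable borel"
proof (rule borel_measurable_continuous_onI)
  have "continuous_on UNIV (\<lambda>p::(real^'a)\<times>(real^'a). pd j (pd i f) (fst p))" for i j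
    by (rule continuous_on_compose2[OF smooth_fun_continuous[OF smooth_fun_pd[OF smooth_fun_pd[OF assms]]]])
       (auto intro!: continuous_intros)
  then show "continuous_on UNIV (\<lambda>p. hess f (fst p) (snd p))"
    unfolding hess_def by (intro continuous_intros)
qed

lemma hess_compose_measurable:
  assumes "smooth_fun f" and [measurable]: "g \<in> borel_measurable M" "w \<in> borel_measurable M"
  shows "(\<lambda>x. hess f (g x) (w x)) \<in> borel_measurable M"
proof -
  have "(\<lambda>x. (g x, w x)) \<in> borel_measurable M" by (rule borel_measurable_Pair) measurable
  from measurable_compose[OF this hess_measurable[OF assms(1)]] show ?thesis by simp
qed

context pressure_data
begin

text \<open>The constant subtracted from the field is \<open>v y\<close>, its value at the centre of
  the kernel: |v x - v y|^2 is at most H^2 |x - y|^(2 \<gamma>), and the substitution z = c (x - y)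
  releases the factors c^(-d) and c^(-2 \<gamma>). Used with c = 1/t for \<sigma> and with c = 2^k
  for the frequency bands.\<close>

lemma integral_hess_bound:
  assumes f: "smooth_W f" and c: "c > 0"
    and int: "integrable lborel (\<lambda>z. hess_norm f z * norm z powr (2 * \<gamma>))"
  shows "\<bar>LINT x|lborel. hess f (c *\<^sub>R (x - y)) (v x)\<bar> \<le>
    H\<^sup>2 * (LINT z|lborel. hess_norm f z * norm z powr (2 * \<gamma>)) / (c ^ CARD('n) * c powr (2 * \<gamma>))"
proof -
  define b where "b = - (c *\<^sub>R y)"
  have cxb: "c *\<^sub>R (x - y) = c *\<^sub>R x + b" for x by (simp add: b_def algebra_simps)
  have sf: "smooth_fun f" using f smooth_W_D by blast
  define G where "G z = hess_norm f z * norm z powr (2 * \<gamma>)" for z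
  have G: "integrable lborel G" using int unfolding G_def[abs_def] .
  then have [measurable]: "G \<in> borel_measurable borel" by simp
  have "(LINT x|lborel. hess (\<lambda>x. f (c *\<^sub>R x + b)) x (v x - v y)) =
      (LINT x|lborel. hess (\<lambda>x. f (c *\<^sub>R x + b)) x (v x))"
    using c f by (intro integral_hess_shift smooth_W_affine) auto
  then have "(LINT x|lborel. hess f (c *\<^sub>R x + b) (v x)) = (LINT x|lborel. hess f (c *\<^sub>R x + b) (v x - v y))"
    using c by (simp add: hess_affine[OF sf])
  also have "\<bar>\<dots>\<bar> \<le> (LINT x|lborel. H\<^sup>2 / c powr (2 * \<gamma>) * G (c *\<^sub>R x + b))"
  proof (rule abs_integral_le)
    show "integrable lborel (\<lambda>x. H\<^sup>2 / c powr (2 * \<gamma>) * G (c *\<^sub>R x + b))"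
      using c G by (intro integrable_mult_right) (simp add: lborel_integrable_affine)
    show "(\<lambda>x. hess f (c *\<^sub>R x + b) (v x - v y)) \<in> borel_measurable lborel"
      using sf by (intro hess_compose_measurable) auto
    fix x
    have "norm (c *\<^sub>R x + b) = c * norm (x - y)" using c by (simp add: cxb[symmetric])
    then have n: "norm (x - y) = norm (c *\<^sub>R x + b) / c" using c by simp
    have "\<bar>hess f (c *\<^sub>R x + b) (v x - v y)\<bar> \<le> hess_norm f (c *\<^sub>R x + b) * (norm (v x - v y))\<^sup>2"
      by (rule abs_hess_le)
    also have "\<dots> \<le> hess_norm f (c *\<^sub>R x + b) * (H * norm (x - y) powr \<gamma>)\<^sup>2"
      by (intro mult_left_mono power_mono holder hess_norm_nonneg) auto
    also have "(H * norm (x - y) powr \<gamma>)\<^sup>2 = H\<^sup>2 * norm (x - y) powr (2 * \<gamma>)"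
      by (simp add: power_mult_distrib power2_eq_square powr_add[symmetric])
    also have "norm (x - y) powr (2 * \<gamma>) = norm (c *\<^sub>R x + b) powr (2 * \<gamma>) / c powr (2 * \<gamma>)"
      unfolding n by (rule powr_divide)
    finally show "\<bar>hess f (c *\<^sub>R x + b) (v x - v y)\<bar> \<le> H\<^sup>2 / c powr (2 * \<gamma>) * G (c *\<^sub>R x + b)"
      by (simp add: G_def mult_ac)
  qed
  also have "\<dots> = H\<^sup>2 / c powr (2 * \<gamma>) * (LINT x|lborel. G (c *\<^sub>R x + b))" by simp
  also have "(LINT x|lborel. G (c *\<^sub>R x + b)) = (LINT x|lborel. G x) / c ^ CARD('n)"
    using lborel_integral_affine[of G c b] c by simp
  finally show ?thesis unfolding cxb G_def by (simp add: mult_ac)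
qed

lemma hess_\<sigma>_eq_0: "3 < norm z \<Longrightarrow> hess \<sigma> z a = 0"
  by (simp add: hess_def pd_pd_\<sigma>_eq_0)

lemma hess_norm_\<sigma>_weighted: "integrable lborel (\<lambda>z. hess_norm \<sigma> z * norm z powr (2 * \<gamma>))"
proof -
  \<comment> \<open>Truncating the weight at 3 makes it bounded and changes nothing where the
    Hessian of \<sigma> lives.\<close>
  have "integrable lborel (\<lambda>z. hess_norm \<sigma> z * (min 3 (norm z)) powr (2 * \<gamma>))"
  proof (rule integrable_mult_bounded[OF hess_norm_integrable[OF \<sigma>_W]])
    show "\<bar>min 3 (norm z) powr (2 * \<gamma>)\<bar> \<le> 3 powr (2 * \<gamma>)" for z :: "real^'n"
      using \<gamma> by (auto intro!: powr_mono2)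
  qed measurable
  moreover have "hess_norm \<sigma> z * (min 3 (norm z)) powr (2 * \<gamma>) = hess_norm \<sigma> z * norm z powr (2 * \<gamma>)" for z
    by (cases "3 < norm z") (auto simp: hess_norm_def pd_pd_\<sigma>_eq_0 min_def)
  ultimately show ?thesis by simp
qed

section \<open>The layers of the pressure\<close>

text \<open>The power of t: rescaling and two derivatives contribute t^(-d-2), the weight in the
  scale integral one factor t. Since \<sigma> is even, x - y may stand for y - x.\<close>

definition Q :: "real \<Rightarrow> real^'n \<Rightarrow> real" where
  "Q t y = (if 0 < t then (LINT x|lborel. hess \<sigma> ((1 / t) *\<^sub>R (x - y)) (v x)) / t ^ (CARD('n) + 1) else 0)"

text \<open>One summand for t \<le> 1, from the cancellation, and one for t > 1, from the sizes of
  kernel, field and support.\<close>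

definition Q_const :: real where
  "Q_const = (LINT z|lborel. hess_norm \<sigma> z * norm z powr (2 * \<gamma>)) +
     (SUP z. hess_norm \<sigma> z) * vmax\<^sup>2 * measure lborel (cball (0::real^'n) R)"

lemma hess_norm_\<sigma>_le_Sup: "hess_norm \<sigma> z \<le> (SUP z. hess_norm \<sigma> z)"
  by (metis hess_norm_bound[OF \<sigma>_W] bdd_aboveI2 cSUP_upper UNIV_I)

lemma Q_const_nonneg: "0 \<le> Q_const"
  unfolding Q_const_def using order_trans[OF hess_norm_nonneg hess_norm_\<sigma>_le_Sup]
  by (intro add_nonneg_nonneg mult_nonneg_nonneg Bochner_Integration.integral_nonneg) (auto simp: hess_norm_nonneg)

text \<open>At small scales the gain t^(d + 2 \<gamma>) of \<open>integral_hess_bound\<close> is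
  divided by t^(d + 1). The result t^(2 \<gamma> - 1) is not integrable at infinity; at large scales
  the integral is instead bounded uniformly in t through the compact support of \<open>v\<close>,
  and the prefactor t^(-d-1) supplies the decay.\<close>

lemma Q_bound: "\<bar>Q t y\<bar> \<le> H\<^sup>2 * Q_const * dominator (2 * \<gamma>) t"
proof (cases "0 < t")
  case False
  then show ?thesis by (simp add: Q_def dominator_def)
next
  case t: True
  let ?A = "LINT z|lborel. hess_norm \<sigma> z * norm z powr (2 * \<gamma>)"
  let ?B = "(SUP z. hess_norm \<sigma> z) * vmax\<^sup>2 * measure lborel (cball (0::real^'n) R)"
  let ?d = "CARD('n)"
  let ?I = "LINT x|lborel. hess \<sigma> ((1 / t) *\<^sub>R (x - y)) (v x)"
  have A: "0 \<le> ?A" by (intro Bochner_Integration.integral_nonneg) (simp add: hess_norm_nonneg)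
  have S: "0 \<le> (SUP z. hess_norm \<sigma> z)" by (rule order_trans[OF hess_norm_nonneg hess_norm_\<sigma>_le_Sup])
  then have B: "0 \<le> ?B" by simp
  have Q: "\<bar>Q t y\<bar> = \<bar>?I\<bar> / t ^ (?d + 1)" using t by (simp add: Q_def)
  show ?thesis
  proof (cases "t \<le> 1")
    case True
    have "\<bar>?I\<bar> \<le> H\<^sup>2 * ?A / ((1 / t) ^ ?d * (1 / t) powr (2 * \<gamma>))"
      using t by (intro integral_hess_bound \<sigma>_W hess_norm_\<sigma>_weighted) auto
    also have "\<dots> = H\<^sup>2 * ?A * (t ^ ?d * t powr (2 * \<gamma>))"
      using t by (simp add: powr_divide power_divide field_simps)
    finally have "\<bar>Q t y\<bar> \<le> H\<^sup>2 * ?A * (t ^ ?d * t powr (2 * \<gamma>)) / t ^ (?d + 1)"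
      unfolding Q using t by (intro divide_right_mono) auto
    also have "\<dots> = H\<^sup>2 * ?A * t powr (2 * \<gamma> - 1)"
      using t by (simp add: powr_diff field_simps)
    also have "\<dots> \<le> H\<^sup>2 * Q_const * t powr (2 * \<gamma> - 1)"
      unfolding Q_const_def using B by (intro mult_right_mono mult_left_mono) auto
    finally show ?thesis using t True by (simp add: dominator_def)
  next
    case False
    have "\<bar>?I\<bar> \<le> (LINT x|lborel. (SUP z. hess_norm \<sigma> z) * (H * vmax)\<^sup>2 * indicator (cball (0::real^'n) R) x)"
    proof (rule abs_integral_le)
      show "(\<lambda>x. hess \<sigma> ((1 / t) *\<^sub>R (x - y)) (v x)) \<in> borel_measurable lborel"
        using smooth_\<sigma> by (intro hess_compose_measurable) auto
      show "\<bar>hess \<sigma> ((1 / t) *\<^sub>R (x - y)) (v x)\<bar> \<le>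
          (SUP z. hess_norm \<sigma> z) * (H * vmax)\<^sup>2 * indicator (cball (0::real^'n) R) x" for x
      proof (cases "R < norm x")
        case True
        then show ?thesis by (simp add: v_eq_0 hess_def)
      next
        case False
        have "\<bar>hess \<sigma> ((1 / t) *\<^sub>R (x - y)) (v x)\<bar> \<le> hess_norm \<sigma> ((1 / t) *\<^sub>R (x - y)) * (norm (v x))\<^sup>2"
          by (rule abs_hess_le)
        also have "\<dots> \<le> (SUP z. hess_norm \<sigma> z) * (H * vmax)\<^sup>2"
          using S by (intro mult_mono hess_norm_\<sigma>_le_Sup power_mono v_bound) auto
        finally show ?thesis using False by simp
      qed
    qed (intro integrable_mult_right integrable_real_indicator,
        simp_all add: emeasure_compact_finite[OF compact_cball, simplified])
    also have "\<dots> = H\<^sup>2 * ?B" by (simp add: power_mult_distrib)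
    finally have "\<bar>Q t y\<bar> \<le> H\<^sup>2 * ?B / t ^ (?d + 1)"
      unfolding Q using t by (intro divide_right_mono) auto
    also have "\<dots> \<le> H\<^sup>2 * ?B / t ^ 2"
    proof -
      have "?d \<ge> 1" by (simp add: Suc_leI)
      then have "t ^ 2 \<le> t ^ (?d + 1)" using False by (intro power_increasing) auto
      then show ?thesis using t B by (intro divide_left_mono) auto
    qed
    also have "\<dots> = H\<^sup>2 * ?B * t powr (-2)" using t by (simp add: powr_minus powr_numeral divide_inverse)
    also have "\<dots> \<le> H\<^sup>2 * Q_const * t powr (-2)"
      unfolding Q_const_def using A by (intro mult_right_mono mult_left_mono) auto
    finally show ?thesis using False by (simp add: dominator_def)
  qed
qed

text \<open>\<open>v\<close> lives in radius R and the kernel at scale t in radius 3 t, so a point y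
  sees only scales of at least (|y| - R) / 3.\<close>

lemma Q_eq_0:
  assumes "R + 3 * t < norm y"
  shows "Q t y = 0"
proof (cases "0 < t")
  case t: True
  have "hess \<sigma> ((1 / t) *\<^sub>R (x - y)) (v x) = 0" for x
  proof (cases "R < norm x")
    case True
    then show ?thesis by (simp add: v_eq_0 hess_def)
  next
    case False
    then have "3 * t < norm (x - y)" using assms norm_triangle_ineq2[of y x] by (simp add: norm_minus_commute)
    then have "3 < norm (x - y) / t" using t by (simp add: pos_less_divide_eq)
    also have "norm (x - y) / t = norm ((1 / t) *\<^sub>R (x - y))" using t by (simp only: norm_scaleR) simp
    finally show ?thesis by (rule hess_\<sigma>_eq_0)
  qed
  then show ?thesis by (simp add: Q_def)
qed (simp add: Q_def)

lemma Q_measurable: "(\<lambda>(t, y). Q t y) \<in> borel_measurable (lborel \<Otimes>\<^sub>M lborel)"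
proof -
  have "(\<lambda>(p, x). hess \<sigma> ((1 / fst p) *\<^sub>R (x - snd p)) (v x)) \<in>
      borel_measurable ((lborel \<Otimes>\<^sub>M lborel) \<Otimes>\<^sub>M (lborel :: (real^'n) measure))"
    unfolding split_beta by (rule hess_compose_measurable[OF smooth_\<sigma>]) measurable
  from lborel.borel_measurable_lebesgue_integral[OF this]
  have [measurable]: "(\<lambda>p. LINT x|lborel. hess \<sigma> ((1 / fst p) *\<^sub>R (x - snd p)) (v x)) \<in>
      borel_measurable (lborel \<Otimes>\<^sub>M lborel)" .
  have "(\<lambda>p. if 0 < fst p then (LINT x|lborel. hess \<sigma> ((1 / fst p) *\<^sub>R (x - snd p)) (v x)) / fst p ^ (CARD('n) + 1) else 0) \<in>
      borel_measurable (lborel \<Otimes>\<^sub>M lborel)"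
    by measurable
  then show ?thesis unfolding Q_def split_beta .
qed

lemma Q_integrable: "integrable lborel (\<lambda>t. Q t y)"
proof (rule Bochner_Integration.integrable_bound)
  show "integrable lborel (\<lambda>t. H\<^sup>2 * Q_const * dominator (2 * \<gamma>) t)"
    using integrable_dominator[of "2 * \<gamma>"] \<gamma> by simp
  show "(\<lambda>t. Q t y) \<in> borel_measurable lborel"
    using measurable_compose[OF measurable_Pair2'[of y lborel lborel] Q_measurable, simplified]
    by (simp add: measurable_Pair1' measurable_compose[OF _ Q_measurable, of "\<lambda>t. (t, y)", simplified])
  show "AE t in lborel. norm (Q t y) \<le> norm (H\<^sup>2 * Q_const * dominator (2 * \<gamma>) t)"
    using Q_bound Q_const_nonneg by (intro AE_I2) (auto simp: dominator_nonneg)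
qed

definition pressure :: "real^'n \<Rightarrow> real" where
  "pressure y = (LINT t|lborel. Q t y) / mass"

lemma pressure_measurable [measurable]: "pressure \<in> borel_measurable borel"
proof -
  have "(\<lambda>(y, t). Q t y) \<in> borel_measurable ((lborel :: (real^'n) measure) \<Otimes>\<^sub>M lborel)"
    using measurable_compose[OF measurable_pair_swap' Q_measurable] by (simp add: split_beta)
  from lborel.borel_measurable_lebesgue_integral[OF this]
  have "(\<lambda>y. LINT t|lborel. Q t y) \<in> borel_measurable borel" by simp
  then show ?thesis unfolding pressure_def[abs_def] by simp
qed

definition pressure_const :: real where
  "pressure_const = Q_const * (LINT t|lborel. dominator (2 * \<gamma>) t) / mass"

lemma pressure_bound: "\<bar>pressure y\<bar> \<le> H\<^sup>2 * pressure_const"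
proof -
  have "\<bar>LINT t|lborel. Q t y\<bar> \<le> (LINT t|lborel. H\<^sup>2 * Q_const * dominator (2 * \<gamma>) t)"
    using Q_integrable[of y] integrable_dominator[of "2 * \<gamma>"] \<gamma>
    by (intro abs_integral_le Q_bound) auto
  then show ?thesis
    unfolding pressure_def pressure_const_def using mass_pos by (simp add: divide_right_mono)
qed

text \<open>Only large scales reach a distant point, and their total contribution is a tail of the
  integrable \<open>dominator\<close>.\<close>

lemma pressure_tendsto_0: "(pressure \<longlongrightarrow> 0) at_infinity"
proof -
  let ?D = "\<lambda>s. LINT t|lborel. H\<^sup>2 * Q_const * (indicator {s..} t * dominator (2 * \<gamma>) t)"
  have dom: "integrable lborel (dominator (2 * \<gamma>))" using integrable_dominator[of "2 * \<gamma>"] \<gamma> by simp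
  have ind: "integrable lborel (\<lambda>t. indicator {s..} t * dominator (2 * \<gamma>) t)" for s
    using integrable_mult_indicator[OF _ dom, of "{s..}"] by simp
  have "(?D \<longlongrightarrow> (LINT t|(lborel::real measure). 0)) at_top"
  proof (rule integral_dominated_convergence_at_top[where w = "\<lambda>t. H\<^sup>2 * Q_const * dominator (2 * \<gamma>) t"])
    show "\<forall>\<^sub>F s in at_top. AE t in lborel. norm (H\<^sup>2 * Q_const * (indicator {s..} t * dominator (2 * \<gamma>) t)) \<le>
        H\<^sup>2 * Q_const * dominator (2 * \<gamma>) t"
      using Q_const_nonneg by (intro always_eventually allI AE_I2)
        (auto simp: indicator_def dominator_nonneg abs_mult)
    show "AE t in lborel. ((\<lambda>s. H\<^sup>2 * Q_const * (indicator {s..} t * dominator (2 * \<gamma>) t)) \<longlongrightarrow> 0) at_top"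
    proof (rule AE_I2)
      fix t :: real
      have "\<forall>\<^sub>F s in at_top. H\<^sup>2 * Q_const * (indicator {s..} t * dominator (2 * \<gamma>) t) = 0"
        using eventually_gt_at_top[of t] by eventually_elim simp
      then show "((\<lambda>s. H\<^sup>2 * Q_const * (indicator {s..} t * dominator (2 * \<gamma>) t)) \<longlongrightarrow> 0) at_top"
        by (rule tendsto_eventually)
    qed
  qed (use dom borel_measurable_integrable[OF ind] in auto)
  then have "(?D \<longlongrightarrow> 0) at_top" by simp
  moreover have "filterlim (\<lambda>y::real^'n. (norm y - R - 1) / 3) at_top at_infinity"
  proof (rule filterlim_compose[OF _ filterlim_norm_at_top])
    show "filterlim (\<lambda>u. (u - R - 1) / 3) at_top at_top" by real_asymp
  qed
  ultimately have D: "((\<lambda>y::real^'n. ?D ((norm y - R - 1) / 3) / mass) \<longlongrightarrow> 0) at_infinity"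
    using filterlim_compose[of ?D "nhds 0" at_top] by (intro tendsto_divide_zero) blast
  show ?thesis
  proof (rule Lim_null_comparison[OF always_eventually D], rule allI)
    fix y :: "real^'n"
    let ?s = "(norm y - R - 1) / 3"
    have "\<bar>LINT t|lborel. Q t y\<bar> \<le> ?D ?s"
    proof (rule abs_integral_le)
      show "integrable lborel (\<lambda>t. H\<^sup>2 * Q_const * (indicator {?s..} t * dominator (2 * \<gamma>) t))"
        using ind by (rule integrable_mult_right)
      show "\<bar>Q t y\<bar> \<le> H\<^sup>2 * Q_const * (indicator {?s..} t * dominator (2 * \<gamma>) t)" for t
        using Q_bound[of t y] Q_eq_0[of t y] by (cases "?s \<le> t") auto
    qed (use Q_integrable in simp)
    then show "norm (pressure y) \<le> ?D ?s / mass"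
      unfolding pressure_def using mass_pos by (simp add: divide_right_mono)
  qed
qed

end

section \<open>Mollification\<close>

lemma integrable_pair_bound_norm:
  fixes F :: "'a::euclidean_space \<times> 'b::euclidean_space \<Rightarrow> 'c::{banach, second_countable_topology}"
  assumes F: "F \<in> borel_measurable (lborel \<Otimes>\<^sub>M lborel)"
    and a: "integrable lborel a" and b: "integrable lborel b"
    and le: "\<And>x y. norm (F (x, y)) \<le> a x * b y"
  shows "integrable (lborel \<Otimes>\<^sub>M lborel) F"
proof (rule Bochner_Integration.integrable_bound[OF _ F])
  have [measurable]: "a \<in> borel_measurable lborel" "b \<in> borel_measurable lborel"
    using a b by auto
  show "integrable (lborel \<Otimes>\<^sub>M lborel) (\<lambda>p. a (fst p) * b (snd p))"
  proof (rule lborel_pair.Fubini_integrable)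
    show "integrable lborel (\<lambda>x. LINT y|lborel. norm (a (fst (x, y)) * b (snd (x, y))))"
      using a by (simp add: abs_mult)
    show "AE x in lborel. integrable lborel (\<lambda>y. a (fst (x, y)) * b (snd (x, y)))"
      using b by simp
  qed measurable
  show "AE p in lborel \<Otimes>\<^sub>M lborel. norm (F p) \<le> norm (a (fst p) * b (snd p))"
    using le by (intro AE_I2) (force intro: order_trans[OF _ abs_ge_self])
qed

lemma integrable_pair_bound:
  fixes F :: "'a::euclidean_space \<times> 'b::euclidean_space \<Rightarrow> real"
  assumes "F \<in> borel_measurable (lborel \<Otimes>\<^sub>M lborel)" "integrable lborel a" "integrable lborel b"
    and "\<And>x y. \<bar>F (x, y)\<bar> \<le> a x * b y"
  shows "integrable (lborel \<Otimes>\<^sub>M lborel) F"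
  using assms by (intro integrable_pair_bound_norm) auto

context lp_cutoff_function
begin

lemma lap_\<sigma>_eq_0: "3 < norm z \<Longrightarrow> lap \<sigma> z = 0"
  by (simp add: lap_def pd_pd_\<sigma>_eq_0)

definition mollify :: "real \<Rightarrow> (real^'n \<Rightarrow> real) \<Rightarrow> real^'n \<Rightarrow> real" where
  "mollify t g x = (LINT y|lborel. g y * (\<phi> ((1 / t) *\<^sub>R (x - y)) / t ^ CARD('n)))"

lemma mollify_subst:
  assumes t: "t > 0" and [measurable]: "g \<in> borel_measurable borel"
  shows "mollify t g x = (LINT z|lborel. \<phi> z * g (x - t *\<^sub>R z))"
proof -
  have "mollify t g x = \<bar>- t\<bar> ^ CARD('n) *\<^sub>R
      (LINT z|lborel. g ((- t) *\<^sub>R z + x) * (\<phi> ((1 / t) *\<^sub>R (x - ((- t) *\<^sub>R z + x))) / t ^ CARD('n)))"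
    unfolding mollify_def using t by (intro lborel_integral_affine) auto
  then show ?thesis using t by (simp add: algebra_simps)
qed

text \<open>\<open>\<phi>_kernel_FTC\<close> integrated against g. Every kernel involved vanishes
  outside the ball of radius 3 T about x, so local integrability of g suffices: the identity serves
  the derivatives of a tested function in the existence part and the difference of two solutions in
  the uniqueness part.\<close>

lemma mollify_increment:
  assumes g[measurable]: "g \<in> borel_measurable borel"
    and loc: "\<And>r. integrable lborel (\<lambda>y. indicator (cball 0 r) y * g y)"
    and \<epsilon>: "0 < \<epsilon>" "\<epsilon> \<le> T"
  shows "mollify T g x - mollify \<epsilon> g x =
    (LINT t|lborel. indicator {\<epsilon>..T} t / t ^ (CARD('n) + 1) * (LINT y|lborel. lap \<sigma> ((1 / t) *\<^sub>R (x - y)) * g y))"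
proof -
  let ?d = "CARD('n)"
  let ?r = "norm x + 3 * T"
  let ?F = "\<lambda>(t, y). indicator {\<epsilon>..T} t / t ^ (?d + 1) * (lap \<sigma> ((1 / t) *\<^sub>R (x - y)) * g y)"
  obtain B where B: "B \<ge> 0" "\<And>z. \<bar>lap \<sigma> z\<bar> \<le> B" using smooth_W_lap(4)[OF \<sigma>_W] by blast
  have [measurable]: "lap \<sigma> \<in> borel_measurable borel" by (rule smooth_W_lap(2)[OF \<sigma>_W])
  have far: "\<phi> ((1 / t) *\<^sub>R (x - y)) = 0" "lap \<sigma> ((1 / t) *\<^sub>R (x - y)) = 0"
    if "0 < t" "t \<le> T" "?r < norm y" for t y
  proof -
    have "3 * t < norm (x - y)" using that norm_triangle_ineq2[of y x] by (simp add: norm_minus_commute)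
    then have "3 < norm (x - y) / t" using that by (simp add: pos_less_divide_eq)
    also have "norm (x - y) / t = norm ((1 / t) *\<^sub>R (x - y))" using that by (simp only: norm_scaleR) simp
    finally show "\<phi> ((1 / t) *\<^sub>R (x - y)) = 0" "lap \<sigma> ((1 / t) *\<^sub>R (x - y)) = 0"
      by (auto intro: \<phi>_eq_0 lap_\<sigma>_eq_0)
  qed
  have m: "integrable lborel (\<lambda>y. g y * (\<phi> ((1 / t) *\<^sub>R (x - y)) / t ^ ?d))" if "0 < t" "t \<le> T" for t
  proof -
    obtain P where P: "\<And>z. \<bar>\<phi> z\<bar> \<le> P" using smooth_W_bound[OF \<phi>_W] by blast
    have "integrable lborel (\<lambda>y. (indicator (cball 0 ?r) y * g y) * (\<phi> ((1 / t) *\<^sub>R (x - y)) / t ^ ?d))"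
      using P that by (intro integrable_mult_bounded[OF loc, where B = "P / t ^ ?d"]) (auto intro!: divide_right_mono)
    also have "(\<lambda>y. (indicator (cball 0 ?r) y * g y) * (\<phi> ((1 / t) *\<^sub>R (x - y)) / t ^ ?d)) =
        (\<lambda>y. g y * (\<phi> ((1 / t) *\<^sub>R (x - y)) / t ^ ?d))"
      using far(1)[OF that] by (auto simp: fun_eq_iff indicator_def)
    finally show ?thesis .
  qed
  have F: "integrable (lborel \<Otimes>\<^sub>M lborel) ?F"
  proof (rule integrable_pair_bound)
    show "integrable lborel (\<lambda>t::real. indicator {\<epsilon>..T} t * (B / \<epsilon> ^ (?d + 1)))"
      by (intro integrable_mult_left integrable_real_indicator) (auto simp: emeasure_lborel_Icc_eq)
    show "integrable lborel (\<lambda>y. \<bar>indicator (cball 0 ?r) y * g y\<bar>)" using loc by (rule integrable_abs)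
    show "?F \<in> borel_measurable (lborel \<Otimes>\<^sub>M lborel)" by measurable
    fix t :: real and y
    show "\<bar>?F (t, y)\<bar> \<le> indicator {\<epsilon>..T} t * (B / \<epsilon> ^ (?d + 1)) * \<bar>indicator (cball 0 ?r) y * g y\<bar>"
    proof (cases "t \<in> {\<epsilon>..T} \<and> norm y \<le> ?r")
      case True
      then have "\<bar>lap \<sigma> ((1 / t) *\<^sub>R (x - y))\<bar> / t ^ (?d + 1) \<le> B / \<epsilon> ^ (?d + 1)"
        using \<epsilon> B by (intro frac_le power_mono) auto
      from mult_right_mono[OF this, of "\<bar>g y\<bar>"] True \<epsilon> show ?thesis
        by (simp add: abs_mult)
    next
      case False
      then show ?thesis using far(2)[of t y] \<epsilon> by (auto simp: indicator_def)
    qed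
  qed
  have "(LINT t|lborel. indicator {\<epsilon>..T} t / t ^ (?d + 1) * (LINT y|lborel. lap \<sigma> ((1 / t) *\<^sub>R (x - y)) * g y)) =
      (LINT t|lborel. LINT y|lborel. ?F (t, y))" by simp
  also have "\<dots> = (LINT y|lborel. LINT t|lborel. ?F (t, y))"
    using lborel_pair.Fubini_integral[of "\<lambda>t y. ?F (t, y)"] F by simp
  also have "\<dots> = (LINT y|lborel. g y * (LINT t|lborel. lap \<sigma> ((1 / t) *\<^sub>R (x - y)) / t ^ (?d + 1) * indicator {\<epsilon>..T} t))"
    by (subst Bochner_Integration.integral_mult_right_zero[symmetric]) (simp add: mult_ac)
  also have "\<dots> = (LINT y|lborel. g y * (\<phi> ((1 / T) *\<^sub>R (x - y)) / T ^ ?d) - g y * (\<phi> ((1 / \<epsilon>) *\<^sub>R (x - y)) / \<epsilon> ^ ?d))"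
    unfolding \<phi>_kernel_FTC[OF \<epsilon>] by (simp add: right_diff_distrib)
  also have "\<dots> = mollify T g x - mollify \<epsilon> g x"
    unfolding mollify_def using \<epsilon> by (intro Bochner_Integration.integral_diff m) auto
  finally show ?thesis ..
qed

lemma mollify_measurable:
  assumes [measurable]: "g \<in> borel_measurable borel"
  shows "mollify t g \<in> borel_measurable borel"
proof -
  have "(\<lambda>(x, y). g y * (\<phi> ((1 / t) *\<^sub>R (x - y)) / t ^ CARD('n))) \<in> borel_measurable (borel \<Otimes>\<^sub>M lborel)"
    by measurable
  from lborel.borel_measurable_lebesgue_integral[OF this]
  show ?thesis unfolding mollify_def[abs_def] .
qed

lemma mollify_bound:
  assumes t: "t > 0" and g: "g \<in> borel_measurable borel" "\<And>x. \<bar>g x\<bar> \<le> B"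
  shows "\<bar>mollify t g x\<bar> \<le> B * mass"
proof -
  have "\<bar>mollify t g x\<bar> \<le> B * (LINT z|lborel. \<bar>\<phi> z\<bar>)"
    unfolding mollify_subst[OF t g(1)] using g
    by (intro abs_integral_mult_le smooth_W_D(2)[OF \<phi>_W]) auto
  then show ?thesis by (simp add: mass_def \<phi>_nonneg)
qed

lemma mollify_bound_large:
  assumes t: "t > 0" and g: "integrable lborel g" and P: "\<And>z. \<bar>\<phi> z\<bar> \<le> P"
  shows "\<bar>mollify t g x\<bar> \<le> P / t ^ CARD('n) * (LINT y|lborel. \<bar>g y\<bar>)"
  unfolding mollify_def using t P
  by (intro abs_integral_mult_le g) (auto intro!: divide_right_mono)

lemma mollify_tendsto:
  assumes g: "continuous_on UNIV g" "\<And>x. \<bar>g x\<bar> \<le> B"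
  shows "(\<lambda>n. mollify (1 / real (Suc n)) g x) \<longlonglongrightarrow> mass * g x"
proof -
  have [measurable]: "g \<in> borel_measurable borel" by (rule borel_measurable_continuous_onI[OF g(1)])
  have "(\<lambda>n. LINT z|lborel. \<phi> z * g (x - (1 / real (Suc n)) *\<^sub>R z)) \<longlonglongrightarrow> (LINT z|lborel. \<phi> z * g x)"
  proof (rule integral_dominated_convergence[where w = "\<lambda>z. B * \<phi> z"])
    show "integrable lborel (\<lambda>z. B * \<phi> z)" using smooth_W_D(2)[OF \<phi>_W] by simp
    show "AE z in lborel. (\<lambda>n. \<phi> z * g (x - (1 / real (Suc n)) *\<^sub>R z)) \<longlonglongrightarrow> \<phi> z * g x"
    proof (intro AE_I2 tendsto_mult tendsto_const)
      fix z
      have "(\<lambda>n. x - (1 / real (Suc n)) *\<^sub>R z) \<longlonglongrightarrow> x - 0 *\<^sub>R z"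
        by (intro tendsto_intros LIMSEQ_Suc[OF lim_1_over_n])
      then show "(\<lambda>n. g (x - (1 / real (Suc n)) *\<^sub>R z)) \<longlonglongrightarrow> g x"
        using g(1) by (intro isCont_tendsto_compose[of x g]) (auto simp: continuous_on_eq_continuous_at)
    qed
    show "AE z in lborel. norm (\<phi> z * g (x - (1 / real (Suc n)) *\<^sub>R z)) \<le> B * \<phi> z" for n
      using g(2) by (intro AE_I2) (simp add: abs_mult \<phi>_nonneg mult.commute[of B] mult_left_mono)
  qed measurable
  then show ?thesis by (simp add: mollify_subst mass_def mult.commute)
qed

end

section \<open>The pressure equation\<close>

context pressure_data
begin

text \<open>Fubini brings \<open>lap f\<close> under the x-integral, and
  \<open>integral_hess_lap\<close> trades it for \<open>lap \<sigma>\<close>. What results is the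
  t-derivative of the quantity \<open>mollified_hess\<close> below.\<close>

lemma integral_Q_lap:
  assumes f: "smooth_W f" and t: "0 < t"
  shows "(LINT y|lborel. Q t y * lap f y) = (\<Sum>i\<in>UNIV. \<Sum>j\<in>UNIV. LINT x|lborel. v x $ i * v x $ j *
    ((LINT y|lborel. lap \<sigma> ((1 / t) *\<^sub>R (x - y)) * pd j (pd i f) y) / t ^ (CARD('n) + 1)))"
proof -
  let ?d = "CARD('n)"
  define s where "s i j z = pd j (pd i \<sigma>) z" for i j z
  have sW: "smooth_W (s i j)" for i j unfolding s_def[abs_def] by (intro smooth_W_pd \<sigma>_W)
  have [measurable]: "s i j \<in> borel_measurable borel" "lap f \<in> borel_measurable borel" for i j
    using sW smooth_W_D(4) smooth_W_lap(2)[OF f] by auto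
  have sI: "integrable lborel (\<lambda>x. s i j ((1 / t) *\<^sub>R (x - y)) * (v x $ i * v x $ j))" for i j y
    using smooth_W_v_integrable(2)[OF smooth_W_affine[OF sW, of "1 / t" _ _ "- ((1 / t) *\<^sub>R y)"]] t
    by (simp add: algebra_simps)
  have F: "integrable (lborel \<Otimes>\<^sub>M lborel) (\<lambda>(y, x). s i j ((1 / t) *\<^sub>R (x - y)) * (v x $ i * v x $ j) * lap f y)" for i j
  proof -
    obtain B where B: "B \<ge> 0" "\<And>z. \<bar>s i j z\<bar> \<le> B" using smooth_W_bound[OF sW] by metis
    show ?thesis
    proof (rule integrable_pair_bound)
      show "integrable lborel (\<lambda>y. B * \<bar>lap f y\<bar>)" "integrable lborel (\<lambda>x. \<bar>v x $ i * v x $ j\<bar>)"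
        using smooth_W_lap(1)[OF f] vv_integrable by (auto intro!: integrable_abs)
      show "\<bar>case (y, x) of (y, x) \<Rightarrow> s i j ((1 / t) *\<^sub>R (x - y)) * (v x $ i * v x $ j) * lap f y\<bar> \<le>
          B * \<bar>lap f y\<bar> * \<bar>v x $ i * v x $ j\<bar>" for y x
        using mult_right_mono[OF B(2)[of "(1 / t) *\<^sub>R (x - y)"], of "\<bar>lap f y\<bar> * \<bar>v x $ i * v x $ j\<bar>"]
        by (simp add: abs_mult mult_ac)
    qed measurable
  qed
  \<comment> \<open>In y the kernel is \<sigma> composed with an affine map of factor - 1/t; second
    derivatives produce the same factor 1/t^2 on both sides, and it cancels.\<close>
  have swap: "(LINT y|lborel. s i j ((1 / t) *\<^sub>R (x - y)) * lap f y) =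
      (LINT y|lborel. lap \<sigma> ((1 / t) *\<^sub>R (x - y)) * pd j (pd i f) y)" for i j x
  proof -
    let ?c = "- (1 / t)" and ?b = "(1 / t) *\<^sub>R x"
    have a: "(1 / t) *\<^sub>R (x - y) = ?c *\<^sub>R y + ?b" for y by (simp add: algebra_simps)
    have "(LINT y|lborel. pd j (pd i (\<lambda>y. \<sigma> (?c *\<^sub>R y + ?b))) y * lap f y) =
        (LINT y|lborel. lap (\<lambda>y. \<sigma> (?c *\<^sub>R y + ?b)) y * pd j (pd i f) y)"
      using t by (intro integral_hess_lap f smooth_W_affine \<sigma>_W) auto
    then show ?thesis
      unfolding a s_def pd_pd_affine[OF smooth_\<sigma>] lap_affine[OF smooth_\<sigma>] using t by (simp add: mult.assoc)
  qed
  have "(LINT y|lborel. Q t y * lap f y) =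
      (LINT y|lborel. (\<Sum>i\<in>UNIV. \<Sum>j\<in>UNIV. (LINT x|lborel. s i j ((1 / t) *\<^sub>R (x - y)) * (v x $ i * v x $ j) * lap f y) / t ^ (?d + 1)))"
  proof (rule Bochner_Integration.integral_cong[OF refl])
    fix y
    have "(LINT x|lborel. hess \<sigma> ((1 / t) *\<^sub>R (x - y)) (v x)) =
        (\<Sum>i\<in>UNIV. \<Sum>j\<in>UNIV. LINT x|lborel. s i j ((1 / t) *\<^sub>R (x - y)) * (v x $ i * v x $ j))"
      unfolding hess_def s_def[symmetric]
      by (subst Bochner_Integration.integral_sum, intro Bochner_Integration.integrable_sum sI)
         (intro sum.cong refl Bochner_Integration.integral_sum sI)
    then show "Q t y * lap f y = (\<Sum>i\<in>UNIV. \<Sum>j\<in>UNIV. (LINT x|lborel. s i j ((1 / t) *\<^sub>R (x - y)) * (v x $ i * v x $ j) * lap f y) / t ^ (?d + 1))"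
      using t by (simp add: Q_def sum_distrib_right sum_divide_distrib)
  qed
  also have "\<dots> = (\<Sum>i\<in>UNIV. \<Sum>j\<in>UNIV. (LINT y|lborel. (LINT x|lborel. s i j ((1 / t) *\<^sub>R (x - y)) * (v x $ i * v x $ j) * lap f y)) / t ^ (?d + 1))"
  proof -
    have i: "integrable lborel (\<lambda>y. (LINT x|lborel. s i j ((1 / t) *\<^sub>R (x - y)) * (v x $ i * v x $ j) * lap f y) / t ^ (?d + 1))" for i j
      using lborel_pair.integrable_fst[OF F[of i j]] by simp
    show ?thesis
      by (subst Bochner_Integration.integral_sum, intro Bochner_Integration.integrable_sum i,
          intro sum.cong refl, subst Bochner_Integration.integral_sum, rule i) simp
  qed
  also have "\<dots> = (\<Sum>i\<in>UNIV. \<Sum>j\<in>UNIV. LINT x|lborel. v x $ i * v x $ j *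
    ((LINT y|lborel. lap \<sigma> ((1 / t) *\<^sub>R (x - y)) * pd j (pd i f) y) / t ^ (?d + 1)))"
  proof (intro sum.cong refl)
    fix i j
    have "(LINT y|lborel. LINT x|lborel. s i j ((1 / t) *\<^sub>R (x - y)) * (v x $ i * v x $ j) * lap f y) =
        (LINT x|lborel. LINT y|lborel. s i j ((1 / t) *\<^sub>R (x - y)) * (v x $ i * v x $ j) * lap f y)"
      using lborel_pair.Fubini_integral[of "\<lambda>y x. s i j ((1 / t) *\<^sub>R (x - y)) * (v x $ i * v x $ j) * lap f y"] F by simp
    also have "\<dots> = (LINT x|lborel. v x $ i * v x $ j * (LINT y|lborel. s i j ((1 / t) *\<^sub>R (x - y)) * lap f y))"
      by (subst Bochner_Integration.integral_mult_right_zero[symmetric]) (simp add: mult_ac)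
    finally show "(LINT y|lborel. (LINT x|lborel. s i j ((1 / t) *\<^sub>R (x - y)) * (v x $ i * v x $ j) * lap f y)) / t ^ (?d + 1) =
        (LINT x|lborel. v x $ i * v x $ j * ((LINT y|lborel. lap \<sigma> ((1 / t) *\<^sub>R (x - y)) * pd j (pd i f) y) / t ^ (?d + 1)))"
      by (simp add: swap)
  qed
  finally show ?thesis .
qed

text \<open>Interpolates between \<open>mass\<close> times the right-hand side of the tested
  equation, as t tends to 0, and 0, as t tends to infinity; its t-derivative is the pairing of
  \<open>Q t\<close> with \<open>lap f\<close>.\<close>

definition mollified_hess :: "real \<Rightarrow> (real^'n \<Rightarrow> real) \<Rightarrow> real" where
  "mollified_hess t f = (\<Sum>i\<in>UNIV. \<Sum>j\<in>UNIV. LINT x|lborel. v x $ i * v x $ j * mollify t (pd j (pd i f)) x)"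

lemma mollified_hess_increment:
  assumes f: "smooth_W f" and \<epsilon>: "0 < \<epsilon>" "\<epsilon> \<le> T"
  shows "mollified_hess T f - mollified_hess \<epsilon> f =
    (LINT t|lborel. indicator {\<epsilon>..T} t * (LINT y|lborel. Q t y * lap f y))"
proof -
  let ?d = "CARD('n)"
  define h where "h i j = pd j (pd i f)" for i j
  have hW: "smooth_W (h i j)" for i j unfolding h_def by (intro smooth_W_pd f)
  have [measurable]: "h i j \<in> borel_measurable borel" "lap \<sigma> \<in> borel_measurable borel" for i j
    using hW smooth_W_D(4) smooth_W_lap(2)[OF \<sigma>_W] by auto
  define M where "M i j t x = (LINT y|lborel. lap \<sigma> ((1 / t) *\<^sub>R (x - y)) * h i j y)" for i j t x
  have Mm: "(\<lambda>p. M i j (fst p) (snd p)) \<in> borel_measurable (lborel \<Otimes>\<^sub>M lborel)" for i j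
  proof -
    have "(\<lambda>(p, y). lap \<sigma> ((1 / fst p) *\<^sub>R (snd p - y)) * h i j y) \<in>
        borel_measurable (((lborel::real measure) \<Otimes>\<^sub>M lborel) \<Otimes>\<^sub>M lborel)"
      by measurable
    from lborel.borel_measurable_lebesgue_integral[OF this] show ?thesis
      unfolding M_def by simp
  qed
  obtain B where B: "B \<ge> 0" "\<And>z. \<bar>lap \<sigma> z\<bar> \<le> B" using smooth_W_lap(4)[OF \<sigma>_W] by blast
  have Mb: "\<bar>M i j t x\<bar> \<le> B * (LINT y|lborel. \<bar>h i j y\<bar>)" for i j t x
    using abs_integral_mult_le[OF smooth_W_D(2)[OF hW], of "\<lambda>y. lap \<sigma> ((1 / t) *\<^sub>R (x - y))" B i j] B
    unfolding M_def by (simp add: mult.commute)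
  let ?G = "\<lambda>i j t x. indicator {\<epsilon>..T} t * (v x $ i * v x $ j * (M i j t x / t ^ (?d + 1)))"
  have G: "integrable (lborel \<Otimes>\<^sub>M lborel) (\<lambda>(t, x). ?G i j t x)" for i j
  proof (rule integrable_pair_bound)
    let ?b = "B * (LINT y|lborel. \<bar>h i j y\<bar>)"
    have b0: "0 \<le> ?b" using B(1) by simp
    show "integrable lborel (\<lambda>t::real. indicator {\<epsilon>..T} t * (?b / \<epsilon> ^ (?d + 1)))"
      by (intro integrable_mult_left integrable_real_indicator) (auto simp: emeasure_lborel_Icc_eq)
    show "integrable lborel (\<lambda>x. \<bar>v x $ i * v x $ j\<bar>)" using vv_integrable by (rule integrable_abs)
    show "(\<lambda>(t, x). ?G i j t x) \<in> borel_measurable (lborel \<Otimes>\<^sub>M lborel)"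
      unfolding split_beta using Mm[of i j] by measurable
    fix t x
    show "\<bar>case (t, x) of (t, x) \<Rightarrow> ?G i j t x\<bar> \<le> indicator {\<epsilon>..T} t * (?b / \<epsilon> ^ (?d + 1)) * \<bar>v x $ i * v x $ j\<bar>"
    proof (cases "t \<in> {\<epsilon>..T}")
      case True
      then have "\<bar>M i j t x\<bar> / t ^ (?d + 1) \<le> ?b / \<epsilon> ^ (?d + 1)"
        using \<epsilon> Mb[of i j t x] b0 by (intro frac_le power_mono) auto
      from mult_left_mono[OF this, of "\<bar>v x $ i * v x $ j\<bar>"] True \<epsilon> show ?thesis
        by (simp add: abs_mult mult_ac)
    qed simp
  qed
  have mI: "integrable lborel (\<lambda>x. v x $ i * v x $ j * mollify t (h i j) x)" if "0 < t" for t i j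
  proof -
    obtain B where B: "\<And>x. \<bar>h i j x\<bar> \<le> B" using smooth_W_bound[OF hW[of i j]] by blast
    show ?thesis
      using mollify_measurable[of "h i j" t] mollify_bound[OF that smooth_W_D(4)[OF hW] B]
      by (intro integrable_mult_bounded[OF vv_integrable]) auto
  qed
  have loc: "integrable lborel (\<lambda>y. indicator (cball 0 r) y * h i j y)" for i j r
    using integrable_mult_indicator[OF _ smooth_W_D(2)[OF hW], of "cball 0 r"] by simp
  have "mollified_hess T f - mollified_hess \<epsilon> f =
      (\<Sum>i\<in>UNIV. \<Sum>j\<in>UNIV. LINT x|lborel. v x $ i * v x $ j * (mollify T (h i j) x - mollify \<epsilon> (h i j) x))"
    unfolding mollified_hess_def h_def[symmetric] sum_subtractf[symmetric] right_diff_distrib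
    using \<epsilon> by (intro sum.cong refl Bochner_Integration.integral_diff[symmetric] mI) auto
  also have "\<dots> = (\<Sum>i\<in>UNIV. \<Sum>j\<in>UNIV. LINT x|lborel. LINT t|lborel. ?G i j t x)"
  proof (intro sum.cong refl Bochner_Integration.integral_cong)
    fix i j x
    have "mollify T (h i j) x - mollify \<epsilon> (h i j) x =
        (LINT t|lborel. indicator {\<epsilon>..T} t / t ^ (?d + 1) * M i j t x)"
      unfolding M_def using loc by (intro mollify_increment \<epsilon>) auto
    then show "v x $ i * v x $ j * (mollify T (h i j) x - mollify \<epsilon> (h i j) x) = (LINT t|lborel. ?G i j t x)"
      by (simp del: Bochner_Integration.integral_mult_right_zero
          add: Bochner_Integration.integral_mult_right_zero[symmetric] mult_ac)
  qed
  also have "\<dots> = (\<Sum>i\<in>UNIV. \<Sum>j\<in>UNIV. LINT t|lborel. LINT x|lborel. ?G i j t x)"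
    using lborel_pair.Fubini_integral[OF G] by simp
  also have "\<dots> = (LINT t|lborel. (\<Sum>i\<in>UNIV. \<Sum>j\<in>UNIV. LINT x|lborel. ?G i j t x))"
  proof -
    have i: "integrable lborel (\<lambda>t. LINT x|lborel. ?G i j t x)" for i j
      using lborel_pair.integrable_fst[OF G] by simp
    show ?thesis
      by (subst Bochner_Integration.integral_sum, intro Bochner_Integration.integrable_sum i,
          intro sum.cong refl, subst Bochner_Integration.integral_sum, rule i) simp
  qed
  also have "\<dots> = (LINT t|lborel. indicator {\<epsilon>..T} t * (LINT y|lborel. Q t y * lap f y))"
  proof (intro Bochner_Integration.integral_cong refl)
    fix t :: real
    show "(\<Sum>i\<in>UNIV. \<Sum>j\<in>UNIV. LINT x|lborel. ?G i j t x) = indicator {\<epsilon>..T} t * (LINT y|lborel. Q t y * lap f y)"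
    proof (cases "t \<in> {\<epsilon>..T}")
      case True
      then show ?thesis using \<epsilon> integral_Q_lap[OF f, of t] by (simp add: M_def h_def)
    qed simp
  qed
  finally show ?thesis .
qed

text \<open>The L^1 bound on the mollification decays like t^(-d), which at t = n + 1 is at most
  1/t, uniformly in x.\<close>

lemma mollified_hess_large:
  assumes f: "smooth_W f"
  shows "(\<lambda>n. mollified_hess (real (Suc n)) f) \<longlonglongrightarrow> 0"
  unfolding mollified_hess_def
proof (intro tendsto_null_sum)
  fix i j
  define h where "h = pd j (pd i f)"
  have hW: "smooth_W h" unfolding h_def by (intro smooth_W_pd f)
  obtain P where P: "P \<ge> 0" "\<And>z. \<bar>\<phi> z\<bar> \<le> P" using smooth_W_bound[OF \<phi>_W] by metis
  let ?K = "P * (LINT y|lborel. \<bar>h y\<bar>)"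
  let ?V = "LINT x|lborel. \<bar>v x $ i * v x $ j\<bar>"
  have bound: "\<bar>LINT x|lborel. v x $ i * v x $ j * mollify (real (Suc n)) h x\<bar> \<le> (1 / real (Suc n)) * (?K * ?V)" for n
  proof -
    have "\<bar>mollify (real (Suc n)) h x\<bar> \<le> ?K / real (Suc n)" for x
    proof -
      have "real (Suc n) ^ 1 \<le> real (Suc n) ^ CARD('n)" by (intro power_increasing) (auto simp: Suc_leI)
      then have "?K / real (Suc n) ^ CARD('n) \<le> ?K / real (Suc n)"
        using P(1) by (intro divide_left_mono mult_nonneg_nonneg) auto
      then show ?thesis
        using mollify_bound_large[OF _ smooth_W_D(2)[OF hW] P(2), of "real (Suc n)" x] by simp
    qed
    then have "\<bar>LINT x|lborel. v x $ i * v x $ j * mollify (real (Suc n)) h x\<bar> \<le> ?K / real (Suc n) * ?V"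
      using mollify_measurable[OF smooth_W_D(4)[OF hW]] by (intro abs_integral_mult_le vv_integrable) auto
    then show ?thesis by simp
  qed
  have "(\<lambda>n. (1 / real (Suc n)) * (?K * ?V)) \<longlonglongrightarrow> 0"
    using tendsto_mult_left_zero[OF LIMSEQ_Suc[OF lim_1_over_n]] by simp
  then show "(\<lambda>n. LINT x|lborel. v x $ i * v x $ j * mollify (real (Suc n)) (pd j (pd i f)) x) \<longlonglongrightarrow> 0"
    unfolding h_def[symmetric]
    by (rule Lim_null_comparison[rotated]) (use bound in \<open>auto intro!: always_eventually\<close>)
qed

lemma mollified_hess_small:
  assumes f: "smooth_W f"
  shows "(\<lambda>n. mollified_hess (1 / real (Suc n)) f) \<longlonglongrightarrow> mass * (LINT x|lborel. hess f x (v x))"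
proof -
  define h where "h i j = pd j (pd i f)" for i j
  have hW: "smooth_W (h i j)" for i j unfolding h_def by (intro smooth_W_pd f)
  have lim: "(\<lambda>n. LINT x|lborel. v x $ i * v x $ j * mollify (1 / real (Suc n)) (h i j) x) \<longlonglongrightarrow>
      (LINT x|lborel. v x $ i * v x $ j * (mass * h i j x))" for i j
  proof -
    obtain B where B: "\<And>z. \<bar>h i j z\<bar> \<le> B" using smooth_W_bound[OF hW] by metis
    have [measurable]: "h i j \<in> borel_measurable borel" "mollify t (h i j) \<in> borel_measurable borel" for t
      by (intro smooth_W_D(4) hW mollify_measurable)+
    show ?thesis
    proof (rule integral_dominated_convergence[where w = "\<lambda>x. \<bar>v x $ i * v x $ j\<bar> * (B * mass)"])
      show "integrable lborel (\<lambda>x. \<bar>v x $ i * v x $ j\<bar> * (B * mass))"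
        using vv_integrable by (intro integrable_mult_left integrable_abs)
      show "AE x in lborel. (\<lambda>n. v x $ i * v x $ j * mollify (1 / real (Suc n)) (h i j) x) \<longlonglongrightarrow>
          v x $ i * v x $ j * (mass * h i j x)"
        using smooth_fun_continuous[OF smooth_W_D(1)[OF hW]] B
        by (intro AE_I2 tendsto_mult tendsto_const mollify_tendsto) auto
      show "AE x in lborel. norm (v x $ i * v x $ j * mollify (1 / real (Suc n)) (h i j) x) \<le>
          \<bar>v x $ i * v x $ j\<bar> * (B * mass)" for n
        using mollify_bound[of "1 / real (Suc n)" "h i j" B] B
        by (intro AE_I2) (auto simp: abs_mult intro!: mult_left_mono)
    qed measurable
  qed
  have int: "integrable lborel (\<lambda>x. h i j x * (v x $ i * v x $ j))" for i j
    by (rule smooth_W_v_integrable(2)[OF hW])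
  have "mass * (LINT x|lborel. hess f x (v x)) =
      (\<Sum>i\<in>UNIV. \<Sum>j\<in>UNIV. LINT x|lborel. v x $ i * v x $ j * (mass * h i j x))"
  proof -
    have "(LINT x|lborel. hess f x (v x)) = (\<Sum>i\<in>UNIV. \<Sum>j\<in>UNIV. LINT x|lborel. h i j x * (v x $ i * v x $ j))"
      unfolding hess_def h_def[symmetric]
      by (subst Bochner_Integration.integral_sum, intro Bochner_Integration.integrable_sum int)
         (intro sum.cong refl Bochner_Integration.integral_sum int)
    then show ?thesis
      by (simp add: sum_distrib_left mult_ac del: Bochner_Integration.integral_mult_right_zero
          flip: Bochner_Integration.integral_mult_right_zero)
  qed
  moreover have "(\<lambda>n. mollified_hess (1 / real (Suc n)) f) \<longlonglongrightarrow>
      (\<Sum>i\<in>UNIV. \<Sum>j\<in>UNIV. LINT x|lborel. v x $ i * v x $ j * (mass * h i j x))"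
    unfolding mollified_hess_def h_def[symmetric] by (intro tendsto_sum lim)
  ultimately show ?thesis by simp
qed

lemma pressure_equation:
  assumes f: "smooth_W f"
  shows "(LINT y|lborel. pressure y * lap f y) = - (LINT x|lborel. hess f x (v x))"
proof -
  let ?I = "\<lambda>t. LINT y|lborel. Q t y * lap f y"
  have [measurable]: "lap f \<in> borel_measurable borel" by (rule smooth_W_lap(2)[OF f])
  have dom: "integrable lborel (\<lambda>t. H\<^sup>2 * Q_const * dominator (2 * \<gamma>) t)"
    using integrable_dominator[of "2 * \<gamma>"] \<gamma> by simp
  have F: "integrable (lborel \<Otimes>\<^sub>M lborel) (\<lambda>(t, y). Q t y * lap f y)"
  proof (rule integrable_pair_bound[OF _ dom integrable_abs[OF smooth_W_lap(1)[OF f]]])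
    show "(\<lambda>(t, y). Q t y * lap f y) \<in> borel_measurable (lborel \<Otimes>\<^sub>M lborel)"
      using Q_measurable unfolding split_beta by measurable
    show "\<bar>case (t, y) of (t, y) \<Rightarrow> Q t y * lap f y\<bar> \<le> H\<^sup>2 * Q_const * dominator (2 * \<gamma>) t * \<bar>lap f y\<bar>" for t y
      using Q_bound[of t y] by (simp add: abs_mult mult_right_mono)
  qed
  have I: "integrable lborel ?I" using lborel_pair.integrable_fst[OF F] by simp
  \<comment> \<open>These intervals exhaust the positive scales; nonpositive t contribute nothing
    because \<open>Q\<close> is 0 there.\<close>
  let ?S = "\<lambda>n. {1 / real (Suc n)..real (Suc n)}"
  have "(\<lambda>n. LINT t|lborel. indicator (?S n) t * ?I t) \<longlonglongrightarrow> (LINT t|lborel. ?I t)"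
  proof (rule integral_dominated_convergence[where w = "\<lambda>t. \<bar>?I t\<bar>"])
    show "integrable lborel (\<lambda>t. \<bar>?I t\<bar>)" using I by (rule integrable_abs)
    show "AE t in lborel. (\<lambda>n. indicator (?S n) t * ?I t) \<longlonglongrightarrow> ?I t"
    proof (rule AE_I2)
      fix t :: real
      show "(\<lambda>n. indicator (?S n) t * ?I t) \<longlonglongrightarrow> ?I t"
      proof (cases "0 < t")
        case False
        then show ?thesis by (simp add: Q_def)
      next
        case True
        have "\<forall>\<^sub>F n in sequentially. 1 / real (Suc n) < t"
          using LIMSEQ_Suc[OF lim_1_over_n] True by (rule order_tendstoD)
        moreover have "\<forall>\<^sub>F n in sequentially. t < real (Suc n)"
          using eventually_gt_at_top[of "nat \<lceil>t\<rceil>"] by eventually_elim linarith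
        ultimately have "\<forall>\<^sub>F n in sequentially. indicator (?S n) t * ?I t = ?I t"
          by eventually_elim simp
        then show ?thesis by (rule tendsto_eventually)
      qed
    qed
    show "AE t in lborel. norm (indicator (?S n) t * ?I t) \<le> \<bar>?I t\<bar>" for n
      by (intro AE_I2) (simp add: indicator_def abs_mult)
  qed (use I in measurable)
  moreover have "(LINT t|lborel. indicator (?S n) t * ?I t) =
      mollified_hess (real (Suc n)) f - mollified_hess (1 / real (Suc n)) f" for n
    by (rule mollified_hess_increment[OF f, symmetric]) (auto simp: field_simps)
  ultimately have "(\<lambda>n. mollified_hess (real (Suc n)) f - mollified_hess (1 / real (Suc n)) f)
      \<longlonglongrightarrow> (LINT t|lborel. ?I t)" by simp
  moreover have "(\<lambda>n. mollified_hess (real (Suc n)) f - mollified_hess (1 / real (Suc n)) f)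
      \<longlonglongrightarrow> 0 - mass * (LINT x|lborel. hess f x (v x))"
    by (intro tendsto_diff mollified_hess_large mollified_hess_small f)
  ultimately have "(LINT t|lborel. ?I t) = 0 - mass * (LINT x|lborel. hess f x (v x))"
    by (rule LIMSEQ_unique)
  moreover have "(LINT t|lborel. ?I t) = (LINT y|lborel. LINT t|lborel. Q t y * lap f y)"
    using lborel_pair.Fubini_integral[of "\<lambda>t y. Q t y * lap f y"] F by simp
  moreover have "\<dots> = mass * (LINT y|lborel. pressure y * lap f y)"
  proof -
    have "pressure y * lap f y = (1 / mass) * (LINT t|lborel. Q t y * lap f y)" for y
      by (simp add: pressure_def)
    then show ?thesis using mass_pos by simp
  qed
  ultimately have "mass * (LINT y|lborel. pressure y * lap f y) = mass * (- (LINT x|lborel. hess f x (v x)))"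
    by simp
  then show ?thesis using mass_pos by (simp only: mult_cancel_left) auto
qed

end

section \<open>Uniqueness\<close>

text \<open>Tent functions of the distance to T decrease to its indicator, and all of them live in
  the 1-neighbourhood of T, where w is integrable.\<close>

lemma integral_compact_eq_0:
  fixes w :: "real^'n \<Rightarrow> real"
  assumes loc: "\<And>S. compact S \<Longrightarrow> integrable lborel (\<lambda>x. indicator S x * w x)"
    and [measurable]: "w \<in> borel_measurable borel"
    and zero: "\<And>g S. continuous_on UNIV g \<Longrightarrow> compact S \<Longrightarrow> (\<And>x. x \<notin> S \<Longrightarrow> g x = 0) \<Longrightarrow>
      (LINT x|lborel. w x * g x) = 0"
    and T: "compact T"
  shows "(LINT x|lborel. indicator T x * w x) = 0"
\<comment> \<open>\<open>infdist\<close> to the empty set is 0, which would make the tents equal to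
  1 everywhere; hence the separate case.\<close>
proof (cases "T = {}")
  case False
  define g where "g n x = max 0 (1 - real (Suc n) * infdist x T)" for n x
  let ?S = "{x. infdist x T \<le> 1}"
  have S: "compact ?S" using False T by (intro compact_infdist_le) auto
  have cont: "continuous_on UNIV (g n)" for n
    unfolding g_def[abs_def] by (intro continuous_intros)
  then have [measurable]: "g n \<in> borel_measurable borel" for n
    by (rule borel_measurable_continuous_onI)
  have out: "g n x = 0" if "x \<notin> ?S" for n x
  proof -
    have "1 * 1 \<le> real (Suc n) * infdist x T" using that by (intro mult_mono) auto
    then show ?thesis by (simp add: g_def)
  qed
  have "(\<lambda>n. LINT x|lborel. w x * g n x) \<longlonglongrightarrow> (LINT x|lborel. indicator T x * w x)"
  proof (rule integral_dominated_convergence[where w = "\<lambda>x. \<bar>indicator ?S x * w x\<bar>"])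
    have [measurable]: "T \<in> sets borel" using T by (simp add: borel_compact)
    show "(\<lambda>x. indicator T x * w x) \<in> borel_measurable lborel" by measurable
    show "integrable lborel (\<lambda>x. \<bar>indicator ?S x * w x\<bar>)" using loc[OF S] by (rule integrable_abs)
    show "AE x in lborel. (\<lambda>n. w x * g n x) \<longlonglongrightarrow> indicator T x * w x"
    proof (rule AE_I2)
      fix x
      show "(\<lambda>n. w x * g n x) \<longlonglongrightarrow> indicator T x * w x"
      proof (cases "x \<in> T")
        case True
        then show ?thesis by (simp add: g_def)
      next
        case False
        then have d: "infdist x T > 0"
          using \<open>T \<noteq> {}\<close> compact_imp_closed[OF T] by (intro infdist_pos_not_in_closed)
        have "\<forall>\<^sub>F n in sequentially. 1 / infdist x T < real n"
          using filterlim_real_sequentially by (simp add: filterlim_at_top_dense)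
        then have "\<forall>\<^sub>F n in sequentially. w x * g n x = 0"
        proof eventually_elim
          case (elim n)
          then have "1 < real (Suc n) * infdist x T" using d by (simp add: field_simps)
          then show ?case by (simp add: g_def)
        qed
        with False show ?thesis by (simp add: tendsto_eventually)
      qed
    qed
    show "AE x in lborel. norm (w x * g n x) \<le> \<bar>indicator ?S x * w x\<bar>" for n
    proof (rule AE_I2)
      fix x
      have "\<bar>g n x\<bar> \<le> 1" by (auto simp: g_def infdist_nonneg)
      from mult_left_mono[OF this, of "\<bar>w x\<bar>"] show "norm (w x * g n x) \<le> \<bar>indicator ?S x * w x\<bar>"
        using out[of x n] by (cases "x \<in> ?S") (auto simp: abs_mult)
    qed
  qed measurable
  moreover have "(LINT x|lborel. w x * g n x) = 0" for n
    using cont S out by (rule zero)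
  ultimately show ?thesis by (simp add: LIMSEQ_const_iff)
qed simp

text \<open>Inner regularity: a set of positive measure on which w is positive would contain a
  compact set of positive measure, over which the integral of w could not vanish. Intersecting with
  balls keeps the measures finite.\<close>

lemma AE_not_pos:
  fixes w :: "real^'n \<Rightarrow> real"
  assumes loc: "\<And>S. compact S \<Longrightarrow> integrable lborel (\<lambda>x. indicator S x * w x)"
    and [measurable]: "w \<in> borel_measurable borel"
    and zero: "\<And>T. compact T \<Longrightarrow> (LINT x|lborel. indicator T x * w x) = 0"
  shows "AE x in lborel. \<not> 0 < w x"
proof -
  have "AE x in lborel. \<not> (x \<in> cball 0 (real n) \<and> 0 < w x)" for n
  proof -
    let ?S = "{x \<in> cball 0 (real n). 0 < w x}"
    have S[measurable]: "?S \<in> sets borel" by measurable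
    have "?S \<in> lmeasurable"
    proof (rule bounded_set_imp_lmeasurable)
      show "bounded ?S" by (rule bounded_subset[OF bounded_cball[of 0 "real n"]]) auto
      show "?S \<in> sets lebesgue" by (rule sets_completionI_sets) (use S in simp)
    qed
    have "measure lebesgue ?S = 0"
    proof (rule ccontr)
      assume "measure lebesgue ?S \<noteq> 0"
      then have "measure lebesgue ?S > 0" by (simp add: zero_less_measure_iff)
      \<comment> \<open>The whole measure of the set, taken as tolerance, is just enough to keep T
        from being a null set.\<close>
      then obtain T where T0: "closed T" "T \<subseteq> ?S" "?S - T \<in> lmeasurable"
          "emeasure lebesgue (?S - T) < ennreal (measure lebesgue ?S)"
        using sets_lebesgue_inner_closed[of ?S "measure lebesgue ?S"] fmeasurableD[OF \<open>?S \<in> lmeasurable\<close>]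
        by blast
      have "bounded T" by (rule bounded_subset[OF bounded_cball[of 0 "real n"]]) (use T0(2) in auto)
      then have T: "compact T" "T \<subseteq> ?S" "measure lebesgue (?S - T) < measure lebesgue ?S"
        using T0 by (simp_all add: compact_eq_bounded_closed emeasure_eq_measure2 ennreal_less_iff)
      have [measurable]: "T \<in> sets borel" using T(1) by (simp add: borel_compact)
      have "AE x in lborel. indicator T x * w x = 0"
      proof (subst integral_nonneg_eq_0_iff_AE[symmetric])
        show "AE x in lborel. 0 \<le> indicator T x * w x"
          using T(2) by (intro AE_I2) (auto simp: indicator_def)
      qed (use loc zero T(1) in auto)
      then have "AE x in lborel. x \<notin> T"
        by eventually_elim (use T(2) in \<open>auto simp: indicator_def split: if_splits\<close>)
      then have "emeasure lborel T = 0"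
        using AE_iff_measurable[of T lborel "\<lambda>x. x \<notin> T"] by simp
      then have "measure lebesgue T = 0" by (simp add: measure_def)
      moreover have "T \<in> lmeasurable" using T(1) by (rule lmeasurable_compact)
      ultimately have "measure lebesgue (?S - T) = measure lebesgue ?S"
        using \<open>?S \<in> lmeasurable\<close> T(2) by (simp add: measurable_measure_Diff)
      then show False using T(3) by simp
    qed
    then have "emeasure lebesgue ?S = 0"
      unfolding emeasure_eq_measure2[OF \<open>?S \<in> lmeasurable\<close>] by simp
    then have "emeasure lborel ?S = 0" using S by simp
    then show ?thesis
      using AE_iff_measurable[of ?S lborel "\<lambda>x. \<not> (x \<in> cball 0 (real n) \<and> 0 < w x)"] by simp
  qed
  then have "AE x in lborel. \<forall>n. \<not> (x \<in> cball 0 (real n) \<and> 0 < w x)"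
    unfolding AE_all_countable by blast
  then show ?thesis
  proof eventually_elim
    case (elim x)
    obtain n where "norm x \<le> real n" using real_arch_simple by blast
    then show ?case using elim by auto
  qed
qed

text \<open>The du Bois-Reymond lemma: both w and - w are nowhere positive, up to a null
  set.\<close>

lemma AE_eq_0_if_integral_continuous_eq_0:
  fixes w :: "real^'n \<Rightarrow> real"
  assumes loc: "\<And>S. compact S \<Longrightarrow> integrable lborel (\<lambda>x. indicator S x * w x)"
    and m: "w \<in> borel_measurable borel"
    and zero: "\<And>g S. continuous_on UNIV g \<Longrightarrow> compact S \<Longrightarrow> (\<And>x. x \<notin> S \<Longrightarrow> g x = 0) \<Longrightarrow>
      (LINT x|lborel. w x * g x) = 0"
  shows "AE x in lborel. w x = 0"
proof -
  have z: "(LINT x|lborel. indicator T x * w x) = 0" if "compact T" for T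
    using loc m zero that by (rule integral_compact_eq_0)
  have "AE x in lborel. \<not> 0 < w x" using loc m z by (rule AE_not_pos)
  moreover have "AE x in lborel. \<not> 0 < - w x" using loc m z by (intro AE_not_pos) auto
  ultimately show ?thesis by eventually_elim simp
qed

lemma locally_integrable_measurable:
  assumes "locally_integrable w"
  shows "w \<in> borel_measurable borel"
proof (rule borel_measurable_LIMSEQ_real)
  show "(\<lambda>x. indicator (cball 0 (real n)) x * w x) \<in> borel_measurable borel" for n
  proof -
    have "set_integrable lborel (cball 0 (real n)) w"
      using assms compact_cball unfolding locally_integrable_def by blast
    then show ?thesis
      unfolding set_integrable_def using borel_measurable_integrable by fastforce
  qed
  fix x :: "real^'a"
  have "\<forall>\<^sub>F n in sequentially. indicator (cball 0 (real n)) x * w x = w x"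
    using eventually_ge_at_top[of "nat \<lceil>norm x\<rceil>"]
  proof eventually_elim
    case (elim n)
    then have "norm x \<le> real n" by linarith
    then show ?case by simp
  qed
  then show "(\<lambda>n. indicator (cball 0 (real n)) x * w x) \<longlonglongrightarrow> w x" by (rule tendsto_eventually)
qed

section \<open>Mollified harmonic distributions\<close>

context lp_cutoff_function
begin

lemma \<phi>_swap: "\<phi> (c *\<^sub>R (x - y)) = \<phi> (c *\<^sub>R (y - x))"
  by (rule \<phi>_radial) (simp add: norm_minus_commute)

text \<open>Fubini and the evenness of \<open>\<phi>\<close>. As g vanishes outside radius r and the
  kernel outside radius 2 t, only the values of w in the ball of radius r + 2 t matter.\<close>

lemma integral_mollify_commute:
  assumes w: "\<And>S. compact S \<Longrightarrow> integrable lborel (\<lambda>x. indicator S x * w x)"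
    and [measurable]: "w \<in> borel_measurable borel"
    and g: "continuous_on UNIV g" "\<And>x. r < norm x \<Longrightarrow> g x = 0" "\<And>x. \<bar>g x\<bar> \<le> B" and t: "0 < t"
  shows "(LINT x|lborel. g x * mollify t w x) = (LINT y|lborel. w y * mollify t g y)"
proof -
  let ?d = "CARD('n)"
  have [measurable]: "g \<in> borel_measurable borel" by (rule borel_measurable_continuous_onI[OF g(1)])
  obtain P where P: "P \<ge> 0" "\<And>z. \<bar>\<phi> z\<bar> \<le> P" using smooth_W_bound[OF \<phi>_W] by metis
  let ?F = "\<lambda>x y. g x * (w y * (\<phi> ((1 / t) *\<^sub>R (x - y)) / t ^ ?d))"
  have "integrable (lborel \<Otimes>\<^sub>M lborel) (\<lambda>(x, y). ?F x y)"
  proof (rule integrable_pair_bound)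
    show "integrable lborel (\<lambda>x::real^'n. B * (P / t ^ ?d) * indicator (cball 0 r) x)"
      by (intro integrable_mult_right integrable_real_indicator)
         (simp_all add: emeasure_compact_finite[OF compact_cball, simplified])
    show "integrable lborel (\<lambda>y. \<bar>indicator (cball 0 (r + 2 * t)) y * w y\<bar>)"
      by (intro integrable_abs w) simp
    fix x y
    show "\<bar>case (x, y) of (x, y) \<Rightarrow> ?F x y\<bar> \<le>
        B * (P / t ^ ?d) * indicator (cball 0 r) x * \<bar>indicator (cball 0 (r + 2 * t)) y * w y\<bar>"
    proof (cases "norm x \<le> r \<and> norm y \<le> r + 2 * t")
      case True
      have "\<bar>g x\<bar> * (\<bar>w y\<bar> * (\<bar>\<phi> ((1 / t) *\<^sub>R (x - y))\<bar> / t ^ ?d)) \<le> B * (\<bar>w y\<bar> * (P / t ^ ?d))"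
        using t P g(3) order_trans[OF abs_ge_zero g(3)] by (intro mult_mono mult_left_mono divide_right_mono) auto
      then show ?thesis using True t by (simp add: abs_mult mult_ac)
    next
      case False
      have "?F x y = 0"
      proof (cases "norm x \<le> r")
        case True
        then have "2 * t < norm (x - y)" using False norm_triangle_ineq2[of y x] by (simp add: norm_minus_commute)
        then have "2 < norm (x - y) / t" using t by (simp add: pos_less_divide_eq)
        also have "norm (x - y) / t = norm ((1 / t) *\<^sub>R (x - y))" using t by (simp only: norm_scaleR) simp
        finally show ?thesis by (simp add: \<phi>_eq_0)
      qed (simp add: g(2))
      moreover have "0 \<le> B * (P / t ^ ?d) * indicator (cball 0 r) x * \<bar>indicator (cball 0 (r + 2 * t)) y * w y\<bar>"
        using P(1) t order_trans[OF abs_ge_zero g(3)] by (intro mult_nonneg_nonneg) auto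
      ultimately show ?thesis by (simp only: prod.case abs_zero)
    qed
  qed measurable
  from lborel_pair.Fubini_integral[OF this]
  have "(LINT y|lborel. LINT x|lborel. ?F x y) = (LINT x|lborel. LINT y|lborel. ?F x y)" .
  moreover have "(LINT y|lborel. ?F x y) = g x * mollify t w x" for x
    by (simp add: mollify_def)
  moreover have "(LINT x|lborel. ?F x y) = w y * mollify t g y" for y
  proof -
    have "(LINT x|lborel. ?F x y) = (LINT x|lborel. w y * (g x * (\<phi> ((1 / t) *\<^sub>R (y - x)) / t ^ ?d)))"
      unfolding \<phi>_swap[of "1 / t" _ y] by (intro Bochner_Integration.integral_cong refl) (simp only: mult.left_commute)
    then show ?thesis by (simp add: mollify_def)
  qed
  ultimately show ?thesis by (simp only:)
qed

text \<open>Weyl's lemma and Liouville's theorem in one step: the mollifications of \<open>w\<close> do not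
  depend on the scale, tend to \<open>0\<close> at large scales, and to a multiple of \<open>w\<close> at small ones.\<close>

lemma harmonic_decaying_eq_0:
  fixes w :: "real^'n \<Rightarrow> real"
  assumes w: "locally_integrable w" and decay: "(w \<longlongrightarrow> 0) at_infinity"
    and harm: "\<And>f. f \<in> test_functions \<Longrightarrow> (LINT x|lborel. w x * lap f x) = 0"
  shows "AE x in lborel. w x = 0"
proof -
  have m[measurable]: "w \<in> borel_measurable borel" using w by (rule locally_integrable_measurable)
  have loc: "integrable lborel (\<lambda>x. indicator S x * w x)" if "compact S" for S
    using w that unfolding locally_integrable_def set_integrable_def by simp
  have inc: "mollify T w x = mollify \<epsilon> w x" if "0 < \<epsilon>" "\<epsilon> \<le> T" for T \<epsilon> x
  proof -
    \<comment> \<open>The reflected and rescaled \<sigma> is itself a test function, so harmonicity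
      applies to it directly.\<close>
    have "(LINT y|lborel. lap \<sigma> ((1 / t) *\<^sub>R (x - y)) * w y) = 0" if "0 < t" for t
    proof -
      let ?c = "- (1 / t)" and ?b = "(1 / t) *\<^sub>R x"
      have a: "(1 / t) *\<^sub>R (x - y) = ?c *\<^sub>R y + ?b" for y by (simp add: algebra_simps)
      have "(LINT y|lborel. w y * lap (\<lambda>y. \<sigma> (?c *\<^sub>R y + ?b)) y) = 0"
        using that by (intro harm test_functions_affine \<sigma>_test) auto
      also have "(\<lambda>y. w y * lap (\<lambda>y. \<sigma> (?c *\<^sub>R y + ?b)) y) = (\<lambda>y. (1 / t)\<^sup>2 * (lap \<sigma> ((1 / t) *\<^sub>R (x - y)) * w y))"
        unfolding a lap_affine[OF smooth_\<sigma>] by (simp add: mult_ac)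
      finally show ?thesis using that by simp
    qed
    then have "indicator {\<epsilon>..T} t / t ^ (CARD('n) + 1) * (LINT y|lborel. lap \<sigma> ((1 / t) *\<^sub>R (x - y)) * w y) = 0" for t
      using that by (cases "t \<in> {\<epsilon>..T}") auto
    then have 0: "(\<lambda>t. indicator {\<epsilon>..T} t / t ^ (CARD('n) + 1) * (LINT y|lborel. lap \<sigma> ((1 / t) *\<^sub>R (x - y)) * w y)) = (\<lambda>t. 0)"
      by (rule ext)
    have "mollify T w x - mollify \<epsilon> w x = (LINT t|(lborel::real measure). 0)"
      unfolding 0[symmetric] using loc that by (intro mollify_increment m) auto
    then show ?thesis by simp
  qed
  have zero: "mollify \<epsilon> w x = 0" if \<epsilon>: "0 < \<epsilon>" for \<epsilon> x
  proof -
    have le: "\<bar>mollify \<epsilon> w x\<bar> \<le> e * mass" if e: "0 < e" for e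
    proof -
      obtain r where r: "\<And>y. r \<le> norm y \<Longrightarrow> \<bar>w y\<bar> \<le> e"
      proof -
        have "\<forall>\<^sub>F y in at_infinity. dist (w y) 0 < e" using decay e by (rule tendstoD)
        then obtain b where "\<And>x. b \<le> norm x \<Longrightarrow> \<bar>w x\<bar> < e"
          unfolding eventually_at_infinity by auto
        then show ?thesis using that[of b] by (auto intro: less_imp_le)
      qed
      \<comment> \<open>The near part is integrable, so its mollification at scale T is at most a
        constant over T; the far part is at most e in size, so its mollification is at most e times
        \<open>mass\<close> at every scale. T may be sent to infinity since the mollification of w
        does not depend on it.\<close>
      define w1 where "w1 y = indicator (cball 0 r) y * w y" for y
      define w2 where "w2 y = w y - w1 y" for y
      have [measurable]: "w1 \<in> borel_measurable borel"
        unfolding w1_def[abs_def] by (intro borel_measurable_times borel_measurable_indicator m) simp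
      have [measurable]: "w2 \<in> borel_measurable borel" unfolding w2_def[abs_def] by measurable
      have w1: "integrable lborel w1" unfolding w1_def[abs_def] by (rule loc) simp
      have w2: "\<bar>w2 y\<bar> \<le> e" for y using r[of y] e by (auto simp: w2_def w1_def indicator_def)
      obtain P where P: "P \<ge> 0" "\<And>z. \<bar>\<phi> z\<bar> \<le> P" using smooth_W_bound[OF \<phi>_W] by metis
      let ?N = "LINT y|lborel. \<bar>w1 y\<bar>"
      have bound: "\<bar>mollify \<epsilon> w x\<bar> \<le> P * ?N / T + e * mass" if T: "\<epsilon> \<le> T" "1 \<le> T" for T
      proof -
        let ?k = "\<lambda>y. \<phi> ((1 / T) *\<^sub>R (x - y)) / T ^ CARD('n)"
        have k: "integrable lborel ?k"
        proof -
          have "integrable lborel (\<lambda>y. \<phi> ((- (1 / T)) *\<^sub>R y + (1 / T) *\<^sub>R x))"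
            using T smooth_W_D(2)[OF \<phi>_W] by (subst lborel_integrable_affine) auto
          then show ?thesis by (simp add: algebra_simps)
        qed
        have kb: "\<bar>?k y\<bar> \<le> P / T ^ CARD('n)" for y using P T by (auto intro!: divide_right_mono)
        have "mollify \<epsilon> w x = mollify T w x" using inc[OF \<epsilon> T(1)] by simp
        also have "\<dots> = (LINT y|lborel. w1 y * ?k y + ?k y * w2 y)"
        proof -
          have "w y * k = w1 y * k + k * w2 y" for k y by (simp add: w2_def algebra_simps)
          then show ?thesis unfolding mollify_def by (intro Bochner_Integration.integral_cong refl)
        qed
        also have "\<dots> = (LINT y|lborel. w1 y * ?k y) + (LINT y|lborel. ?k y * w2 y)"
          using integrable_mult_bounded[OF w1 _ kb] integrable_mult_bounded[OF k _ w2]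
          by (intro Bochner_Integration.integral_add) auto
        also have "\<dots> = mollify T w1 x + mollify T w2 x"
          by (simp add: mollify_def mult.commute)
        also have "\<bar>\<dots>\<bar> \<le> P / T ^ CARD('n) * ?N + e * mass"
          using mollify_bound_large[OF _ w1 P(2), of T x] mollify_bound[of T w2 e x] w2 T
          by (intro order_trans[OF abs_triangle_ineq] add_mono) auto
        also have "P / T ^ CARD('n) * ?N \<le> P * ?N / T"
        proof -
          have "T ^ 1 \<le> T ^ CARD('n)" using T by (intro power_increasing) (auto simp: Suc_leI)
          then have "P * ?N / T ^ CARD('n) \<le> P * ?N / T"
            using P(1) T by (intro divide_left_mono mult_nonneg_nonneg) auto
          then show ?thesis by simp
        qed
        finally show ?thesis by simp
      qed
      have "((\<lambda>T. P * ?N / T + e * mass) \<longlongrightarrow> 0 + e * mass) at_top"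
        by (intro tendsto_intros tendsto_divide_0[OF tendsto_const] filterlim_at_top_imp_at_infinity filterlim_ident)
      moreover have "\<forall>\<^sub>F T in at_top. \<bar>mollify \<epsilon> w x\<bar> \<le> P * ?N / T + e * mass"
        using eventually_ge_at_top[of "max \<epsilon> 1"] by eventually_elim (rule bound, auto)
      ultimately show ?thesis by (intro tendsto_lowerbound[where F = at_top]) auto
    qed
    have "\<bar>mollify \<epsilon> w x\<bar> \<le> 0 + e" if "0 < e" for e
      using le[of "e / mass"] that mass_pos by simp
    then have "\<bar>mollify \<epsilon> w x\<bar> \<le> 0" by (rule field_le_epsilon)
    then show ?thesis by simp
  qed
  show ?thesis
  \<comment> \<open>w need not be continuous, so its mollifications are not compared with w
    pointwise: the mollifier is moved onto a continuous g, where it converges.\<close>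
  proof (rule AE_eq_0_if_integral_continuous_eq_0[OF loc m])
    fix g :: "real^'n \<Rightarrow> real" and S
    assume g: "continuous_on UNIV g" and S: "compact S" and gS: "\<And>x. x \<notin> S \<Longrightarrow> g x = 0"
    obtain r where r: "\<And>x. x \<in> S \<Longrightarrow> norm x \<le> r" using compact_imp_bounded[OF S] by (auto simp: bounded_iff)
    have gr: "g x = 0" if "r < norm x" for x using r[of x] gS[of x] that by auto
    obtain B where B: "\<And>x. \<bar>g x\<bar> \<le> B"
    proof -
      have "bounded (insert 0 (g ` S))"
        using compact_imp_bounded[OF compact_continuous_image[OF continuous_on_subset[OF g] S]] by simp
      then obtain B where "\<And>y. y \<in> insert 0 (g ` S) \<Longrightarrow> norm y \<le> B" unfolding bounded_iff by blast
      then have "\<bar>g x\<bar> \<le> B" for x by (cases "x \<in> S") (force simp: gS)+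
      then show ?thesis by (rule that)
    qed
    have [measurable]: "g \<in> borel_measurable borel" by (rule borel_measurable_continuous_onI[OF g])
    have [measurable]: "mollify t g \<in> borel_measurable borel" for t by (rule mollify_measurable) measurable
    have far: "mollify t g y = 0" if "r + 2 < norm y" "0 < t" "t \<le> 1" for t y
    proof -
      have "\<phi> z * g (y - t *\<^sub>R z) = 0" for z
      proof (cases "norm z \<le> 2")
        case True
        have "norm (t *\<^sub>R z) \<le> 1 * 2" unfolding norm_scaleR using that True by (intro mult_mono) auto
        then have "r < norm (y - t *\<^sub>R z)" using that norm_triangle_ineq2[of y "t *\<^sub>R z"] by linarith
        then show ?thesis by (simp add: gr)
      qed (simp add: \<phi>_eq_0)
      then have "(\<lambda>z. \<phi> z * g (y - t *\<^sub>R z)) = (\<lambda>z. 0)" by (rule ext)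
      then show ?thesis by (subst mollify_subst) (use that in simp_all)
    qed
    have "(\<lambda>n. LINT y|lborel. w y * mollify (1 / real (Suc n)) g y) \<longlonglongrightarrow> (LINT y|lborel. w y * (mass * g y))"
    proof (rule integral_dominated_convergence[where w = "\<lambda>y. \<bar>indicator (cball 0 (r + 2)) y * w y\<bar> * (B * mass)"])
      show "integrable lborel (\<lambda>y. \<bar>indicator (cball 0 (r + 2)) y * w y\<bar> * (B * mass))"
        by (intro integrable_mult_left integrable_abs loc) simp
      show "AE y in lborel. (\<lambda>n. w y * mollify (1 / real (Suc n)) g y) \<longlonglongrightarrow> w y * (mass * g y)"
        using g B by (intro AE_I2 tendsto_mult tendsto_const mollify_tendsto)
      show "AE y in lborel. norm (w y * mollify (1 / real (Suc n)) g y) \<le>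
          \<bar>indicator (cball 0 (r + 2)) y * w y\<bar> * (B * mass)" for n
      proof (rule AE_I2)
        fix y
        show "norm (w y * mollify (1 / real (Suc n)) g y) \<le> \<bar>indicator (cball 0 (r + 2)) y * w y\<bar> * (B * mass)"
        proof (cases "r + 2 < norm y")
          case True
          then show ?thesis using far[of y "1 / real (Suc n)"] by simp
        next
          case False
          then show ?thesis
            using mollify_bound[of "1 / real (Suc n)" g B y] B by (auto simp: abs_mult intro!: mult_left_mono)
        qed
      qed
    qed measurable
    moreover have "(LINT y|lborel. w y * mollify (1 / real (Suc n)) g y) = 0" for n
    proof -
      have "(LINT x|lborel. g x * mollify (1 / real (Suc n)) w x) =
          (LINT y|lborel. w y * mollify (1 / real (Suc n)) g y)"
        by (rule integral_mollify_commute[OF loc m g gr B]) auto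
      then show ?thesis by (simp add: zero)
    qed
    ultimately have "(LINT y|lborel. w y * (mass * g y)) = 0" by (simp add: LIMSEQ_const_iff)
    also have "(LINT y|lborel. w y * (mass * g y)) = mass * (LINT y|lborel. w y * g y)"
      by (simp add: mult.left_commute)
    finally show "(LINT y|lborel. w y * g y) = 0" using mass_pos by simp
  qed
qed

end

section \<open>Cosine transforms of test functions\<close>

lemma has_derivative_quadratic_remainder:
  fixes f :: "'a::real_normed_vector \<Rightarrow> real"
  assumes D: "bounded_linear D" and le: "\<And>h. \<bar>f (x + h) - f x - D h\<bar> \<le> C * (norm h)\<^sup>2"
  shows "(f has_derivative D) (at x)"
  unfolding has_derivative_at
proof (intro conjI D)
  have "isCont (\<lambda>h::'a. C * norm h) 0" by (intro continuous_intros)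
  then have "((\<lambda>h::'a. C * norm h) \<longlongrightarrow> 0) (at 0)" by (simp add: isCont_def)
  then show "((\<lambda>h. norm (f (x + h) - f x - D h) / norm h) \<longlongrightarrow> 0) (at 0)"
  proof (rule Lim_null_comparison[rotated], intro always_eventually allI)
    fix h :: 'a
    have "\<bar>f (x + h) - f x - D h\<bar> / norm h \<le> C * norm h"
      using le[of h] by (cases "h = 0") (simp_all add: divide_le_eq power2_eq_square mult.assoc)
    then show "norm (norm (f (x + h) - f x - D h) / norm h) \<le> C * norm h" by simp
  qed
qed

text \<open>The deviations of cos s from 1 and of sin s from s contribute s^2 / 2 each.\<close>

lemma cos_add_remainder: "\<bar>cos (u + s) - cos u + s * sin u\<bar> \<le> (s::real)\<^sup>2"
proof -
  have "\<bar>sin s - (\<Sum>m<2. sin_coeff m * s ^ m)\<bar> \<le> inverse (fact 2) * \<bar>s\<bar> ^ 2"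
    by (rule Maclaurin_sin_bound)
  then have 1: "\<bar>s - sin s\<bar> \<le> s\<^sup>2 / 2"
    by (simp add: sin_coeff_def numeral_2_eq_2 abs_minus_commute)
  have "\<bar>sin (s / 2)\<bar>\<^sup>2 \<le> \<bar>s / 2\<bar>\<^sup>2" by (intro power_mono abs_sin_x_le_abs_x) auto
  moreover have "1 - cos s = 2 * (sin (s / 2))\<^sup>2" using cos_double_sin[of "s / 2"] by simp
  ultimately have 2: "\<bar>cos s - 1\<bar> \<le> s\<^sup>2 / 2" by (simp add: power_divide abs_minus_commute)
  have "cos (u + s) - cos u + s * sin u = cos u * (cos s - 1) + sin u * (s - sin s)"
    by (simp add: cos_add algebra_simps)
  also have "\<bar>\<dots>\<bar> \<le> \<bar>cos u\<bar> * \<bar>cos s - 1\<bar> + \<bar>sin u\<bar> * \<bar>s - sin s\<bar>"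
    unfolding abs_mult[symmetric] by (rule abs_triangle_ineq)
  also have "\<dots> \<le> 1 * (s\<^sup>2 / 2) + 1 * (s\<^sup>2 / 2)"
    using 1 2 by (intro add_mono mult_mono) auto
  finally show ?thesis by simp
qed

text \<open>A real form of the Fourier transform, equal to it for even m and a = 0. The phase keeps
  derivatives and multiplications by coordinates within one family, since each of them amounts to a
  shift by pi / 2.\<close>

definition cos_transform :: "real \<Rightarrow> (real^'n \<Rightarrow> real) \<Rightarrow> real^'n \<Rightarrow> real" where
  "cos_transform a m z = (LINT \<xi>|lborel. m \<xi> * cos (z \<bullet> \<xi> + a))"

lemma cos_transform_integrable:
  assumes "integrable lborel (m :: real^'n \<Rightarrow> real)"
  shows "integrable lborel (\<lambda>\<xi>. m \<xi> * cos (z \<bullet> \<xi> + a))" "integrable lborel (\<lambda>\<xi>. m \<xi> * sin (z \<bullet> \<xi> + a))"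
  by (rule integrable_mult_bounded[OF assms, where B = 1]; simp)+

lemma abs_cos_transform_le:
  assumes "integrable lborel (m :: real^'n \<Rightarrow> real)"
  shows "\<bar>cos_transform a m z\<bar> \<le> (LINT \<xi>|lborel. \<bar>m \<xi>\<bar>)"
  unfolding cos_transform_def
  using abs_integral_mult_le[OF assms, of "\<lambda>\<xi>. cos (z \<bullet> \<xi> + a)" 1] by simp

lemma test_functions_integrable: "m \<in> test_functions \<Longrightarrow> integrable lborel m"
  using test_functions_smooth_W smooth_W_D(2) by blast

lemma test_functions_nth_mult: "m \<in> test_functions \<Longrightarrow> (\<lambda>\<xi>. \<xi> $ i * m \<xi>) \<in> test_functions"
  using test_functions_mult[OF _ smooth_fun_nth, of m i] by (simp add: mult.commute)

text \<open>Differentiation under the integral by an explicit remainder: the second-order error of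
  the cosine, integrated against |m|, is at most |h|^2 times the second moment of |m|.\<close>

lemma has_derivative_cos_transform:
  fixes m :: "real^'n \<Rightarrow> real"
  assumes m: "m \<in> test_functions"
  shows "(cos_transform a m has_derivative
    (\<lambda>h. \<Sum>i\<in>UNIV. h $ i * cos_transform (a + pi / 2) (\<lambda>\<xi>. \<xi> $ i * m \<xi>) z)) (at z)"
proof (rule has_derivative_quadratic_remainder)
  let ?D = "\<lambda>h. \<Sum>i\<in>UNIV. h $ i * cos_transform (a + pi / 2) (\<lambda>\<xi>. \<xi> $ i * m \<xi>) z"
  show "bounded_linear ?D"
    by (intro bounded_linear_sum bounded_linear_mult_left[THEN bounded_linear_compose] bounded_linear_vec_nth)
  have [measurable]: "m \<in> borel_measurable borel"
    using test_functions_smooth_W[OF m] smooth_W_D(4) by blast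
  have im: "integrable lborel m" using m by (rule test_functions_integrable)
  have ii: "integrable lborel (\<lambda>\<xi>. \<xi> $ i * m \<xi>)" for i
    using m by (intro test_functions_integrable test_functions_nth_mult)
  have iii: "integrable lborel (\<lambda>\<xi>. \<xi> $ i * (\<xi> $ i * m \<xi>))" for i
    using m by (intro test_functions_integrable test_functions_nth_mult)
  have i2: "integrable lborel (\<lambda>\<xi>. \<bar>m \<xi>\<bar> * (norm \<xi>)\<^sup>2)"
  proof -
    have "integrable lborel (\<lambda>\<xi>. \<Sum>i\<in>UNIV. \<bar>\<xi> $ i * (\<xi> $ i * m \<xi>)\<bar>)"
      by (intro Bochner_Integration.integrable_sum integrable_abs iii)
    moreover have "(\<Sum>i\<in>UNIV. \<bar>\<xi> $ i * (\<xi> $ i * m \<xi>)\<bar>) = \<bar>m \<xi>\<bar> * (norm \<xi>)\<^sup>2" for \<xi> :: "real^'n"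
      unfolding power2_norm_eq_inner inner_vec_def sum_distrib_left by (simp add: abs_mult mult_ac)
    ultimately show ?thesis by simp
  qed
  fix h :: "real^'n"
  have D: "?D h = (LINT \<xi>|lborel. - (h \<bullet> \<xi>) * (m \<xi> * sin (z \<bullet> \<xi> + a)))"
  proof -
    have "?D h = (\<Sum>i\<in>UNIV. LINT \<xi>|lborel. h $ i * ((\<xi> $ i * m \<xi>) * cos (z \<bullet> \<xi> + (a + pi / 2))))"
      by (simp add: cos_transform_def)
    also have "\<dots> = (LINT \<xi>|lborel. (\<Sum>i\<in>UNIV. h $ i * ((\<xi> $ i * m \<xi>) * cos (z \<bullet> \<xi> + (a + pi / 2)))))"
      by (intro Bochner_Integration.integral_sum[symmetric] integrable_mult_right cos_transform_integrable ii)
    also have "\<dots> = (LINT \<xi>|lborel. - (h \<bullet> \<xi>) * (m \<xi> * sin (z \<bullet> \<xi> + a)))"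
    proof (intro Bochner_Integration.integral_cong refl)
      fix \<xi> :: "real^'n"
      have "cos (z \<bullet> \<xi> + (a + pi / 2)) = - sin (z \<bullet> \<xi> + a)"
        using minus_sin_cos_eq[of "z \<bullet> \<xi> + a"] by (simp add: add.assoc)
      then show "(\<Sum>i\<in>UNIV. h $ i * ((\<xi> $ i * m \<xi>) * cos (z \<bullet> \<xi> + (a + pi / 2)))) = - (h \<bullet> \<xi>) * (m \<xi> * sin (z \<bullet> \<xi> + a))"
        by (simp add: inner_vec_def sum_distrib_left sum_distrib_right sum_negf mult_ac)
    qed
    finally show ?thesis .
  qed
  have iD: "integrable lborel (\<lambda>\<xi>. (h \<bullet> \<xi>) * (m \<xi> * sin (z \<bullet> \<xi> + a)))"
  proof -
    have "integrable lborel (\<lambda>\<xi>. \<Sum>i\<in>UNIV. h $ i * ((\<xi> $ i * m \<xi>) * sin (z \<bullet> \<xi> + a)))"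
      by (intro Bochner_Integration.integrable_sum integrable_mult_right cos_transform_integrable ii)
    then show ?thesis by (simp add: inner_vec_def sum_distrib_left sum_distrib_right mult_ac)
  qed
  have "cos_transform a m (z + h) - cos_transform a m z - ?D h =
      (LINT \<xi>|lborel. m \<xi> * cos ((z + h) \<bullet> \<xi> + a) - m \<xi> * cos (z \<bullet> \<xi> + a) + (h \<bullet> \<xi>) * (m \<xi> * sin (z \<bullet> \<xi> + a)))"
    unfolding D unfolding cos_transform_def
    using iD cos_transform_integrable[OF im] by simp
  also have "\<bar>\<dots>\<bar> \<le> (LINT \<xi>|lborel. (norm h)\<^sup>2 * (\<bar>m \<xi>\<bar> * (norm \<xi>)\<^sup>2))"
  proof (rule abs_integral_le)
    show "integrable lborel (\<lambda>\<xi>. (norm h)\<^sup>2 * (\<bar>m \<xi>\<bar> * (norm \<xi>)\<^sup>2))" using i2 by simp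
    fix \<xi> :: "real^'n"
    have e: "(z + h) \<bullet> \<xi> + a = (z \<bullet> \<xi> + a) + h \<bullet> \<xi>" by (simp add: inner_add_left)
    have "m \<xi> * cos ((z + h) \<bullet> \<xi> + a) - m \<xi> * cos (z \<bullet> \<xi> + a) + (h \<bullet> \<xi>) * (m \<xi> * sin (z \<bullet> \<xi> + a)) =
        m \<xi> * (cos ((z \<bullet> \<xi> + a) + h \<bullet> \<xi>) - cos (z \<bullet> \<xi> + a) + (h \<bullet> \<xi>) * sin (z \<bullet> \<xi> + a))"
      unfolding e by (simp add: algebra_simps)
    also have "\<bar>\<dots>\<bar> \<le> \<bar>m \<xi>\<bar> * (h \<bullet> \<xi>)\<^sup>2"
      unfolding abs_mult by (intro mult_left_mono cos_add_remainder) auto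
    also have "\<dots> \<le> \<bar>m \<xi>\<bar> * (norm h * norm \<xi>)\<^sup>2"
      using Cauchy_Schwarz_ineq2[of h \<xi>] power_mono[of "\<bar>h \<bullet> \<xi>\<bar>" "norm h * norm \<xi>" 2]
      by (intro mult_left_mono) simp_all
    finally show "\<bar>m \<xi> * cos ((z + h) \<bullet> \<xi> + a) - m \<xi> * cos (z \<bullet> \<xi> + a) + (h \<bullet> \<xi>) * (m \<xi> * sin (z \<bullet> \<xi> + a))\<bar>
        \<le> (norm h)\<^sup>2 * (\<bar>m \<xi>\<bar> * (norm \<xi>)\<^sup>2)"
      by (simp add: power_mult_distrib mult_ac)
  qed simp
  also have "\<dots> = (LINT \<xi>|lborel. \<bar>m \<xi>\<bar> * (norm \<xi>)\<^sup>2) * (norm h)\<^sup>2" by simp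
  finally show "\<bar>cos_transform a m (z + h) - cos_transform a m z - ?D h\<bar> \<le>
      (LINT \<xi>|lborel. \<bar>m \<xi>\<bar> * (norm \<xi>)\<^sup>2) * (norm h)\<^sup>2" .
qed

lemma pd_cos_transform:
  assumes "m \<in> test_functions"
  shows "pd i (cos_transform a m) = cos_transform (a + pi / 2) (\<lambda>\<xi>. \<xi> $ i * m \<xi>)"
  using pd_eq[OF has_derivative_cos_transform[OF assms]]
  by (auto simp: fun_eq_iff axis_def if_distrib[of "\<lambda>u. u * _"] cong: if_cong)

lemma smooth_cos_transform:
  assumes "m \<in> test_functions"
  shows "smooth_fun (cos_transform a m)"
proof (rule smooth_fun_coinduct[where P = "\<lambda>f. \<exists>a m. m \<in> test_functions \<and> f = cos_transform a m"])
  fix f :: "real^'a \<Rightarrow> real" assume "\<exists>a m. m \<in> test_functions \<and> f = cos_transform a m"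
  then obtain a m where m: "m \<in> test_functions" "f = cos_transform a m" by blast
  have "f differentiable_on UNIV"
    using has_derivative_cos_transform[OF m(1)] unfolding m(2)
    by (auto simp: differentiable_on_def differentiable_def)
  moreover have "\<exists>a m. m \<in> test_functions \<and> pd i f = cos_transform a m" for i
    unfolding m(2) pd_cos_transform[OF m(1)] using test_functions_nth_mult[OF m(1)] by blast
  ultimately show "f differentiable_on UNIV \<and> (\<forall>i. \<exists>a m. m \<in> test_functions \<and> pd i f = cos_transform a m)"
    by blast
qed (use assms in blast)

lemma iter_pd_cos_transform:
  assumes "m \<in> test_functions"
  shows "\<exists>a' m'. m' \<in> test_functions \<and> iter_pd is (cos_transform a m) = cos_transform a' m'"
proof (induction "is")
  case (Cons i "is")
  then obtain a' m' where *: "m' \<in> test_functions" "iter_pd is (cos_transform a m) = cos_transform a' m'" by blast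
  then show ?case using test_functions_nth_mult[OF *(1)] by (auto simp: pd_cos_transform)
qed (use assms in auto)

text \<open>Integration by parts in \<xi>: z_i cos (z . \<xi> + a) is the i-th partial derivative of
  sin (z . \<xi> + a) in \<xi>.\<close>

lemma nth_mult_cos_transform:
  assumes m: "m \<in> test_functions"
  shows "z $ i * cos_transform a m z = cos_transform (a + pi / 2) (pd i m) z"
proof -
  let ?s = "\<lambda>\<xi>. sin (z \<bullet> \<xi> + a)" and ?c = "\<lambda>\<xi>. cos (z \<bullet> \<xi> + a)"
  have W: "smooth_W m" by (rule test_functions_smooth_W[OF m])
  have pW: "smooth_W (pd i m)" by (rule smooth_W_pd[OF W])
  have ds: "(?s has_derivative (\<lambda>h. ?c \<xi> * (z \<bullet> h))) (at \<xi>)" for \<xi>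
    by (auto intro!: derivative_eq_intros)
  then have ds': "?s differentiable_on UNIV" by (auto simp: differentiable_on_def differentiable_def)
  have ps: "pd i ?s = (\<lambda>\<xi>. ?c \<xi> * z $ i)"
    using pd_eq[OF ds] by (auto simp: inner_axis fun_eq_iff)
  have dm: "m differentiable_on UNIV" using W smooth_W_D(1) smooth_fun_iff by blast
  have eq: "pd i (\<lambda>\<xi>. m \<xi> * ?s \<xi>) = (\<lambda>\<xi>. z $ i * (m \<xi> * ?c \<xi>) + pd i m \<xi> * ?s \<xi>)"
    unfolding pd_mult[OF dm ds'] ps by (simp add: mult_ac)
  note I = cos_transform_integrable[OF smooth_W_D(2)[OF W]] cos_transform_integrable[OF smooth_W_D(2)[OF pW]]
  \<comment> \<open>The sine factor alone is not integrable, so the product is handed to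
    \<open>integral_pd_eq_0\<close> as a whole.\<close>
  have "(LINT \<xi>|lborel. pd i (\<lambda>\<xi>. m \<xi> * ?s \<xi>) \<xi>) = 0"
  proof (rule integral_pd_eq_0)
    show "(\<lambda>\<xi>. m \<xi> * ?s \<xi>) differentiable_on UNIV" using dm ds' by (rule differentiable_on_mult)
    show "continuous_on UNIV (pd i (\<lambda>\<xi>. m \<xi> * ?s \<xi>))"
      unfolding eq using smooth_fun_continuous W pW smooth_W_D(1) by (intro continuous_intros) blast+
    show "integrable lborel (pd i (\<lambda>\<xi>. m \<xi> * ?s \<xi>))"
      unfolding eq by (intro Bochner_Integration.integrable_add integrable_mult_right I)
  qed (rule I)
  then have "z $ i * (LINT \<xi>|lborel. m \<xi> * ?c \<xi>) = - (LINT \<xi>|lborel. pd i m \<xi> * ?s \<xi>)"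
    unfolding eq using I by simp
  moreover have "cos (z \<bullet> \<xi> + (a + pi / 2)) = - sin (z \<bullet> \<xi> + a)" for \<xi>
    using minus_sin_cos_eq[of "z \<bullet> \<xi> + a"] by (simp add: add.assoc)
  ultimately show ?thesis by (simp add: cos_transform_def)
qed

lemma nth_power_mult_cos_transform:
  assumes "m \<in> test_functions"
  shows "\<exists>C. \<forall>z. \<bar>z $ i\<bar> ^ k * \<bar>cos_transform a m z\<bar> \<le> C"
  using assms
proof (induction k arbitrary: a m)
  case 0
  then show ?case using abs_cos_transform_le[OF test_functions_integrable[OF 0]] by auto
next
  case (Suc k)
  obtain C where C: "\<And>z. \<bar>z $ i\<bar> ^ k * \<bar>cos_transform (a + pi / 2) (pd i m) z\<bar> \<le> C"
    using Suc.IH[OF test_functions_pd[OF Suc.prems]] by blast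
  have eq: "\<bar>z $ i\<bar> ^ Suc k * \<bar>cos_transform a m z\<bar> = \<bar>z $ i\<bar> ^ k * \<bar>cos_transform (a + pi / 2) (pd i m) z\<bar>" for z
    unfolding nth_mult_cos_transform[OF Suc.prems, symmetric] by (simp add: abs_mult mult_ac)
  show ?case unfolding eq using C by blast
qed

section \<open>Rapid decay of cosine transforms\<close>

lemma one_plus_power_le: "(1 + x) ^ k \<le> 2 ^ k * (1 + x ^ k)" if "0 \<le> x" for x :: real
proof (cases "x \<le> 1")
  case True
  then have "(1 + x) ^ k \<le> 2 ^ k" using that by (intro power_mono) auto
  also have "\<dots> \<le> 2 ^ k * (1 + x ^ k)" using that by simp
  finally show ?thesis .
next
  case False
  then have "(1 + x) ^ k \<le> (2 * x) ^ k" using that by (intro power_mono) auto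
  also have "\<dots> \<le> 2 ^ k * (1 + x ^ k)" by (simp add: power_mult_distrib)
  finally show ?thesis .
qed

lemma norm_power_le_sum:
  fixes z :: "real^'n"
  shows "norm z ^ k \<le> real CARD('n) ^ k * (\<Sum>i\<in>UNIV. \<bar>z $ i\<bar> ^ k)"
proof -
  obtain j where j: "\<And>i. \<bar>z $ i\<bar> \<le> \<bar>z $ j\<bar>"
  proof -
    have "Max (range (\<lambda>i. \<bar>z $ i\<bar>)) \<in> range (\<lambda>i. \<bar>z $ i\<bar>)" by (intro Max_in) auto
    then obtain j where "Max (range (\<lambda>i. \<bar>z $ i\<bar>)) = \<bar>z $ j\<bar>" by blast
    then have "\<bar>z $ i\<bar> \<le> \<bar>z $ j\<bar>" for i using Max_ge[of "range (\<lambda>i. \<bar>z $ i\<bar>)" "\<bar>z $ i\<bar>"] by simp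
    then show ?thesis by (rule that)
  qed
  have "norm z \<le> (\<Sum>i\<in>UNIV. \<bar>z $ i\<bar>)" by (rule norm_le_l1_cart)
  also have "\<dots> \<le> real CARD('n) * \<bar>z $ j\<bar>" using sum_bounded_above[of UNIV "\<lambda>i. \<bar>z $ i\<bar>"] j by simp
  finally have "norm z ^ k \<le> (real CARD('n) * \<bar>z $ j\<bar>) ^ k" by (intro power_mono) auto
  also have "\<dots> = real CARD('n) ^ k * \<bar>z $ j\<bar> ^ k" by (simp add: power_mult_distrib)
  also have "\<dots> \<le> real CARD('n) ^ k * (\<Sum>i\<in>UNIV. \<bar>z $ i\<bar> ^ k)"
    by (intro mult_left_mono member_le_sum) auto
  finally show ?thesis .
qed

text \<open>Powers of single coordinates are absorbed by derivatives of m, and the largest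
  coordinate controls the norm.\<close>

lemma cos_transform_decay:
  fixes m :: "real^'n \<Rightarrow> real"
  assumes "m \<in> test_functions"
  shows "\<exists>C. \<forall>z. \<bar>cos_transform a m z\<bar> * (1 + norm z) ^ k \<le> C"
proof -
  have "\<forall>i. \<exists>C. \<forall>z. \<bar>z $ i\<bar> ^ k * \<bar>cos_transform a m z\<bar> \<le> C"
    using nth_power_mult_cos_transform[OF assms] by blast
  then obtain C where C: "\<And>i z. \<bar>z $ i\<bar> ^ k * \<bar>cos_transform a m z\<bar> \<le> C i" by metis
  let ?N = "LINT \<xi>|lborel. \<bar>m \<xi>\<bar>"
  have "\<bar>cos_transform a m z\<bar> * (1 + norm z) ^ k \<le> 2 ^ k * (?N + real CARD('n) ^ k * (\<Sum>i\<in>UNIV. C i))" for z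
  proof -
    have "(1 + norm z) ^ k \<le> 2 ^ k * (1 + real CARD('n) ^ k * (\<Sum>i\<in>UNIV. \<bar>z $ i\<bar> ^ k))"
      by (rule order_trans[OF one_plus_power_le]) (auto intro: norm_power_le_sum)
    then have "\<bar>cos_transform a m z\<bar> * (1 + norm z) ^ k \<le>
        \<bar>cos_transform a m z\<bar> * (2 ^ k * (1 + real CARD('n) ^ k * (\<Sum>i\<in>UNIV. \<bar>z $ i\<bar> ^ k)))"
      by (rule mult_left_mono) simp
    also have "\<dots> = 2 ^ k * (\<bar>cos_transform a m z\<bar> + real CARD('n) ^ k * (\<Sum>i\<in>UNIV. \<bar>z $ i\<bar> ^ k * \<bar>cos_transform a m z\<bar>))"
      by (simp add: sum_distrib_left sum_distrib_right algebra_simps)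
    also have "\<dots> \<le> 2 ^ k * (?N + real CARD('n) ^ k * (\<Sum>i\<in>UNIV. C i))"
      using abs_cos_transform_le[OF test_functions_integrable[OF assms]] C
      by (intro mult_left_mono add_mono sum_mono) auto
    finally show ?thesis .
  qed
  then show ?thesis by blast
qed

lemma cos_transform_integrable_decay:
  assumes m: "m \<in> test_functions" and p: "0 \<le> p" "p \<le> 1"
  shows "integrable lborel (\<lambda>z. \<bar>cos_transform a m z\<bar> * norm z powr p)"
proof -
  have [measurable]: "cos_transform a m \<in> borel_measurable borel"
    by (rule smooth_fun_measurable[OF smooth_cos_transform[OF m]])
  \<comment> \<open>2 d powers for integrability and one more to absorb the weight |z|^p, which is
    where p \<le> 1 enters.\<close>
  let ?k = "2 * CARD('a) + 1"
  obtain C where C: "\<And>z. \<bar>cos_transform a m z\<bar> * (1 + norm z) ^ ?k \<le> C"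
    using cos_transform_decay[OF m, of a ?k] by blast
  show ?thesis
  proof (rule integrable_decay)
    fix z :: "real^'a"
    have "norm z powr p \<le> (1 + norm z) powr p" using p by (intro powr_mono2) auto
    also have "\<dots> \<le> (1 + norm z) powr 1" using p by (intro powr_mono) auto
    finally have "norm z powr p \<le> 1 + norm z" by simp
    then have "\<bar>cos_transform a m z\<bar> * norm z powr p * (1 + norm z) ^ (2 * CARD('a)) \<le>
        \<bar>cos_transform a m z\<bar> * (1 + norm z) * (1 + norm z) ^ (2 * CARD('a))"
      by (intro mult_right_mono mult_left_mono) auto
    also have "\<dots> = \<bar>cos_transform a m z\<bar> * (1 + norm z) ^ ?k" by simp
    finally show "norm (\<bar>cos_transform a m z\<bar> * norm z powr p) * (1 + norm z) ^ (2 * CARD('a)) \<le> C"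
      using C[of z] by (simp add: abs_mult)
  qed measurable
qed

lemma cos_transform_L1:
  assumes m: "m \<in> test_functions"
  shows "integrable lborel (cos_transform a m)"
proof (rule integrable_decay)
  show "cos_transform a m \<in> borel_measurable borel"
    by (rule smooth_fun_measurable[OF smooth_cos_transform[OF m]])
  have "\<exists>C. \<forall>z. \<bar>cos_transform a m z\<bar> * (1 + norm z) ^ (2 * CARD('a)) \<le> C"
    by (rule cos_transform_decay[OF m])
  then show "norm (cos_transform a m z) * (1 + norm z) ^ (2 * CARD('a)) \<le>
      (SOME C. \<forall>z. \<bar>cos_transform a m z\<bar> * (1 + norm z) ^ (2 * CARD('a)) \<le> C)" for z
    unfolding real_norm_def by (rule someI2_ex) blast
qed

lemma smooth_W_cos_transform:
  assumes m: "m \<in> test_functions"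
  shows "smooth_W (cos_transform a m)"
  unfolding smooth_W_def
proof (intro conjI allI)
  show "smooth_fun (cos_transform a m)" by (rule smooth_cos_transform[OF m])
  fix "is"
  obtain a' m' where *: "m' \<in> test_functions" "iter_pd is (cos_transform a m) = cos_transform a' m'"
    using iter_pd_cos_transform[OF m] by blast
  show "integrable lborel (iter_pd is (cos_transform a m))"
    unfolding *(2) by (rule cos_transform_L1[OF *(1)])
  show "bounded (range (iter_pd is (cos_transform a m)))"
    unfolding *(2) bounded_iff using abs_cos_transform_le[OF test_functions_integrable[OF *(1)]] by auto
qed

lemma hess_norm_cos_transform_weighted:
  assumes m: "m \<in> test_functions" and p: "0 \<le> p" "p \<le> 1"
  shows "integrable lborel (\<lambda>z. hess_norm (cos_transform a m) z * norm z powr p)"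
  unfolding hess_norm_def sum_distrib_right pd_cos_transform[OF m] pd_cos_transform[OF test_functions_nth_mult[OF m]]
  by (intro Bochner_Integration.integrable_sum cos_transform_integrable_decay test_functions_nth_mult m p)

lemma lap_cos_transform:
  assumes m: "m \<in> test_functions"
  shows "lap (cos_transform a m) z = - cos_transform a (\<lambda>\<xi>. (norm \<xi>)\<^sup>2 * m \<xi>) z"
proof -
  have i: "integrable lborel (\<lambda>\<xi>. (\<xi> $ i * (\<xi> $ i * m \<xi>)) * cos (z \<bullet> \<xi> + (a + pi / 2 + pi / 2)))" for i
    by (intro cos_transform_integrable test_functions_integrable test_functions_nth_mult m)
  have "lap (cos_transform a m) z =
      (LINT \<xi>|lborel. (\<Sum>i\<in>UNIV. (\<xi> $ i * (\<xi> $ i * m \<xi>)) * cos (z \<bullet> \<xi> + (a + pi / 2 + pi / 2))))"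
    unfolding lap_def pd_cos_transform[OF m] pd_cos_transform[OF test_functions_nth_mult[OF m]] cos_transform_def
    by (intro Bochner_Integration.integral_sum[symmetric] i)
  also have "\<dots> = (LINT \<xi>|lborel. - ((norm \<xi>)\<^sup>2 * m \<xi> * cos (z \<bullet> \<xi> + a)))"
  proof (intro Bochner_Integration.integral_cong refl)
    fix \<xi> :: "real^'a"
    have "cos (z \<bullet> \<xi> + (a + pi / 2 + pi / 2)) = - cos (z \<bullet> \<xi> + a)"
      using cos_periodic_pi[of "z \<bullet> \<xi> + a"] by (simp add: add.assoc)
    then show "(\<Sum>i\<in>UNIV. (\<xi> $ i * (\<xi> $ i * m \<xi>)) * cos (z \<bullet> \<xi> + (a + pi / 2 + pi / 2))) =
        - ((norm \<xi>)\<^sup>2 * m \<xi> * cos (z \<bullet> \<xi> + a))"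
      unfolding power2_norm_eq_inner inner_vec_def by (simp add: sum_distrib_left sum_distrib_right sum_negf mult_ac)
  qed
  finally show ?thesis by (simp add: cos_transform_def)
qed

section \<open>Littlewood-Paley pieces\<close>

lemma schwartz_integrable:
  fixes \<psi> :: "real^'n \<Rightarrow> complex"
  assumes "\<psi> \<in> schwartz"
  shows "integrable lborel \<psi>"
proof -
  have sm: "smooth_fun \<psi>" using assms by (simp add: schwartz_def)
  have "\<exists>C. \<forall>x. norm x ^ k * norm (\<psi> x) \<le> C" for k
  proof -
    have "bounded (range (\<lambda>x. norm x ^ k *\<^sub>R iter_pd [] \<psi> x))"
      using assms unfolding schwartz_def by blast
    then show ?thesis unfolding bounded_iff by (simp add: abs_mult)
  qed
  then obtain C where C: "\<And>k x. norm x ^ k * norm (\<psi> x) \<le> C k" by metis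
  let ?k = "2 * CARD('n)"
  show ?thesis
  proof (rule integrable_decay)
    show "\<psi> \<in> borel_measurable borel" using sm by (rule smooth_fun_measurable)
    fix x
    have "norm (\<psi> x) * (1 + norm x) ^ ?k \<le> norm (\<psi> x) * (2 ^ ?k * (1 + norm x ^ ?k))"
      by (intro mult_left_mono one_plus_power_le) auto
    also have "\<dots> = 2 ^ ?k * (norm x ^ 0 * norm (\<psi> x) + norm x ^ ?k * norm (\<psi> x))"
      by (simp add: algebra_simps)
    also have "\<dots> \<le> 2 ^ ?k * (C 0 + C ?k)"
      by (intro mult_left_mono add_mono C) auto
    finally show "norm (\<psi> x) * (1 + norm x) ^ ?k \<le> 2 ^ ?k * (C 0 + C ?k)" .
  qed
qed

text \<open>The sine part is odd and integrates to 0, so that real kernels suffice from here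
  on.\<close>

lemma integral_cis_even:
  fixes m :: "real^'n \<Rightarrow> real"
  assumes m: "integrable lborel m" and even: "\<And>\<xi>. m (- \<xi>) = m \<xi>"
  shows "(LINT \<xi>|lborel. exp (- (\<i> * complex_of_real (z \<bullet> \<xi>))) * complex_of_real (m \<xi>)) =
    complex_of_real (cos_transform 0 m z)"
proof -
  have [measurable]: "m \<in> borel_measurable borel" using m by auto
  have e: "exp (- (\<i> * complex_of_real (z \<bullet> \<xi>))) * complex_of_real (m \<xi>) =
      complex_of_real (m \<xi> * cos (z \<bullet> \<xi> + 0)) - \<i> * complex_of_real (m \<xi> * sin (z \<bullet> \<xi> + 0))" for \<xi>
  proof -
    have "exp (- (\<i> * complex_of_real (z \<bullet> \<xi>))) = cis (- (z \<bullet> \<xi>))" by (simp add: cis_conv_exp)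
    then show ?thesis by (simp add: complex_eq_iff mult_ac)
  qed
  have odd: "(LINT \<xi>|lborel. m \<xi> * sin (z \<bullet> \<xi> + 0)) = 0"
  proof -
    have "(LINT \<xi>|lborel. m \<xi> * sin (z \<bullet> \<xi> + 0)) =
        \<bar>- 1\<bar> ^ CARD('n) *\<^sub>R (LINT \<xi>|lborel. m ((- 1) *\<^sub>R \<xi> + 0) * sin (z \<bullet> ((- 1) *\<^sub>R \<xi> + 0) + 0))"
      by (rule lborel_integral_affine) auto
    then show ?thesis by (simp add: even)
  qed
  show ?thesis
  proof -
    have "(LINT \<xi>|lborel. complex_of_real (m \<xi> * cos (z \<bullet> \<xi> + 0)) - \<i> * complex_of_real (m \<xi> * sin (z \<bullet> \<xi> + 0))) =
        (LINT \<xi>|lborel. complex_of_real (m \<xi> * cos (z \<bullet> \<xi> + 0))) -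
        (LINT \<xi>|lborel. \<i> * complex_of_real (m \<xi> * sin (z \<bullet> \<xi> + 0)))"
      by (intro Bochner_Integration.integral_diff integrable_mult_right integrable_of_real cos_transform_integrable m)
    then show ?thesis
      unfolding e by (simp only: integral_mult_right_zero integral_complex_of_real odd cos_transform_def) simp
  qed
qed

text \<open>The convolution theorem, in the order of operations that duality imposes on
  \<open>lp_piece\<close>. Both transforms are written out and the integrals exchanged, so Fourier
  inversion does not enter.\<close>

lemma fourier_mult_inv_fourier:
  fixes m :: "real^'n \<Rightarrow> real" and \<psi> :: "real^'n \<Rightarrow> complex"
  assumes m: "integrable lborel m" and even: "\<And>\<xi>. m (- \<xi>) = m \<xi>" and \<psi>: "integrable lborel \<psi>"
  shows "fourier (\<lambda>\<xi>. complex_of_real (m \<xi>) * inv_fourier \<psi> \<xi>) x =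
    (LINT y|lborel. \<psi> y * complex_of_real (1 / (2 * pi) ^ CARD('n) * cos_transform 0 m (x - y)))"
proof -
  let ?c = "complex_of_real (1 / (2 * pi) ^ CARD('n))"
  have [measurable]: "m \<in> borel_measurable borel" "\<psi> \<in> borel_measurable borel" using m \<psi> by auto
  let ?F = "\<lambda>\<xi> y. exp (- (\<i> * complex_of_real (\<xi> \<bullet> x))) * (complex_of_real (m \<xi>) * (exp (\<i> * complex_of_real (\<xi> \<bullet> y)) * \<psi> y))"
  have "integrable (lborel \<Otimes>\<^sub>M lborel) (\<lambda>(\<xi>, y). ?F \<xi> y)"
  proof (rule integrable_pair_bound_norm)
    show "integrable lborel (\<lambda>\<xi>. \<bar>m \<xi>\<bar>)" "integrable lborel (\<lambda>y. norm (\<psi> y))"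
      using m \<psi> by (auto intro: integrable_abs integrable_norm)
    show "norm (case (\<xi>, y) of (\<xi>, y) \<Rightarrow> ?F \<xi> y) \<le> \<bar>m \<xi>\<bar> * norm (\<psi> y)" for \<xi> y
      by (simp add: norm_mult norm_exp_eq_Re)
  qed measurable
  from lborel_pair.Fubini_integral[OF this]
  have F: "(LINT y|lborel. LINT \<xi>|lborel. ?F \<xi> y) = (LINT \<xi>|lborel. LINT y|lborel. ?F \<xi> y)" .
  have inner: "(LINT \<xi>|lborel. ?F \<xi> y) = \<psi> y * complex_of_real (cos_transform 0 m (x - y))" for y
  proof -
    have "?F \<xi> y = \<psi> y * (exp (- (\<i> * complex_of_real ((x - y) \<bullet> \<xi>))) * complex_of_real (m \<xi>))" for \<xi>
    proof -
      have "exp (- (\<i> * complex_of_real ((x - y) \<bullet> \<xi>))) =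
          exp (- (\<i> * complex_of_real (\<xi> \<bullet> x))) * exp (\<i> * complex_of_real (\<xi> \<bullet> y))"
        by (simp add: exp_add[symmetric] inner_diff_left inner_commute[of x] inner_commute[of y] algebra_simps)
      then show ?thesis by simp
    qed
    then show ?thesis by (simp only: integral_mult_right_zero integral_cis_even[OF m even])
  qed
  have "fourier (\<lambda>\<xi>. complex_of_real (m \<xi>) * inv_fourier \<psi> \<xi>) x =
      (LINT \<xi>|lborel. ?c * (LINT y|lborel. ?F \<xi> y))"
  proof -
    have "(LINT y|lborel. ?F \<xi> y) = exp (- (\<i> * complex_of_real (\<xi> \<bullet> x))) * (complex_of_real (m \<xi>) *
        (LINT y|lborel. exp (\<i> * complex_of_real (\<xi> \<bullet> y)) * \<psi> y))" for \<xi>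
      by (simp only: integral_mult_right_zero)
    then show ?thesis
      unfolding fourier_def inv_fourier_def by (simp add: mult_ac)
  qed
  also have "\<dots> = ?c * (LINT y|lborel. LINT \<xi>|lborel. ?F \<xi> y)"
    unfolding F by (rule integral_mult_right_zero)
  also have "\<dots> = ?c * (LINT y|lborel. \<psi> y * complex_of_real (cos_transform 0 m (x - y)))"
    by (simp only: inner)
  also have "\<dots> = (LINT y|lborel. ?c * (\<psi> y * complex_of_real (cos_transform 0 m (x - y))))"
    by (rule integral_mult_right_zero[symmetric])
  finally show ?thesis by (simp add: mult_ac)
qed

text \<open>For even m, the inverse Fourier transform of m.\<close>

definition lp_kernel :: "(real^'n \<Rightarrow> real) \<Rightarrow> real^'n \<Rightarrow> real" where
  "lp_kernel m z = 1 / (2 * pi) ^ CARD('n) * cos_transform 0 m z"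

lemma lp_piece_eq_temp_of:
  fixes f \<phi> :: "real^'n \<Rightarrow> real"
  assumes m: "lp_symbol \<phi> k \<in> test_functions" and even: "\<And>\<xi>. lp_symbol \<phi> k (- \<xi>) = lp_symbol \<phi> k \<xi>"
    and f[measurable]: "f \<in> borel_measurable borel" and B: "\<And>x. \<bar>f x\<bar> \<le> B" and \<psi>: "\<psi> \<in> schwartz"
  shows "lp_piece \<phi> k f \<psi> =
    temp_of (\<lambda>y. complex_of_real (LINT x|lborel. f x * lp_kernel (lp_symbol \<phi> k) (x - y))) \<psi>"
proof -
  let ?K = "lp_kernel (lp_symbol \<phi> k)"
  have \<psi>i: "integrable lborel \<psi>" using \<psi> by (rule schwartz_integrable)
  then have [measurable]: "\<psi> \<in> borel_measurable borel" by auto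
  have K: "integrable lborel ?K"
    unfolding lp_kernel_def[abs_def] using cos_transform_L1[OF m] by simp
  then have [measurable]: "?K \<in> borel_measurable borel" by auto
  have Kt: "integrable lborel (\<lambda>x. \<bar>?K (x - y)\<bar>)" "(LINT x|lborel. \<bar>?K (x - y)\<bar>) = (LINT x|lborel. \<bar>?K x\<bar>)" for y
    using lborel_integrable_affine[of "\<lambda>x. \<bar>?K x\<bar>" 1 "- y"] lborel_integral_affine[of "\<lambda>x. \<bar>?K x\<bar>" 1 "- y"]
      integrable_abs[OF K] by simp_all
  let ?F = "\<lambda>y x. complex_of_real (f x) * (\<psi> y * complex_of_real (?K (x - y)))"
  have iy: "integrable lborel (\<lambda>x. ?F y x)" for y
  proof (rule Bochner_Integration.integrable_bound)
    show "integrable lborel (\<lambda>x. (\<bar>B\<bar> * norm (\<psi> y)) * \<bar>?K (x - y)\<bar>)" using Kt(1) by (rule integrable_mult_right)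
    show "AE x in lborel. norm (?F y x) \<le> norm ((\<bar>B\<bar> * norm (\<psi> y)) * \<bar>?K (x - y)\<bar>)"
    proof (rule AE_I2)
      fix x
      have "\<bar>f x\<bar> \<le> \<bar>B\<bar>" using B[of x] by linarith
      from mult_right_mono[OF this, of "norm (\<psi> y) * \<bar>?K (x - y)\<bar>"]
      show "norm (?F y x) \<le> norm ((\<bar>B\<bar> * norm (\<psi> y)) * \<bar>?K (x - y)\<bar>)"
        by (simp add: norm_mult abs_mult mult_ac)
    qed
  qed measurable
  \<comment> \<open>f is only bounded, and K (x - y) is not dominated by a product of functions of x
    and of y. Integrability comes from integrating in x first, where the L^1 norm of K is
    translation invariant.\<close>
  have "integrable (lborel \<Otimes>\<^sub>M lborel) (\<lambda>(y, x). ?F y x)"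
  proof (rule lborel_pair.Fubini_integrable)
    show "integrable lborel (\<lambda>y. LINT x|lborel. norm (case (y, x) of (y, x) \<Rightarrow> ?F y x))"
    proof (rule Bochner_Integration.integrable_bound)
      show "integrable lborel (\<lambda>y. (\<bar>B\<bar> * (LINT x|lborel. \<bar>?K x\<bar>)) * norm (\<psi> y))"
        using \<psi>i by (intro integrable_mult_right integrable_norm)
      show "AE y in lborel. norm (LINT x|lborel. norm (case (y, x) of (y, x) \<Rightarrow> ?F y x)) \<le>
          norm ((\<bar>B\<bar> * (LINT x|lborel. \<bar>?K x\<bar>)) * norm (\<psi> y))"
      proof (rule AE_I2)
        fix y
        have "(LINT x|lborel. norm (?F y x)) \<le> (LINT x|lborel. (\<bar>B\<bar> * norm (\<psi> y)) * \<bar>?K (x - y)\<bar>)"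
        proof (rule integral_mono)
          fix x
          have "\<bar>f x\<bar> \<le> \<bar>B\<bar>" using B[of x] by linarith
          from mult_right_mono[OF this, of "norm (\<psi> y) * \<bar>?K (x - y)\<bar>"]
          show "norm (?F y x) \<le> (\<bar>B\<bar> * norm (\<psi> y)) * \<bar>?K (x - y)\<bar>"
            by (simp add: norm_mult mult_ac)
        qed (use iy Kt(1) in \<open>auto intro!: integrable_norm\<close>)
        then show "norm (LINT x|lborel. norm (case (y, x) of (y, x) \<Rightarrow> ?F y x)) \<le>
            norm ((\<bar>B\<bar> * (LINT x|lborel. \<bar>?K x\<bar>)) * norm (\<psi> y))"
          by (simp add: Kt(2) abs_mult mult_ac)
      qed
    qed measurable
    show "AE y in lborel. integrable lborel (\<lambda>x. case (y, x) of (y, x) \<Rightarrow> ?F y x)" using iy by simp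
  qed measurable
  from lborel_pair.Fubini_integral[OF this]
  have F: "(LINT x|lborel. LINT y|lborel. ?F y x) = (LINT y|lborel. LINT x|lborel. ?F y x)" .
  have "lp_piece \<phi> k f \<psi> = (LINT x|lborel. complex_of_real (f x) *
      fourier (\<lambda>\<xi>. complex_of_real (lp_symbol \<phi> k \<xi>) * inv_fourier \<psi> \<xi>) x)"
    by (simp add: lp_piece_def temp_inv_fourier_def temp_mult_def temp_fourier_def temp_of_def)
  also have "\<dots> = (LINT x|lborel. LINT y|lborel. ?F y x)"
    unfolding fourier_mult_inv_fourier[OF test_functions_integrable[OF m] even \<psi>i] lp_kernel_def
    by simp
  also have "\<dots> = (LINT y|lborel. LINT x|lborel. \<psi> y * complex_of_real (f x * ?K (x - y)))"
    unfolding F by (simp add: mult_ac)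
  also have "\<dots> = temp_of (\<lambda>y. complex_of_real (LINT x|lborel. f x * ?K (x - y))) \<psi>"
    unfolding temp_of_def
    by (simp only: integral_mult_right_zero integral_complex_of_real mult.commute[of "complex_of_real _" "\<psi> _"])
  finally show ?thesis .
qed

lemma temp_Linf_lp_piece_le:
  fixes f \<phi> :: "real^'n \<Rightarrow> real"
  assumes m: "lp_symbol \<phi> k \<in> test_functions" and even: "\<And>\<xi>. lp_symbol \<phi> k (- \<xi>) = lp_symbol \<phi> k \<xi>"
    and f[measurable]: "f \<in> borel_measurable borel" and B: "\<And>x. \<bar>f x\<bar> \<le> B"
    and A: "\<And>y. \<bar>LINT x|lborel. f x * lp_kernel (lp_symbol \<phi> k) (x - y)\<bar> \<le> A"
  shows "temp_Linf (lp_piece \<phi> k f) \<le> ennreal A"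
proof -
  let ?K = "lp_kernel (lp_symbol \<phi> k)"
  let ?g = "\<lambda>y. complex_of_real (LINT x|lborel. f x * ?K (x - y))"
  have "integrable lborel ?K"
    unfolding lp_kernel_def[abs_def] using cos_transform_L1[OF m] by simp
  then have [measurable]: "?K \<in> borel_measurable borel" by auto
  have "(\<lambda>(y, x). f x * ?K (x - y)) \<in> borel_measurable (borel \<Otimes>\<^sub>M lborel)" by measurable
  from lborel.borel_measurable_lebesgue_integral[OF this]
  have g[measurable]: "?g \<in> borel_measurable borel" by simp
  have "esssup lborel (\<lambda>y. ereal (norm (?g y))) \<le> ereal A"
    using A by (intro esssup_I AE_I2) (auto simp del: norm_of_real simp: norm_of_real[where 'a=complex])
  then have L: "Linf_norm ?g \<le> ennreal A"
    unfolding Linf_norm_def using e2ennreal_mono by fastforce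
  have "temp_Linf (lp_piece \<phi> k f) \<le> Linf_norm ?g"
    unfolding temp_Linf_def
    using L lp_piece_eq_temp_of[OF m even f B] by (intro Inf_lower) (auto simp: less_top[symmetric] top_unique)
  then show ?thesis using L by (rule order_trans)
qed

section \<open>The Zygmund bound\<close>

context lp_cutoff_function
begin

text \<open>One fixed symbol living on the annulus 1/2 \<le> |\<xi>| \<le> 2; the symbols with k > 0
  are its dilations, so a single potential serves all of them.\<close>

definition band :: "real^'n \<Rightarrow> real" where
  "band \<xi> = \<phi> \<xi> - \<phi> (2 *\<^sub>R \<xi>)"

lemma band_test: "band \<in> test_functions"
proof (rule test_functionsI[OF _ compact_cball[of 0 2]])
  show "smooth_fun band"
    unfolding band_def[abs_def]
    using smooth_fun_diff[OF smooth_\<phi> smooth_fun_affine[OF smooth_\<phi>, of 2 0]] by simp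
qed (simp add: band_def \<phi>_eq_0)

lemma band_eq_0: "norm \<xi> < 1 / 2 \<Longrightarrow> band \<xi> = 0"
  by (simp add: band_def \<phi>_eq_1)

lemma lp_symbol_0: "lp_symbol \<phi> 0 = \<phi>"
  by (simp add: lp_symbol_def fun_eq_iff)

lemma lp_symbol_band: "0 < k \<Longrightarrow> lp_symbol \<phi> k \<xi> = band ((1 / 2 ^ k) *\<^sub>R \<xi>)"
  by (simp add: lp_symbol_def band_def)

lemma lp_symbol_test: "lp_symbol \<phi> k \<in> test_functions"
proof (cases "k = 0")
  case True
  then show ?thesis by (simp add: lp_symbol_0 \<phi>_test)
next
  case False
  then have "lp_symbol \<phi> k = (\<lambda>\<xi>. band ((1 / 2 ^ k) *\<^sub>R \<xi> + 0))"
    using lp_symbol_band[of k] by auto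
  then show ?thesis using test_functions_affine[OF band_test, of "1 / 2 ^ k" 0] by simp
qed

lemma lp_symbol_even: "lp_symbol \<phi> k (- \<xi>) = lp_symbol \<phi> k \<xi>"
proof -
  have "\<phi> (c *\<^sub>R (- \<xi>)) = \<phi> (c *\<^sub>R \<xi>)" for c by (rule \<phi>_radial) simp
  from this[of 1] this[of "1 / 2 ^ k"] this[of "2 / 2 ^ k"] show ?thesis by (simp add: lp_symbol_def)
qed

text \<open>Up to the normalising factor, the function with symbol - band / |\<xi>|^2, whose
  Laplacian has symbol \<open>band\<close>. The phase pi supplies the minus sign, and the quotient
  is smooth because \<open>band\<close> vanishes near 0.\<close>

definition band_potential :: "real^'n \<Rightarrow> real" where
  "band_potential = cos_transform pi (\<lambda>\<xi>. band \<xi> / (norm \<xi>)\<^sup>2)"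

lemma band_div_test: "(\<lambda>\<xi>. band \<xi> / (norm \<xi>)\<^sup>2) \<in> test_functions"
proof (rule test_functionsI)
  show "smooth_fun (\<lambda>\<xi>. band \<xi> / (norm \<xi>)\<^sup>2)"
    using band_test band_eq_0 by (intro smooth_fun_div_norm2[where r = "1 / 2"]) (auto simp: test_functions_def)
  show "compact (fun_support band)" using band_test by (simp add: test_functions_def)
qed (simp add: not_in_fun_support)

lemma smooth_W_band_potential: "smooth_W band_potential"
  unfolding band_potential_def by (rule smooth_W_cos_transform[OF band_div_test])

lemma lap_band_potential: "lap band_potential z = cos_transform 0 band z"
proof -
  have "(\<lambda>\<xi>. (norm \<xi>)\<^sup>2 * (band \<xi> / (norm \<xi>)\<^sup>2)) = band"
  proof
    fix \<xi> show "(norm \<xi>)\<^sup>2 * (band \<xi> / (norm \<xi>)\<^sup>2) = band \<xi>"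
      using band_eq_0[of \<xi>] by (cases "\<xi> = 0") auto
  qed
  then have "lap band_potential z = - cos_transform pi band z"
    unfolding band_potential_def lap_cos_transform[OF band_div_test] by simp
  then show ?thesis by (simp add: cos_transform_def)
qed

lemma lp_kernel_band:
  assumes "0 < k"
  shows "lp_kernel (lp_symbol \<phi> k) z = 1 / (2 * pi) ^ CARD('n) * (2 ^ k) ^ CARD('n) * lap band_potential (2 ^ k *\<^sub>R z)"
proof -
  have [measurable]: "lp_symbol \<phi> k \<in> borel_measurable borel"
    using test_functions_smooth_W[OF lp_symbol_test] smooth_W_D(4) by blast
  have "cos_transform 0 (lp_symbol \<phi> k) z = \<bar>2 ^ k\<bar> ^ CARD('n) *\<^sub>R
      (LINT \<xi>|lborel. lp_symbol \<phi> k (2 ^ k *\<^sub>R \<xi> + 0) * cos (z \<bullet> (2 ^ k *\<^sub>R \<xi> + 0) + 0))"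
    unfolding cos_transform_def by (rule lborel_integral_affine) auto
  also have "\<dots> = (2 ^ k) ^ CARD('n) * cos_transform 0 band (2 ^ k *\<^sub>R z)"
    using assms by (simp add: lp_symbol_band cos_transform_def)
  finally show ?thesis by (simp add: lp_kernel_def lap_band_potential)
qed

end

context pressure_data
begin

text \<open>The first summand serves k = 0, the second every k > 0.\<close>

definition lp_const :: real where
  "lp_const = pressure_const * (LINT x|lborel. \<bar>lp_kernel \<phi> x\<bar>) +
    1 / (2 * pi) ^ CARD('n) * (LINT z|lborel. hess_norm band_potential z * norm z powr (2 * \<gamma>))"

lemma pressure_const_nonneg: "0 \<le> pressure_const"
  unfolding pressure_const_def using Q_const_nonneg mass_pos
  by (intro divide_nonneg_nonneg mult_nonneg_nonneg Bochner_Integration.integral_nonneg) (auto simp: dominator_nonneg)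

lemma lp_const_nonneg: "0 \<le> lp_const"
  unfolding lp_const_def
  by (intro add_nonneg_nonneg mult_nonneg_nonneg Bochner_Integration.integral_nonneg pressure_const_nonneg)
    (auto simp: hess_norm_nonneg)

text \<open>For k > 0 the equation, tested with the potential rescaled by N = 2^k and centred at y,
  replaces the pressure by \<open>v \<otimes> v\<close>; \<open>integral_hess_bound\<close> then
  yields N^(-d - 2 \<gamma>) against the N^d of the kernel. For k = 0 the symbol is 1 near 0 and
  cannot be divided by |\<xi>|^2, so the sup bound on the pressure is used.\<close>

lemma pressure_lp_bound:
  "\<bar>LINT x|lborel. pressure x * lp_kernel (lp_symbol \<phi> k) (x - y)\<bar> \<le> H\<^sup>2 * lp_const / (2 ^ k) powr (2 * \<gamma>)"
proof (cases "k = 0")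
  case True
  let ?K = "lp_kernel \<phi>"
  have K: "integrable lborel ?K"
    unfolding lp_kernel_def[abs_def] using cos_transform_L1[OF \<phi>_test] by simp
  then have [measurable]: "?K \<in> borel_measurable borel" by auto
  have Kt: "integrable lborel (\<lambda>x. ?K (x - y))" "(LINT x|lborel. \<bar>?K (x - y)\<bar>) = (LINT x|lborel. \<bar>?K x\<bar>)"
    using lborel_integrable_affine[of ?K 1 "- y"] lborel_integral_affine[of "\<lambda>x. \<bar>?K x\<bar>" 1 "- y"] K by simp_all
  have "\<bar>LINT x|lborel. ?K (x - y) * pressure x\<bar> \<le> H\<^sup>2 * pressure_const * (LINT x|lborel. \<bar>?K (x - y)\<bar>)"
    by (rule abs_integral_mult_le[OF Kt(1) _ pressure_bound]) simp
  also have "\<dots> \<le> H\<^sup>2 * lp_const"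
    unfolding lp_const_def Kt(2) mult.assoc
    by (intro mult_left_mono) (auto intro!: Bochner_Integration.integral_nonneg simp: hess_norm_nonneg)
  finally show ?thesis using True by (simp add: lp_symbol_0 mult.commute)
next
  case False
  let ?d = "CARD('n)" and ?N = "2 ^ k :: real"
  let ?A = "LINT z|lborel. hess_norm band_potential z * norm z powr (2 * \<gamma>)"
  define b where "b = - (?N *\<^sub>R y)"
  have cxb: "?N *\<^sub>R (x - y) = ?N *\<^sub>R x + b" for x by (simp add: b_def algebra_simps)
  have W: "smooth_W band_potential" by (rule smooth_W_band_potential)
  have sf: "smooth_fun band_potential" using W smooth_W_D by blast
  have "(LINT x|lborel. pressure x * lap (\<lambda>x. band_potential (?N *\<^sub>R x + b)) x) =
      - (LINT x|lborel. hess (\<lambda>x. band_potential (?N *\<^sub>R x + b)) x (v x))"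
    by (intro pressure_equation smooth_W_affine W) simp
  \<comment> \<open>The Laplacian and the Hessian both produce N^2, so this factor never reaches the
    estimate.\<close>
  then have "?N\<^sup>2 * (LINT x|lborel. pressure x * lap band_potential (?N *\<^sub>R (x - y))) =
      ?N\<^sup>2 * (- (LINT x|lborel. hess band_potential (?N *\<^sub>R (x - y)) (v x)))"
    unfolding lap_affine[OF sf] hess_affine[OF sf] cxb by (simp add: mult.left_commute[of "pressure _"])
  then have eq: "(LINT x|lborel. pressure x * lap band_potential (?N *\<^sub>R (x - y))) =
      - (LINT x|lborel. hess band_potential (?N *\<^sub>R (x - y)) (v x))"
    by (simp only: mult_cancel_left) auto
  have i: "integrable lborel (\<lambda>z. hess_norm band_potential z * norm z powr (2 * \<gamma>))"
    unfolding band_potential_def using \<gamma> by (intro hess_norm_cos_transform_weighted band_div_test) auto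
  have "(LINT x|lborel. pressure x * lp_kernel (lp_symbol \<phi> k) (x - y)) =
      1 / (2 * pi) ^ ?d * ?N ^ ?d * (LINT x|lborel. pressure x * lap band_potential (?N *\<^sub>R (x - y)))"
    using False unfolding lp_kernel_band[OF neq0_conv[THEN iffD1, OF False]]
    by (simp add: mult_ac flip: integral_mult_right_zero)
  also have "\<bar>\<dots>\<bar> = 1 / (2 * pi) ^ ?d * ?N ^ ?d * \<bar>LINT x|lborel. hess band_potential (?N *\<^sub>R (x - y)) (v x)\<bar>"
    unfolding eq by (simp add: abs_mult)
  also have "\<dots> \<le> 1 / (2 * pi) ^ ?d * ?N ^ ?d * (H\<^sup>2 * ?A / (?N ^ ?d * ?N powr (2 * \<gamma>)))"
    by (intro mult_left_mono integral_hess_bound W i) auto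
  also have "\<dots> = H\<^sup>2 * (1 / (2 * pi) ^ ?d * ?A) / ?N powr (2 * \<gamma>)" by simp
  also have "\<dots> \<le> H\<^sup>2 * lp_const / ?N powr (2 * \<gamma>)"
    unfolding lp_const_def using pressure_const_nonneg
    by (intro divide_right_mono mult_left_mono) auto
  finally show ?thesis .
qed

lemma zygmund_norm_pressure: "zygmund_norm \<phi> (2 * \<gamma>) pressure \<le> ennreal (H\<^sup>2 * lp_const)"
  unfolding zygmund_norm_def
proof (rule SUP_least)
  fix k
  have "temp_Linf (lp_piece \<phi> k pressure) \<le> ennreal (H\<^sup>2 * lp_const / (2 ^ k) powr (2 * \<gamma>))"
    by (rule temp_Linf_lp_piece_le[OF lp_symbol_test lp_symbol_even pressure_measurable pressure_bound pressure_lp_bound])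
  then have "ennreal ((2 ^ k) powr (2 * \<gamma>)) * temp_Linf (lp_piece \<phi> k pressure) \<le>
      ennreal ((2 ^ k) powr (2 * \<gamma>)) * ennreal (H\<^sup>2 * lp_const / (2 ^ k) powr (2 * \<gamma>))"
    by (rule mult_left_mono) simp
  also have "\<dots> = ennreal (H\<^sup>2 * lp_const)"
    using lp_const_nonneg by (simp flip: ennreal_mult)
  finally show "ennreal ((2 ^ k) powr (2 * \<gamma>)) * temp_Linf (lp_piece \<phi> k pressure) \<le> ennreal (H\<^sup>2 * lp_const)" .
qed

lemma locally_integrable_pressure: "locally_integrable pressure"
  unfolding locally_integrable_def set_integrable_def
proof (intro allI impI)
  fix S :: "(real^'n) set" assume S: "compact S"
  then have [measurable]: "S \<in> sets borel" by (simp add: borel_compact)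
  have "integrable lborel (\<lambda>x. indicator S x * pressure x)"
    using emeasure_compact_finite[OF S]
    by (intro integrable_mult_bounded[OF _ _ pressure_bound] integrable_real_indicator) auto
  then show "integrable lborel (\<lambda>x. indicator S x *\<^sub>R pressure x)" by simp
qed

end

section \<open>The weak form of the equation, existence and uniqueness\<close>

lemma locally_integrable_mult_test:
  assumes q: "locally_integrable q" and f: "f \<in> test_functions"
  shows "integrable lborel (\<lambda>x. q x * f x)"
proof -
  have S: "compact (fun_support f)" using f by (simp add: test_functions_def)
  then have "integrable lborel (\<lambda>x. indicator (fun_support f) x * q x)"
    using q unfolding locally_integrable_def set_integrable_def by simp
  moreover obtain B where "\<And>x. \<bar>f x\<bar> \<le> B" using smooth_W_bound[OF test_functions_smooth_W[OF f]] by blast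
  moreover have "f \<in> borel_measurable lborel"
    using smooth_W_D(4)[OF test_functions_smooth_W[OF f]] by simp
  ultimately have "integrable lborel (\<lambda>x. (indicator (fun_support f) x * q x) * f x)"
    by (intro integrable_mult_bounded[where f = "\<lambda>x. indicator (fun_support f) x * q x"])
  moreover have "(indicator (fun_support f) x * q x) * f x = q x * f x" for x
    using not_in_fun_support[of x f] by (cases "x \<in> fun_support f") auto
  ultimately show ?thesis by simp
qed

text \<open>The signs of two distributional derivatives cancel, and their order is reversed when
  they pass to the tested function, in agreement with the index order in
  \<open>hess\<close>.\<close>

lemma solves_pressure_eq_iff:
  fixes v :: "real^'n \<Rightarrow> real^'n"
  assumes v: "\<And>i j. integrable lborel (\<lambda>x. v x $ i * v x $ j)" and q: "locally_integrable q"
  shows "solves_pressure_eq v q \<longleftrightarrow>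
    (\<forall>f\<in>test_functions. (LINT x|lborel. q x * lap f x) = - (LINT x|lborel. hess f x (v x)))"
proof -
  have l: "(\<Sum>i\<in>UNIV. distr_pd i (distr_pd i (distr_of q)) f) = (LINT x|lborel. q x * lap f x)"
    if f: "f \<in> test_functions" for f
    unfolding distr_pd_def distr_of_def lap_def sum_distrib_left
    by (simp add: Bochner_Integration.integral_sum locally_integrable_mult_test[OF q] test_functions_pd f)
  have r: "(\<Sum>i\<in>UNIV. \<Sum>j\<in>UNIV. distr_pd i (distr_pd j (distr_of (\<lambda>x. v x $ i * v x $ j))) f) =
      (LINT x|lborel. hess f x (v x))"
    if f: "f \<in> test_functions" for f
  proof -
    have i: "integrable lborel (\<lambda>x. v x $ i * v x $ j * pd j (pd i f) x)" for i j
    proof -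
      have W: "smooth_W (pd j (pd i f))" using f by (intro smooth_W_pd test_functions_smooth_W)
      obtain B where "\<And>x. \<bar>pd j (pd i f) x\<bar> \<le> B" using smooth_W_bound[OF W] by blast
      then show ?thesis using smooth_W_D(4)[OF W] by (intro integrable_mult_bounded[OF v]) auto
    qed
    show ?thesis
      unfolding distr_pd_def distr_of_def hess_def
      by (simp add: Bochner_Integration.integral_sum i mult.commute[of "pd _ _ _"])
  qed
  show ?thesis unfolding solves_pressure_eq_def using q l r by auto
qed

context pressure_data
begin

lemma decaying_solution_pressure: "decaying_solution v pressure"
  unfolding decaying_solution_def solves_pressure_eq_iff[OF vv_integrable locally_integrable_pressure]
  using pressure_equation test_functions_smooth_W pressure_tendsto_0 by blast

lemma decaying_solution_unique:
  assumes p: "decaying_solution v p"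
  shows "AE x in lborel. p x = pressure x"
proof -
  have lp: "locally_integrable p" and "(p \<longlongrightarrow> 0) at_infinity"
    using p by (auto simp: decaying_solution_def solves_pressure_eq_def)
  have "AE x in lborel. p x - pressure x = 0"
  proof (rule harmonic_decaying_eq_0)
    show "locally_integrable (\<lambda>x. p x - pressure x)"
      using lp locally_integrable_pressure unfolding locally_integrable_def by auto
    show "((\<lambda>x. p x - pressure x) \<longlongrightarrow> 0) at_infinity"
      using tendsto_diff[OF \<open>(p \<longlongrightarrow> 0) at_infinity\<close> pressure_tendsto_0] by simp
    fix f :: "real^'n \<Rightarrow> real" assume f: "f \<in> test_functions"
    have "integrable lborel (\<lambda>x. q x * lap f x)" if "locally_integrable q" for q
      unfolding lap_def sum_distrib_left
      by (intro Bochner_Integration.integrable_sum locally_integrable_mult_test that test_functions_pd f)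
    then have "(LINT x|lborel. (p x - pressure x) * lap f x) =
        (LINT x|lborel. p x * lap f x) - (LINT x|lborel. pressure x * lap f x)"
      using lp locally_integrable_pressure by (simp add: left_diff_distrib)
    also have "\<dots> = 0"
      using p decaying_solution_pressure f
      unfolding decaying_solution_def solves_pressure_eq_iff[OF vv_integrable lp]
        solves_pressure_eq_iff[OF vv_integrable locally_integrable_pressure] by simp
    finally show "(LINT x|lborel. (p x - pressure x) * lap f x) = 0" .
  qed
  then show ?thesis by eventually_elim simp
qed

end

lemma holder_seminorm:
  fixes v :: "real^'n \<Rightarrow> 'b::real_normed_vector"
  assumes "holder_norm \<gamma> v < \<infinity>"
  obtains H where "0 \<le> H" "ennreal H \<le> holder_norm \<gamma> v"
    "\<And>x y. norm (v x - v y) \<le> H * norm (x - y) powr \<gamma>"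
proof -
  let ?S = "SUP (x, y)\<in>{(x, y). x \<noteq> y}. ennreal (norm (v x - v y) / norm (x - y) powr \<gamma>)"
  have le: "?S \<le> holder_norm \<gamma> v" unfolding holder_norm_def by (simp add: add_increasing)
  with assms have fin: "?S < \<infinity>" by simp
  have "norm (v x - v y) \<le> enn2real ?S * norm (x - y) powr \<gamma>" for x y
  proof (cases "x = y")
    case False
    have "ennreal (norm (v x - v y) / norm (x - y) powr \<gamma>) \<le> ?S"
      using False by (intro SUP_upper2[of "(x, y)"]) auto
    \<comment> \<open>Finiteness is essential here, since \<open>enn2real\<close> sends infinity to
      0.\<close>
    also have "?S = ennreal (enn2real ?S)" using fin by simp
    finally have "norm (v x - v y) / norm (x - y) powr \<gamma> \<le> enn2real ?S"
      by (simp add: ennreal_le_iff)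
    then show ?thesis using False by (simp add: divide_le_eq)
  qed simp
  with le fin show ?thesis by (intro that[of "enn2real ?S"]) auto
qed

text \<open>The constant precedes the field in the quantifiers and is uniform over all fields
  supported in K. Uniqueness is up to null sets because the equation sees only integrals of the
  solution.\<close>

theorem theorem3p2:
  fixes \<gamma> :: real and \<phi> :: "real^'n \<Rightarrow> real" and K :: "(real^'n) set"
  assumes "CARD('n) \<ge> 2"
    and "0 < \<gamma>" and "\<gamma> \<le> 1 / 2"
    and "lp_cutoff \<phi>"
    and "compact K"
  shows "\<exists>C>0. \<forall>v :: real^'n \<Rightarrow> real^'n.
    v \<in> holder_compact \<gamma> \<and> fun_support v \<subseteq> K \<and> div_free v \<longrightarrow>
    (\<exists>q. decaying_solution v q \<and>
         (\<forall>p. decaying_solution v p \<longrightarrow> (AE x in lborel. p x = q x)) \<and>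
         zygmund_norm \<phi> (2 * \<gamma>) q \<le> ennreal C * (holder_norm \<gamma> v)\<^sup>2)"
proof -
  obtain R where R: "0 < R" "\<And>x. x \<in> K \<Longrightarrow> norm x \<le> R"
    using compact_imp_bounded[OF assms(5)] by (auto simp: bounded_pos)
  \<comment> \<open>R comes from K alone, and \<open>lp_const\<close> from \<open>\<phi>\<close>,
    \<gamma> and R alone, so C is available before any field is fixed; the maximum with 1 makes it
    positive.\<close>
  define C where "C = max 1 (pressure_data.lp_const \<phi> \<gamma> R)"
  show ?thesis
  proof (intro exI[of _ C] conjI allI impI)
    show "0 < C" by (simp add: C_def)
    fix v :: "real^'n \<Rightarrow> real^'n"
    assume v: "v \<in> holder_compact \<gamma> \<and> fun_support v \<subseteq> K \<and> div_free v"
    then have "holder_norm \<gamma> v < \<infinity>" by (simp add: holder_compact_def)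
    then obtain H where Hv: "0 \<le> H" "ennreal H \<le> holder_norm \<gamma> v"
      "\<And>x y. norm (v x - v y) \<le> H * norm (x - y) powr \<gamma>"
      using holder_seminorm by blast
    interpret pressure_data \<phi> v \<gamma> H R
    proof
      show "v x = 0" if "R < norm x" for x
        using that v R(2)[of x] by (intro not_in_fun_support) auto
    qed (use assms R Hv v in auto)
    have "zygmund_norm \<phi> (2 * \<gamma>) pressure \<le> ennreal (H\<^sup>2 * lp_const)" by (rule zygmund_norm_pressure)
    also have "\<dots> \<le> ennreal (C * H\<^sup>2)"
      unfolding C_def by (intro ennreal_leI) (simp add: mult.commute[of _ "H\<^sup>2"] mult_left_mono)
    also have "\<dots> = ennreal C * (ennreal H)\<^sup>2"
      using Hv(1) by (simp add: C_def ennreal_mult ennreal_power)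
    also have "\<dots> \<le> ennreal C * (holder_norm \<gamma> v)\<^sup>2"
      by (intro mult_left_mono power_mono Hv(2)) auto
    finally show "\<exists>q. decaying_solution v q \<and>
         (\<forall>p. decaying_solution v p \<longrightarrow> (AE x in lborel. p x = q x)) \<and>
         zygmund_norm \<phi> (2 * \<gamma>) q \<le> ennreal C * (holder_norm \<gamma> v)\<^sup>2"
      using decaying_solution_pressure decaying_solution_unique by blast
  qed
qed

end
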